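(* Assume that $h$ is sufficiently small such that the discrete inf-sup property $$\sup_{\mathbf v_h\in\mathbf V_{h,\ast}}\frac{b(\lambda_h,\mathbf v_h)}{\|\mathbf v_h\|_1}\ge\beta\|\lambda_h\|_1\quad\text{for all }\lambda_h\in V_h$$ holds with a constant $\beta>0$ independent of $h$. Then the problem: determine $(\mathbf u_h,\lambda_h)\in\mathbf V_h\times V_h$ with $Q_{\mathcal K_{\hat{\mathbf z},h}}\mathbf u_h=Q_{\mathcal K_{\hat{\mathbf z},h}}\mathbf z$ such that $$a(\mathbf u_h,\mathbf v_h)+b(\lambda_h,\mathbf v_h)=0\quad\text{for all }\mathbf v_h\in\mathbf V_h,$$ $$b(\mu_h,\mathbf u_h)=b(\mu_h,\mathbf z)=(\mu_h,z)_1\quad\text{for all }\mu_h\in V_h,$$ has a unique solution.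
   Context: Let $d\in\{2,3\}$ and let $\Omega\subset\mathbb R^d$ be a bounded connected open polygonal (polyhedral) domain with Lipschitz boundary. $\mathbf H^1(\Omega)=H^1(\Omega)^d$; $(\cdot,\cdot)_1$ and $\|\cdot\|_1$ are the standard $H^1$ inner product and norm (for scalar and vector functions: $L^2$ inner product of the functions plus that of their gradients). Let $\mathbf z=z\hat{\mathbf z}$ with $z\in H^{1,\infty}(\Omega)$ and $\hat{\mathbf z}\in H^{1,\infty}(\Omega)^d$, $\|\hat{\mathbf z}\|=1$ (Euclidean norm) a.e. on $\Omega$; moreover $\hat{\mathbf z}\in H^{k+1,\infty}(\Omega)^d$, with $k$ as below. Set $\mathbf E(\mathbf v)=\nabla\mathbf v+\nabla\mathbf v^T$, $a(\mathbf u,\mathbf v)=\int_\Omega\mathbf E(\mathbf u):\mathbf E(\mathbf v)\,d\mathbf x$ for $\mathbf u,\mathbf v\in\mathbf H^1(\Omega)$, and $b(\lambda,\mathbf v)=(\lambda,\mathbf v\cdot\hat{\mathbf z})_1$ for $\lambda\in H^1(\Omega)$, $\mathbf v\in\mathbf H^1(\Omega)$. Let $K=\{\mathbf v\in\mathbf H^1(\Omega): a(\mathbf v,\mathbf v)=0\}$ (rigid motions). For a closed subspace $W\subset\mathbf H^1(\Omega)$, $Q_W$ is the $(\cdot,\cdot)_1$-orthogonal projection onto $W$. Let $\{\mathcal T_h\}_{h>0}$ be a shape regular (not necessarily quasi-uniform) family of simplicial triangulations of $\Omega$ ($h$ is the mesh size), $V_h$ the space of continuous piecewise polynomials of degree $k\ge1$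 on $\mathcal T_h$, $\mathbf V_h=V_h^d$. Set $\ker_h(b)=\{\mathbf v_h\in\mathbf V_h: b(\lambda_h,\mathbf v_h)=0\ \forall\lambda_h\in V_h\}$, $\mathcal K_{\hat{\mathbf z},h}=\ker_h(b)\cap K$, and $\mathbf V_{h,\ast}=\{\mathbf v_h\in\mathbf V_h: Q_{\mathcal K_{\hat{\mathbf z},h}}\mathbf v_h=0\}$. *)

theory Defs
  imports "HOL-Analysis.Analysis"
begin

section \<open>Domains\<close>

text \<open>Near each boundary point, \<open>\<Omega>\<close> is the strict epigraph, in some direction \<open>\<nu>\<close>, of a
  Lipschitz function \<open>\<gamma>\<close> on the hyperplane orthogonal to \<open>\<nu>\<close>.\<close>

definition lipschitz_boundary :: "(real^'n) set \<Rightarrow> bool" where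
  "lipschitz_boundary \<Omega> \<longleftrightarrow>
     (\<forall>x0\<in>frontier \<Omega>. \<exists>r \<nu> \<gamma> L. r > 0 \<and> norm \<nu> = 1 \<and> L-lipschitz_on {y. y \<bullet> \<nu> = 0} \<gamma> \<and>
        \<Omega> \<inter> ball x0 r = {x \<in> ball x0 r. x \<bullet> \<nu> > \<gamma> (x - (x \<bullet> \<nu>) *\<^sub>R \<nu>)})"

definition polyhedral_lipschitz_domain :: "(real^'n) set \<Rightarrow> bool" where
  "polyhedral_lipschitz_domain \<Omega> \<longleftrightarrow>
     open \<Omega> \<and> connected \<Omega> \<and> bounded \<Omega> \<and> \<Omega> \<noteq> {} \<and>
     (\<exists>P. finite P \<and> (\<forall>p\<in>P. polytope p) \<and> closure \<Omega> = \<Union>P) \<and>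
     lipschitz_boundary \<Omega>"

section \<open>Weak derivatives and Sobolev spaces\<close>

definition partial :: "'n \<Rightarrow> (real^'n \<Rightarrow> real) \<Rightarrow> real^'n \<Rightarrow> real" where
  "partial i f x = frechet_derivative f (at x) (axis i 1)"

primrec C_k :: "nat \<Rightarrow> (real^'n \<Rightarrow> real) \<Rightarrow> bool" where
  "C_k 0 f \<longleftrightarrow> continuous_on UNIV f"
| "C_k (Suc m) f \<longleftrightarrow> (\<forall>x. f differentiable (at x)) \<and> (\<forall>i. C_k m (partial i f))"

definition test_functions :: "(real^'n) set \<Rightarrow> (real^'n \<Rightarrow> real) set" where
  "test_functions \<Omega> =
     {\<phi>. (\<forall>m. C_k m \<phi>) \<and> compact (closure {x. \<phi> x \<noteq> 0}) \<and> closure {x. \<phi> x \<noteq> 0} \<subseteq> \<Omega>}"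

definition locally_integrable :: "(real^'n) set \<Rightarrow> (real^'n \<Rightarrow> real) \<Rightarrow> bool" where
  "locally_integrable \<Omega> f \<longleftrightarrow> (\<forall>C. compact C \<and> C \<subseteq> \<Omega> \<longrightarrow> f absolutely_integrable_on C)"

definition has_weak_partial ::
  "(real^'n) set \<Rightarrow> 'n \<Rightarrow> (real^'n \<Rightarrow> real) \<Rightarrow> (real^'n \<Rightarrow> real) \<Rightarrow> bool" where
  "has_weak_partial \<Omega> i f g \<longleftrightarrow>
     locally_integrable \<Omega> f \<and> locally_integrable \<Omega> g \<and>
     (\<forall>\<phi>\<in>test_functions \<Omega>.
        (LINT x|lebesgue_on \<Omega>. f x * partial i \<phi> x) = - (LINT x|lebesgue_on \<Omega>. g x * \<phi> x))"

text \<open>Elements of the function spaces are functions on the whole of \<open>\<real>\<^sup>n\<close>, whose values outside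
  \<open>\<Omega>\<close> are irrelevant. A weak derivative is only determined almost everywhere on \<open>\<Omega>\<close>;
  \<open>weak_partial\<close> picks a representative, the same one for functions that agree almost everywhere
  on \<open>\<Omega>\<close>.\<close>

definition weak_partial :: "(real^'n) set \<Rightarrow> 'n \<Rightarrow> (real^'n \<Rightarrow> real) \<Rightarrow> real^'n \<Rightarrow> real" where
  "weak_partial \<Omega> i f = (SOME g. has_weak_partial \<Omega> i f g)"

definition L2 :: "(real^'n) set \<Rightarrow> (real^'n \<Rightarrow> real) set" where
  "L2 \<Omega> = {f \<in> borel_measurable (lebesgue_on \<Omega>). integrable (lebesgue_on \<Omega>) (\<lambda>x. (f x)\<^sup>2)}"

definition Linf :: "(real^'n) set \<Rightarrow> (real^'n \<Rightarrow> real) set" where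
  "Linf \<Omega> = {f \<in> borel_measurable (lebesgue_on \<Omega>). \<exists>C. AE x in lebesgue_on \<Omega>. \<bar>f x\<bar> \<le> C}"

definition H1 :: "(real^'n) set \<Rightarrow> (real^'n \<Rightarrow> real) set" where
  "H1 \<Omega> = {f \<in> L2 \<Omega>. \<forall>i. \<exists>g\<in>L2 \<Omega>. has_weak_partial \<Omega> i f g}"

text \<open>\<open>Hinf m \<Omega>\<close> is \<open>H\<^bsup>m,\<infinity>\<^esup>(\<Omega>)\<close>: all weak derivatives up to order \<open>m\<close> are essentially bounded.\<close>

primrec Hinf :: "nat \<Rightarrow> (real^'n) set \<Rightarrow> (real^'n \<Rightarrow> real) set" where
  "Hinf 0 \<Omega> = Linf \<Omega>"
| "Hinf (Suc m) \<Omega> = {f \<in> Linf \<Omega>. \<forall>i. \<exists>g\<in>Hinf m \<Omega>. has_weak_partial \<Omega> i f g}"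

text \<open>The \<open>n\<close>-fold power \<open>X\<^sup>n\<close> of a space \<open>X\<close> of scalar functions.\<close>

definition vec_space :: "(real^'n \<Rightarrow> real) set \<Rightarrow> (real^'n \<Rightarrow> real^'n) set" where
  "vec_space X = {v. \<forall>i. (\<lambda>x. v x $ i) \<in> X}"

definition wgrad :: "(real^'n) set \<Rightarrow> (real^'n \<Rightarrow> real) \<Rightarrow> real^'n \<Rightarrow> real^'n" where
  "wgrad \<Omega> f x = (\<chi> i. weak_partial \<Omega> i f x)"

definition wgrad_vec :: "(real^'n) set \<Rightarrow> (real^'n \<Rightarrow> real^'n) \<Rightarrow> real^'n \<Rightarrow> real^'n^'n" where
  "wgrad_vec \<Omega> v x = (\<chi> i. wgrad \<Omega> (\<lambda>y. v y $ i) x)"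

text \<open>On matrices, \<open>\<bullet>\<close> is the Frobenius product \<open>A : B\<close>.\<close>

definition H1_inner :: "(real^'n) set \<Rightarrow> (real^'n \<Rightarrow> real) \<Rightarrow> (real^'n \<Rightarrow> real) \<Rightarrow> real" where
  "H1_inner \<Omega> f g =
     (LINT x|lebesgue_on \<Omega>. f x * g x) + (LINT x|lebesgue_on \<Omega>. wgrad \<Omega> f x \<bullet> wgrad \<Omega> g x)"

definition H1_inner_vec ::
  "(real^'n) set \<Rightarrow> (real^'n \<Rightarrow> real^'n) \<Rightarrow> (real^'n \<Rightarrow> real^'n) \<Rightarrow> real" where
  "H1_inner_vec \<Omega> u v =
     (LINT x|lebesgue_on \<Omega>. u x \<bullet> v x) +
     (LINT x|lebesgue_on \<Omega>. wgrad_vec \<Omega> u x \<bullet> wgrad_vec \<Omega> v x)"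

definition H1_norm :: "(real^'n) set \<Rightarrow> (real^'n \<Rightarrow> real) \<Rightarrow> real" where
  "H1_norm \<Omega> f = sqrt (H1_inner \<Omega> f f)"

definition H1_norm_vec :: "(real^'n) set \<Rightarrow> (real^'n \<Rightarrow> real^'n) \<Rightarrow> real" where
  "H1_norm_vec \<Omega> v = sqrt (H1_inner_vec \<Omega> v v)"

text \<open>Orthogonal projection onto a subspace \<open>W\<close> with respect to \<open>(\<cdot>,\<cdot>)\<^sub>1\<close>. The description is
  unique for those \<open>W\<close> on which \<open>H1_norm_vec\<close> only vanishes at the zero function, such as the
  subspaces of the finite element spaces below.\<close>

definition proj_H1 ::
  "(real^'n) set \<Rightarrow> (real^'n \<Rightarrow> real^'n) set \<Rightarrow> (real^'n \<Rightarrow> real^'n) \<Rightarrow> (real^'n \<Rightarrow> real^'n)" where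
  "proj_H1 \<Omega> W v = (THE p. p \<in> W \<and> (\<forall>w\<in>W. H1_inner_vec \<Omega> (\<lambda>x. v x - p x) w = 0))"

section \<open>The bilinear forms\<close>

definition strain :: "(real^'n) set \<Rightarrow> (real^'n \<Rightarrow> real^'n) \<Rightarrow> real^'n \<Rightarrow> real^'n^'n" where
  "strain \<Omega> v x = wgrad_vec \<Omega> v x + transpose (wgrad_vec \<Omega> v x)"

definition form_a ::
  "(real^'n) set \<Rightarrow> (real^'n \<Rightarrow> real^'n) \<Rightarrow> (real^'n \<Rightarrow> real^'n) \<Rightarrow> real" where
  "form_a \<Omega> u v = (LINT x|lebesgue_on \<Omega>. strain \<Omega> u x \<bullet> strain \<Omega> v x)"

definition form_b ::
  "(real^'n) set \<Rightarrow> (real^'n \<Rightarrow> real^'n) \<Rightarrow> (real^'n \<Rightarrow> real) \<Rightarrow> (real^'n \<Rightarrow> real^'n) \<Rightarrow> real" where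
  "form_b \<Omega> zhat lam v = H1_inner \<Omega> lam (\<lambda>x. v x \<bullet> zhat x)"

definition rigid_motions :: "(real^'n) set \<Rightarrow> (real^'n \<Rightarrow> real^'n) set" where
  "rigid_motions \<Omega> = {v \<in> vec_space (H1 \<Omega>). form_a \<Omega> v v = 0}"

section \<open>Triangulations and finite element spaces\<close>

text \<open>The library notion \<open>triangulation\<close> requires any two simplices to meet in a common face.\<close>

definition simplicial_triangulation :: "(real^'n) set \<Rightarrow> (real^'n) set set \<Rightarrow> bool" where
  "simplicial_triangulation \<Omega> T \<longleftrightarrow>
     triangulation T \<and> (\<forall>S\<in>T. int CARD('n) simplex S) \<and> \<Union>T = closure \<Omega>"

definition mesh_size :: "(real^'n) set set \<Rightarrow> real" where
  "mesh_size T = Max (diameter ` T)"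

text \<open>The diameter of each simplex is uniformly comparable to the radius of some inscribed ball.\<close>

definition shape_regular :: "real set \<Rightarrow> (real \<Rightarrow> (real^'n) set set) \<Rightarrow> bool" where
  "shape_regular H T \<longleftrightarrow>
     (\<exists>\<sigma>>0. \<forall>h\<in>H. \<forall>S\<in>T h. \<exists>c r. r > 0 \<and> cball c r \<subseteq> S \<and> diameter S \<le> \<sigma> * r)"

definition polys :: "nat \<Rightarrow> (real^'n \<Rightarrow> real) set" where
  "polys k = {p. \<exists>c. \<forall>x. p x =
     (\<Sum>\<alpha> | (\<Sum>i\<in>UNIV. \<alpha> i) \<le> k. c \<alpha> * (\<Prod>i\<in>UNIV. (x $ i) ^ \<alpha> i))}"

text \<open>Finite element functions live on \<open>closure \<Omega>\<close>; as HOL functions are total, they are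
  normalized to vanish elsewhere, so that equality of functions is equality in the space.\<close>

definition fe_space :: "(real^'n) set \<Rightarrow> (real^'n) set set \<Rightarrow> nat \<Rightarrow> (real^'n \<Rightarrow> real) set" where
  "fe_space \<Omega> T k =
     {f. continuous_on (closure \<Omega>) f \<and> (\<forall>S\<in>T. \<exists>p\<in>polys k. \<forall>x\<in>S. f x = p x) \<and>
         (\<forall>x. x \<notin> closure \<Omega> \<longrightarrow> f x = 0)}"

definition ker_b ::
  "(real^'n) set \<Rightarrow> (real^'n) set set \<Rightarrow> nat \<Rightarrow> (real^'n \<Rightarrow> real^'n) \<Rightarrow> (real^'n \<Rightarrow> real^'n) set" where
  "ker_b \<Omega> T k zhat =
     {v \<in> vec_space (fe_space \<Omega> T k). \<forall>lam\<in>fe_space \<Omega> T k. form_b \<Omega> zhat lam v = 0}"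

definition rigid_ker ::
  "(real^'n) set \<Rightarrow> (real^'n) set set \<Rightarrow> nat \<Rightarrow> (real^'n \<Rightarrow> real^'n) \<Rightarrow> (real^'n \<Rightarrow> real^'n) set" where
  "rigid_ker \<Omega> T k zhat = ker_b \<Omega> T k zhat \<inter> rigid_motions \<Omega>"

definition fe_star ::
  "(real^'n) set \<Rightarrow> (real^'n) set set \<Rightarrow> nat \<Rightarrow> (real^'n \<Rightarrow> real^'n) \<Rightarrow> (real^'n \<Rightarrow> real^'n) set" where
  "fe_star \<Omega> T k zhat =
     {v \<in> vec_space (fe_space \<Omega> T k). proj_H1 \<Omega> (rigid_ker \<Omega> T k zhat) v = (\<lambda>_. 0)}"

text \<open>The supremum is taken in the extended reals and, as usual, over nonzero functions only.\<close>

definition discrete_inf_sup ::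
  "(real^'n) set \<Rightarrow> (real^'n) set set \<Rightarrow> nat \<Rightarrow> (real^'n \<Rightarrow> real^'n) \<Rightarrow> real \<Rightarrow> bool" where
  "discrete_inf_sup \<Omega> T k zhat \<beta> \<longleftrightarrow>
     (\<forall>lam\<in>fe_space \<Omega> T k.
        (SUP v\<in>fe_star \<Omega> T k zhat - {\<lambda>_. 0}. ereal (form_b \<Omega> zhat lam v / H1_norm_vec \<Omega> v))
          \<ge> ereal (\<beta> * H1_norm \<Omega> lam))"

end

theory Submission
  imports Defs "HOL-Library.Function_Algebras" "HOL-Computational_Algebra.Polynomial"
begin

text \<open>Existence and uniqueness. The discrete spaces have finite dimension, and the problem is linear with a
  symmetric system matrix, so it suffices that the homogeneous problem has no solution except zero. Let
  \<open>(u, lam)\<close> solve it. Testing the first equation with \<open>u\<close> and the second with \<open>lam\<close> gives \<open>a(u, u) = 0\<close>, so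
  \<open>u\<close> is a rigid motion in the discrete kernel of \<open>b\<close>; its projection onto the space of these vanishes, so
  \<open>u = 0\<close>. Now \<open>b(lam, v) = 0\<close> for all \<open>v\<close>, and the inf-sup condition forces \<open>lam = 0\<close>. The condition on the
  projection enters as one more constraint, with its own multiplier to keep the system square and symmetric;
  this multiplier turns out to be zero. This is \<open>constrained_saddle_point_ex1\<close>, a statement of linear algebra.

  To apply it, the forms must be bilinear on the spaces concerned. This is not automatic, since they are
  written with an arbitrary choice of weak derivatives, and with integrals that are zero by convention for
  functions that are not integrable. Three facts about weak derivatives provide it.

  \<^item> Weak derivatives are unique almost everywhere (\<open>weakly_zero_imp_AE_zero\<close>, by mollification), so the
    chosen ones depend linearly on the function up to null sets.

  \<^item> Finite element functions are weakly differentiable with bounded derivatives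
    (\<open>fe_space_subset_Hinf_1\<close>). They are Lipschitz along segments in the domain and differentiable off the faces
    of the mesh, and difference quotients can be integrated by parts (\<open>lipschitz_has_weak_partial\<close>).

  \<^item> Products of bounded functions with bounded weak derivatives obey the product rule
    (\<open>has_weak_partial_mult\<close>, by doubling of variables). So \<open>v \<bullet> zhat\<close> and \<open>zvec = z zhat\<close> lie in \<open>H\<^sup>1\<close>.

  Positive definiteness of the \<open>H\<^sup>1\<close> inner product on finite element functions holds because these are
  continuous. The right-hand sides \<open>b(\<mu>, zvec)\<close> and \<open>(\<mu>, z)\<^sub>1\<close> agree because \<open>zvec \<bullet> zhat = z\<close> almost everywhere.\<close>

section \<open>Linear algebra of constrained saddle point problems\<close>

text \<open>With pointwise operations, spaces of functions are subspaces of a real vector space, so that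
  \<^const>\<open>span\<close>, \<^const>\<open>subspace\<close> and \<^const>\<open>linear\<close> apply to them.\<close>

instantiation "fun" :: (type, real_vector) real_vector
begin

definition scaleR_fun :: "real \<Rightarrow> ('a \<Rightarrow> 'b) \<Rightarrow> 'a \<Rightarrow> 'b" where
  "scaleR_fun c f = (\<lambda>x. c *\<^sub>R f x)"

instance
  by standard (auto simp: fun_eq_iff scaleR_fun_def algebra_simps)

end

lemma scaleR_fun_apply [simp]: "(c *\<^sub>R f) x = c *\<^sub>R f x"
  by (simp add: scaleR_fun_def)

text \<open>Linearity is required on a set only: the forms of the problem are linear where weak derivatives
  exist, not on all functions.\<close>

definition functional_on :: "'v::real_vector set \<Rightarrow> ('v \<Rightarrow> real) \<Rightarrow> bool" where
  "functional_on U F \<longleftrightarrow>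
     (\<forall>x\<in>U. \<forall>y\<in>U. F (x + y) = F x + F y) \<and> (\<forall>x\<in>U. \<forall>c. F (c *\<^sub>R x) = c * F x)"

definition bilinear_on ::
  "'v::real_vector set \<Rightarrow> 'w::real_vector set \<Rightarrow> ('v \<Rightarrow> 'w \<Rightarrow> real) \<Rightarrow> bool" where
  "bilinear_on U W B \<longleftrightarrow>
     (\<forall>y\<in>W. functional_on U (\<lambda>x. B x y)) \<and> (\<forall>x\<in>U. functional_on W (B x))"

lemma functional_onD:
  assumes "functional_on U F"
  shows "x \<in> U \<Longrightarrow> y \<in> U \<Longrightarrow> F (x + y) = F x + F y"
    and "x \<in> U \<Longrightarrow> F (c *\<^sub>R x) = c * F x"
  using assms by (auto simp: functional_on_def)

lemma functional_on_zero: "functional_on U F \<Longrightarrow> subspace U \<Longrightarrow> F 0 = 0"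
  using functional_onD(2)[of U F 0 0] by (simp add: subspace_0)

lemma functional_on_diff:
  assumes "functional_on U F" "subspace U" "x \<in> U" "y \<in> U"
  shows "F (x - y) = F x - F y"
  using functional_onD(1)[OF assms(1), of "x - y" y] assms by (simp add: subspace_diff)

lemma functional_on_sum:
  assumes F: "functional_on U F" and U: "subspace U" and "finite I" "\<And>i. i \<in> I \<Longrightarrow> g i \<in> U"
  shows "F (\<Sum>i\<in>I. c i *\<^sub>R g i) = (\<Sum>i\<in>I. c i * F (g i))"
  using assms(3,4)
proof (induction I rule: finite_induct)
  case empty
  then show ?case using functional_on_zero[OF F U] by simp
next
  case (insert i I)
  have "(\<Sum>i\<in>I. c i *\<^sub>R g i) \<in> U" using insert by (intro subspace_sum U subspace_scale) auto
  then show ?case using insert functional_onD[OF F] U by (simp add: subspace_scale)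
qed

lemma functional_on_subset: "functional_on U F \<Longrightarrow> V \<subseteq> U \<Longrightarrow> functional_on V F"
  by (auto simp: functional_on_def subset_iff)

lemma bilinear_on_subset: "bilinear_on U W B \<Longrightarrow> U' \<subseteq> U \<Longrightarrow> W' \<subseteq> W \<Longrightarrow> bilinear_on U' W' B"
  unfolding bilinear_on_def by (meson functional_on_subset subsetD)

lemma bilinear_onD:
  assumes "bilinear_on U W B"
  shows "y \<in> W \<Longrightarrow> functional_on U (\<lambda>x. B x y)" "x \<in> U \<Longrightarrow> functional_on W (B x)"
  using assms by (auto simp: bilinear_on_def)

text \<open>Gram-Schmidt: a new spanning vector \<open>e\<close> is replaced by its component \<open>d\<close> orthogonal to the old
  span, and the old representer is corrected by a multiple of \<open>d\<close>.\<close>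

lemma riesz_positive_definite:
  assumes "finite S" "bilinear_on (span S) (span S) ip"
    and "\<And>x y. x \<in> span S \<Longrightarrow> y \<in> span S \<Longrightarrow> ip x y = ip y x"
    and "\<And>x. x \<in> span S \<Longrightarrow> x \<noteq> 0 \<Longrightarrow> ip x x > 0"
    and "functional_on (span S) F"
  shows "\<exists>p\<in>span S. \<forall>y\<in>span S. ip p y = F y"
  using assms
proof (induction S arbitrary: F rule: finite_induct)
  case empty
  then show ?case
    using functional_on_zero[OF bilinear_onD(2)[OF empty(1)], of 0] functional_on_zero[OF empty(4)]
    by (auto simp: subspace_0)
next
  case (insert e S)
  let ?V = "span (insert e S)"
  note bil = insert.prems(1) and sym = insert.prems(2) and pos = insert.prems(3) and F = insert.prems(4)
  have sub: "span S \<subseteq> ?V" by (simp add: span_mono subset_insertI)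
  have eV: "e \<in> ?V" by (simp add: span_base)
  have IH: "\<exists>p\<in>span S. \<forall>y\<in>span S. ip p y = G y" if "functional_on (span S) G" for G
    using insert.IH[OF bilinear_on_subset[OF bil sub sub] _ _ that] sym pos sub by blast
  show ?case
  proof (cases "e \<in> span S")
    case True
    then show ?thesis using IH[OF functional_on_subset[OF F sub]] by (simp add: span_redundant)
  next
    case False
    obtain q where q: "q \<in> span S" "\<And>y. y \<in> span S \<Longrightarrow> ip q y = ip e y"
      using IH[OF functional_on_subset[OF bilinear_onD(2)[OF bil eV] sub]] by blast
    obtain p where p: "p \<in> span S" "\<And>y. y \<in> span S \<Longrightarrow> ip p y = F y"
      using IH[OF functional_on_subset[OF F sub]] by blast
    \<comment> \<open>The vector \<open>q\<close> is the orthogonal projection of \<open>e\<close> onto the old span.\<close>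
    define d where "d = e - q"
    define c where "c = F d / ip d d"
    have dV: "d \<in> ?V" unfolding d_def using eV q sub by (intro span_diff) auto
    have "d \<noteq> 0" using False q by (auto simp: d_def)
    then have dd: "ip d d > 0" using pos dV by auto
    have orth: "ip d y = 0" if "y \<in> span S" for y
      using functional_on_diff[OF bilinear_onD(1)[OF bil, of y] subspace_span eV, of q] q that sub
      by (auto simp: d_def)
    have "ip (p + c *\<^sub>R d) y = F y" if y: "y \<in> ?V" for y
    proof -
      obtain k where "y - k *\<^sub>R e \<in> span S"
        using y span_breakdown_eq[of y e S] by auto
      then have "(y - k *\<^sub>R e) + k *\<^sub>R q \<in> span S" using q by (intro span_add span_scale) auto
      then obtain w where w: "w \<in> span S" "w = (y - k *\<^sub>R e) + k *\<^sub>R q" by blast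
      then have w: "w \<in> span S" "y = w + k *\<^sub>R d"
        by (auto simp only:) (simp add: d_def algebra_simps)
      have V: "p \<in> ?V" "w \<in> ?V" "c *\<^sub>R d \<in> ?V" "k *\<^sub>R d \<in> ?V" using p w sub dV by (auto intro: span_scale)
      have "ip (p + c *\<^sub>R d) y = ip p y + c * ip d y"
        using functional_onD[OF bilinear_onD(1)[OF bil y]] V dV by simp
      also have "ip p y = ip p w + k * ip p d"
        using functional_onD[OF bilinear_onD(2)[OF bil, of p]] V dV w by simp
      also have "ip p d = 0" using sym[of p d] orth[OF p(1)] V dV by simp
      also have "ip d y = ip d w + k * ip d d"
        using functional_onD[OF bilinear_onD(2)[OF bil, of d]] V dV w by simp
      also have "ip d w = 0" using orth w by simp
      finally have "ip (p + c *\<^sub>R d) y = F w + k * F d"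
        using dd p(2) w(1) by (simp add: c_def)
      then show ?thesis using functional_onD[OF F] V dV w by simp
    qed
    moreover have "p + c *\<^sub>R d \<in> ?V" using p sub dV by (intro span_add span_scale) auto
    ultimately show ?thesis by blast
  qed
qed

text \<open>An indefinite form cannot be orthogonalised, but it can be handled by least squares. The form
  \<open>ip x y = (\<Sum>e\<in>S. B x e * B y e)\<close> is positive definite because \<open>B\<close> is nondegenerate. Riesz for \<open>ip\<close>
  gives an \<open>x\<close> that solves the normal equations: the residuals \<open>r e = B x e - F e\<close> satisfy
  \<open>(\<Sum>e\<in>S. r e * B y e) = 0\<close> for all \<open>y\<close>. So \<open>w = (\<Sum>e\<in>S. r e *\<^sub>R e)\<close> is annihilated by \<open>B\<close>, hence zero,
  and the sum of the squared residuals is \<open>B x w - F w = 0\<close>.\<close>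

lemma nondegenerate_form_represents:
  assumes S: "finite S" and bil: "bilinear_on (span S) (span S) B"
    and sym: "\<And>x y. x \<in> span S \<Longrightarrow> y \<in> span S \<Longrightarrow> B x y = B y x"
    and nondeg: "\<And>x. x \<in> span S \<Longrightarrow> (\<And>y. y \<in> span S \<Longrightarrow> B x y = 0) \<Longrightarrow> x = 0"
    and F: "functional_on (span S) F"
  shows "\<exists>x\<in>span S. \<forall>y\<in>span S. B x y = F y"
proof -
  define ip where "ip x y = (\<Sum>e\<in>S. B x e * B y e)" for x y
  have e: "e \<in> span S" if "e \<in> S" for e using that by (rule span_base)
  note lin1 = functional_onD[OF bilinear_onD(1)[OF bil]]
  note lin2 = functional_onD[OF bilinear_onD(2)[OF bil]]
  have fin: "F (\<Sum>e\<in>S. c e *\<^sub>R e) = (\<Sum>e\<in>S. c e * F e)" for c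
    by (rule functional_on_sum[OF F subspace_span S e])
  have Bin: "B x (\<Sum>e\<in>S. c e *\<^sub>R e) = (\<Sum>e\<in>S. c e * B x e)" if "x \<in> span S" for x c
    by (rule functional_on_sum[OF bilinear_onD(2)[OF bil that] subspace_span S e])
  have zero: "x = 0" if x: "x \<in> span S" and B0: "\<And>e. e \<in> S \<Longrightarrow> B x e = 0" for x
  proof (rule nondeg[OF x])
    fix y assume "y \<in> span S"
    then obtain c where "y = (\<Sum>e\<in>S. c e *\<^sub>R e)" using S by (auto simp: span_finite)
    then show "B x y = 0" using Bin[OF x] B0 by simp
  qed
  have "\<exists>x\<in>span S. \<forall>y\<in>span S. ip x y = (\<Sum>e\<in>S. F e * B y e)"
  proof (rule riesz_positive_definite[OF S])
    show "bilinear_on (span S) (span S) ip"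
      unfolding bilinear_on_def functional_on_def ip_def
      by (auto simp: lin1 e sum.distrib[symmetric] sum_distrib_left algebra_simps)
    show "ip x y = ip y x" for x y by (simp add: ip_def mult.commute)
    show "ip x x > 0" if x: "x \<in> span S" "x \<noteq> 0" for x
    proof -
      obtain e where "e \<in> S" "B x e \<noteq> 0" using zero x by blast
      then show ?thesis unfolding ip_def using S
        by (intro sum_pos2[where i = e]) (auto simp: zero_less_mult_iff neq_iff)
    qed
    show "functional_on (span S) (\<lambda>y. \<Sum>e\<in>S. F e * B y e)"
      unfolding functional_on_def
      by (auto simp: lin1 e sum.distrib[symmetric] sum_distrib_left algebra_simps)
  qed
  then obtain x where x: "x \<in> span S" and xy: "\<And>y. y \<in> span S \<Longrightarrow> ip x y = (\<Sum>e\<in>S. F e * B y e)"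
    by blast
  define w where "w = (\<Sum>e\<in>S. (B x e - F e) *\<^sub>R e)"
  have w: "w \<in> span S" unfolding w_def by (intro span_sum span_scale e)
  have "B w y = 0" if y: "y \<in> span S" for y
  proof -
    have "B w y = (\<Sum>e\<in>S. (B x e - F e) * B y e)" using sym[OF w y] Bin[OF y] by (simp add: w_def)
    also have "\<dots> = ip x y - (\<Sum>e\<in>S. F e * B y e)"
      by (simp add: ip_def left_diff_distrib sum_subtractf)
    finally show ?thesis using xy[OF y] by simp
  qed
  then have "w = 0" by (rule nondeg[OF w])
  have "(\<Sum>e\<in>S. (B x e - F e)\<^sup>2) = B x w - F w"
    unfolding w_def Bin[OF x] fin sum_subtractf[symmetric]
    by (intro sum.cong) (auto simp: power2_eq_square algebra_simps)
  also have "\<dots> = 0"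
    using \<open>w = 0\<close> functional_on_zero[OF F subspace_span] functional_on_zero[OF bilinear_onD(2)[OF bil x] subspace_span]
    by simp
  finally have r: "B x e = F e" if "e \<in> S" for e
    using S that by (simp add: sum_nonneg_eq_0_iff)
  have "B x y = F y" if "y \<in> span S" for y
  proof -
    obtain c where "y = (\<Sum>e\<in>S. c e *\<^sub>R e)" using S \<open>y \<in> span S\<close> by (auto simp: span_finite)
    then show ?thesis using Bin[OF x] fin r by simp
  qed
  then show ?thesis using x by blast
qed

definition finitely_spanned :: "'v::real_vector set \<Rightarrow> bool" where
  "finitely_spanned U \<longleftrightarrow> (\<exists>S. finite S \<and> U \<subseteq> span S)"

lemma finitely_spanned_subset: "finitely_spanned U \<Longrightarrow> V \<subseteq> U \<Longrightarrow> finitely_spanned V"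
  unfolding finitely_spanned_def by blast

text \<open>The finite set that spans \<open>U\<close> may lie outside of \<open>U\<close>, but it bounds the size of a basis chosen
  inside \<open>U\<close>.\<close>

lemma finitely_spanned_subspace_eq_span:
  fixes U :: "'v::real_vector set"
  assumes U: "subspace U" and fs: "finitely_spanned U"
  obtains B where "finite B" "U = span B"
proof -
  obtain S where S: "finite S" "U \<subseteq> span S" using fs by (auto simp: finitely_spanned_def)
  obtain B where B: "B \<subseteq> U" "independent B" "U \<subseteq> span B"
    using real_vector.maximal_independent_subset[of U] by (auto simp: dependent_raw_def)
  have "finite B" using real_vector.independent_span_bound[OF S(1), of B] B S by (auto simp: dependent_raw_def)
  moreover have "U = span B" using B span_minimal[OF B(1) U] by blast
  ultimately show ?thesis using that by blast
qed

lemma finitely_spanned_Times: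
  fixes U :: "'v::real_vector set" and W :: "'w::real_vector set"
  assumes "finitely_spanned U" "finitely_spanned W"
  shows "finitely_spanned (U \<times> W)"
proof -
  obtain S T where S: "finite S" "U \<subseteq> span S" and T: "finite T" "W \<subseteq> span T"
    using assms by (auto simp: finitely_spanned_def)
  have l1: "linear (\<lambda>x. (x::'v, 0::'w))" and l2: "linear (\<lambda>x. (0::'v, x::'w))"
    by (auto intro!: linearI)
  let ?X = "(\<lambda>x. (x, 0)) ` S \<union> (\<lambda>x. (0, x)) ` T"
  have "(u, w) \<in> span ?X" if "u \<in> U" "w \<in> W" for u w
  proof -
    have "(u, 0::'w) \<in> span ((\<lambda>x. (x, 0)) ` S)"
      unfolding linear_span_image[OF l1] using S that by blast
    moreover have "(0::'v, w) \<in> span ((\<lambda>x. (0, x)) ` T)"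
      unfolding linear_span_image[OF l2] using T that by blast
    ultimately have "(u, 0) \<in> span ?X" "(0, w) \<in> span ?X" by (meson Un_upper1 Un_upper2 span_mono subsetD)+
    from span_add[OF this] show ?thesis by simp
  qed
  then show ?thesis unfolding finitely_spanned_def using S T by (intro exI[of _ ?X]) auto
qed

text \<open>If \<open>a r r = 0\<close> then \<open>a (v + t r) (v + t r) = a v v + 2 t a r v\<close> is affine in \<open>t\<close>, and it can only be
  bounded below by zero if its slope vanishes.\<close>

lemma positive_semidefinite_null_radical:
  assumes U: "subspace U" and bil: "bilinear_on U U a"
    and sym: "\<And>u v. u \<in> U \<Longrightarrow> v \<in> U \<Longrightarrow> a u v = a v u"
    and nonneg: "\<And>u. u \<in> U \<Longrightarrow> a u u \<ge> 0"
    and r: "r \<in> U" "a r r = 0" and v: "v \<in> U"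
  shows "a r v = 0"
proof -
  note lin1 = functional_onD[OF bilinear_onD(1)[OF bil]]
  note lin2 = functional_onD[OF bilinear_onD(2)[OF bil]]
  have "0 \<le> a v v + 2 * t * a r v" for t
  proof -
    have "t *\<^sub>R r \<in> U" using U r by (simp add: subspace_scale)
    then have "a (v + t *\<^sub>R r) (v + t *\<^sub>R r) = a v v + 2 * t * a r v"
      using lin1 lin2 r v U sym[OF v r(1)] by (simp add: subspace_add)
    then show ?thesis using nonneg[of "v + t *\<^sub>R r"] \<open>t *\<^sub>R r \<in> U\<close> U v by (simp add: subspace_add)
  qed
  \<comment> \<open>At this \<open>t\<close> the affine function has the value -1.\<close>
  from this[of "- (a v v + 1) / (2 * a r v)"] show ?thesis
    by (cases "a r v = 0") (auto simp: field_simps)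
qed

text \<open>The condition \<open>a r r = 0\<close> is quadratic, but for a semidefinite form it says that \<open>r\<close> lies in the
  radical, which is a linear condition. This makes the rigid motions in the discrete kernel a subspace.\<close>

lemma subspace_degenerate_vectors:
  assumes U: "subspace U" and a: "bilinear_on U U a"
    and sym: "\<And>u v. u \<in> U \<Longrightarrow> v \<in> U \<Longrightarrow> a u v = a v u"
    and nonneg: "\<And>u. u \<in> U \<Longrightarrow> a u u \<ge> 0" and b: "bilinear_on Q U b"
  shows "subspace {r \<in> U. a r r = 0 \<and> (\<forall>q\<in>Q. b q r = 0)}" (is "subspace ?R")
proof (unfold subspace_def, intro conjI ballI allI)
  note a1 = functional_onD[OF bilinear_onD(1)[OF a]] and b2 = functional_onD[OF bilinear_onD(2)[OF b]]
  have rad: "a r v = 0" "a v r = 0" if "r \<in> ?R" "v \<in> U" for r v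
    using positive_semidefinite_null_radical[OF U a sym nonneg, of r v] sym[of r v] that by auto
  show "0 \<in> ?R"
    using functional_on_zero[OF bilinear_onD(1)[OF a] U, of 0] functional_on_zero[OF bilinear_onD(2)[OF b] U] U
    by (auto simp: subspace_0)
  fix x y c assume x: "x \<in> ?R" and y: "y \<in> ?R"
  have xy: "x \<in> U" "y \<in> U" "x + y \<in> U" "c *\<^sub>R x \<in> U"
    using x y U by (auto simp: subspace_add subspace_scale)
  show "x + y \<in> ?R" using x y xy rad[OF x] rad[OF y] a1 b2 by auto
  show "c *\<^sub>R x \<in> ?R" using x y xy rad[OF x] a1 b2 by auto
qed

text \<open>Prescribing \<open>ip u r\<close> for \<open>r \<in> R\<close> is treated as a further constraint, with its own multiplier \<open>s \<in> R\<close>.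
  This yields the symmetric form \<open>a u v + b q v + b p u + ip s v + ip u r\<close> on triples \<open>(u, q, s)\<close>. Testing with
  \<open>v \<in> R\<close>, where \<open>a\<close> and \<open>b\<close> vanish, leaves \<open>ip s v = 0\<close>, so \<open>s = 0\<close>: the multiplier does not perturb the
  equations. For a solution of the homogeneous problem, \<open>v = u\<close> gives \<open>a u u = 0\<close>, so \<open>u \<in> R\<close>, and \<open>u\<close> is
  orthogonal to \<open>R\<close>, so \<open>u = 0\<close>; then \<open>q = 0\<close> by injectivity of \<open>b\<close>. So the form is nondegenerate.\<close>

theorem constrained_saddle_point_ex1:
  fixes U :: "'v::real_vector set" and Q :: "'q::real_vector set"
  assumes U: "subspace U" "finitely_spanned U" and Q: "subspace Q" "finitely_spanned Q"
    and a: "bilinear_on U U a" "\<And>u v. u \<in> U \<Longrightarrow> v \<in> U \<Longrightarrow> a u v = a v u"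
           "\<And>u. u \<in> U \<Longrightarrow> a u u \<ge> 0"
    and b: "bilinear_on Q U b"
    and ip: "bilinear_on U U ip" "\<And>u v. u \<in> U \<Longrightarrow> v \<in> U \<Longrightarrow> ip u v = ip v u"
           "\<And>u. u \<in> U \<Longrightarrow> u \<noteq> 0 \<Longrightarrow> ip u u > 0"
    and inj: "\<And>q. q \<in> Q \<Longrightarrow> (\<And>v. v \<in> U \<Longrightarrow> b q v = 0) \<Longrightarrow> q = 0"
    and R: "R = {r \<in> U. a r r = 0 \<and> (\<forall>q\<in>Q. b q r = 0)}"
    and g: "functional_on Q g" and l: "functional_on R l"
  shows "\<exists>!(u, q). u \<in> U \<and> q \<in> Q \<and> (\<forall>r\<in>R. ip u r = l r) \<and>
           (\<forall>v\<in>U. a u v + b q v = 0) \<and> (\<forall>p\<in>Q. b p u = g p)"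
proof -
  note a1 = functional_onD[OF bilinear_onD(1)[OF a(1)]] and a2 = functional_onD[OF bilinear_onD(2)[OF a(1)]]
  note b1 = functional_onD[OF bilinear_onD(1)[OF b]] and b2 = functional_onD[OF bilinear_onD(2)[OF b]]
  note i1 = functional_onD[OF bilinear_onD(1)[OF ip(1)]] and i2 = functional_onD[OF bilinear_onD(2)[OF ip(1)]]
  have rad: "a r v = 0" "a v r = 0" if "r \<in> R" "v \<in> U" for r v
    using positive_semidefinite_null_radical[OF U(1) a, of r v] a(2)[of r v] that R by auto
  have RU: "R \<subseteq> U" by (auto simp: R)
  note z = functional_on_zero[OF bilinear_onD(1)[OF a(1)] U(1)] functional_on_zero[OF bilinear_onD(2)[OF a(1)] U(1)]
     functional_on_zero[OF bilinear_onD(1)[OF b] Q(1)] functional_on_zero[OF bilinear_onD(2)[OF b] U(1)]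
     functional_on_zero[OF bilinear_onD(1)[OF ip(1)] U(1)] functional_on_zero[OF bilinear_onD(2)[OF ip(1)] U(1)]
  have Rsub: "subspace R" unfolding R by (rule subspace_degenerate_vectors[OF U(1) a b])
  have kernel: "u = 0 \<and> q = 0"
    if u: "u \<in> U" and q: "q \<in> Q" and orth: "\<And>r. r \<in> R \<Longrightarrow> ip u r = 0"
      and eq: "\<And>v. v \<in> U \<Longrightarrow> a u v + b q v = 0" and bu: "\<And>p. p \<in> Q \<Longrightarrow> b p u = 0" for u q
  proof -
    have "a u u = 0" using eq[OF u] bu[OF q] by simp
    then have "u \<in> R" using u bu by (auto simp: R)
    then have "u = 0" using orth[of u] ip(3)[OF u] by force
    moreover have "q = 0" using eq z(1) \<open>u = 0\<close> by (intro inj[OF q]) auto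
    ultimately show ?thesis by simp
  qed
  define X where "X = U \<times> Q \<times> R"
  have X: "subspace X" unfolding X_def by (intro subspace_Times U Q Rsub)
  have "finitely_spanned X" unfolding X_def
    by (intro finitely_spanned_Times U Q finitely_spanned_subset[OF U(2) RU])
  then obtain S where S: "finite S" "X = span S" using finitely_spanned_subspace_eq_span[OF X] by blast
  define B where "B = (\<lambda>(u, q, s) (v, p, r). a u v + b q v + b p u + ip s v + ip u r)"
  define F where "F = (\<lambda>(v::'v, p, r). g p + l r)"
  have sym: "B x y = B y x" if "x \<in> X" "y \<in> X" for x y
    using that RU by (auto simp: X_def B_def a(2) ip(2) subset_iff)
  have "\<exists>x\<in>X. \<forall>y\<in>X. B x y = F y"
    unfolding S(2)
  proof (rule nondegenerate_form_represents[OF S(1)]; fold S(2))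
    show "bilinear_on X X B"
    proof -
      have right: "functional_on X (B x)" if xX: "x \<in> X" for x
      proof -
        obtain u q s where x: "x = (u, q, s)" "u \<in> U" "q \<in> Q" "s \<in> U"
          using xX RU by (auto simp: X_def)
        show ?thesis
          unfolding functional_on_def
        proof (intro conjI ballI allI)
          fix y y' c assume "y \<in> X" "y' \<in> X"
          then obtain v p r where y: "y = (v, p, r)" "v \<in> U" "p \<in> Q" "r \<in> U"
            using RU by (auto simp: X_def)
          obtain v' p' r' where y': "y' = (v', p', r')" "v' \<in> U" "p' \<in> Q" "r' \<in> U"
            using \<open>y' \<in> X\<close> RU by (auto simp: X_def)
          show "B x (y + y') = B x y + B x y'"
            using x y y' by (simp add: B_def a2 b1 b2 i2)
          show "B x (c *\<^sub>R y) = c * B x y"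
            using x y by (simp add: B_def a2 b1 b2 i2 distrib_left)
        qed
      qed
      have "functional_on X (\<lambda>x. B x y)" if "y \<in> X" for y
        using right[OF that] sym[OF _ that] X
        by (simp add: functional_on_def subspace_add subspace_scale)
      then show ?thesis using right by (simp add: bilinear_on_def)
    qed
    show "B x y = B y x" if "x \<in> X" "y \<in> X" for x y using that by (rule sym)
    show "functional_on X F"
      unfolding functional_on_def X_def F_def
      by (auto simp: functional_onD[OF g] functional_onD[OF l] algebra_simps)
    fix x assume "x \<in> X" and x0: "\<And>y. y \<in> X \<Longrightarrow> B x y = 0"
    then obtain u q s where x: "x = (u, q, s)" "u \<in> U" "q \<in> Q" "s \<in> R" by (auto simp: X_def)
    have 1: "a u v + b q v + ip s v = 0" if "v \<in> U" for v
      using x0[of "(v, 0, 0)"] x that z RU Q Rsub by (auto simp: X_def B_def subspace_0)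
    have 2: "b p u = 0" if "p \<in> Q" for p
      using x0[of "(0, p, 0)"] x that z RU U Rsub by (auto simp: X_def B_def subspace_0)
    have 3: "ip u r = 0" if "r \<in> R" for r
      using x0[of "(0, 0, r)"] x that z RU U Q by (auto simp: X_def B_def subspace_0)
    have "ip s s = 0" using 1[of s] rad[OF x(4) x(2)] x by (auto simp: R)
    then have "s = 0" using ip(3)[of s] x RU by force
    then have "u = 0 \<and> q = 0" using kernel[OF x(2,3) 3 _ 2] 1 z by auto
    then show "x = 0" using x \<open>s = 0\<close> by (simp add: zero_prod_def)
  qed
  then obtain u q s where x: "u \<in> U" "q \<in> Q" "s \<in> R"
    and sol: "\<And>v p r. v \<in> U \<Longrightarrow> p \<in> Q \<Longrightarrow> r \<in> R \<Longrightarrow> B (u, q, s) (v, p, r) = F (v, p, r)"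
    unfolding X_def by fastforce
  have gl: "g 0 = 0" "l 0 = 0" using functional_on_zero g l Q Rsub by auto
  have e1: "a u v + b q v + ip s v = 0" if "v \<in> U" for v
    using sol[of v 0 0] x that z RU Q Rsub gl by (auto simp: B_def F_def subspace_0)
  have e2: "b p u = g p" if "p \<in> Q" for p
    using sol[of 0 p 0] x that z RU U Rsub gl by (auto simp: B_def F_def subspace_0)
  have e3: "ip u r = l r" if "r \<in> R" for r
    using sol[of 0 0 r] x that z RU U Q gl by (auto simp: B_def F_def subspace_0)
  have "ip s s = 0" using e1[of s] rad[OF x(3) x(1)] x by (auto simp: R)
  then have "s = 0" using ip(3)[of s] x RU by force
  show ?thesis
  proof (rule ex1I[of _ "(u, q)"], goal_cases)
    case 1
    show ?case using x e1 e2 e3 \<open>s = 0\<close> z by auto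
  next
    case (2 y)
    obtain u' q' where y: "y = (u', q')" by force
    have y': "u' \<in> U" "q' \<in> Q" "\<And>r. r \<in> R \<Longrightarrow> ip u' r = l r" "\<And>v. v \<in> U \<Longrightarrow> a u' v + b q' v = 0"
      "\<And>p. p \<in> Q \<Longrightarrow> b p u' = g p"
      using 2 y by auto
    have au: "a u v + b q v = 0" if "v \<in> U" for v using e1[OF that] \<open>s = 0\<close> z that by auto
    note d = functional_on_diff[OF bilinear_onD(1)[OF a(1)] U(1)] functional_on_diff[OF bilinear_onD(1)[OF b] Q(1)]
      functional_on_diff[OF bilinear_onD(2)[OF b] U(1)] functional_on_diff[OF bilinear_onD(1)[OF ip(1)] U(1)]
    have "u' - u = 0 \<and> q' - q = 0"
    proof (rule kernel)
      show "u' - u \<in> U" "q' - q \<in> Q" using x y' U Q by (auto simp: subspace_diff)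
      show "ip (u' - u) r = 0" if "r \<in> R" for r using d x y' e3 that RU by auto
      show "a (u' - u) v + b (q' - q) v = 0" if "v \<in> U" for v
        using d x y'(1,2) y'(4)[OF that] au[OF that] that by auto
      show "b p (u' - u) = 0" if "p \<in> Q" for p using d x y' e2 that by auto
    qed
    then show ?case using y by simp
  qed
qed

section \<open>Smooth functions\<close>

lemma partial_eqI: "(f has_derivative f') (at x) \<Longrightarrow> partial i f x = f' (axis i 1)"
  by (simp add: partial_def frechet_derivative_at[symmetric])

lemma C_k_differentiable: "C_k (Suc m) f \<Longrightarrow> f differentiable (at x)"
  by simp

lemma C_k_continuous: "C_k m f \<Longrightarrow> continuous_on UNIV f"
proof (cases m)
  case (Suc l)
  assume "C_k m f"
  then have "\<forall>x. f differentiable (at x)" using Suc by simp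
  then show ?thesis
    by (simp add: continuous_at_imp_continuous_on differentiable_imp_continuous_within)
qed simp

lemma C_k_Suc_imp: "C_k (Suc m) f \<Longrightarrow> C_k m f"
proof (induction m arbitrary: f)
  case 0
  then show ?case using C_k_continuous[OF 0] by simp
next
  case (Suc m)
  then show ?case by (simp (no_asm_use) del: C_k.simps(1)) (metis C_k.simps(2))
qed

lemma C_k_const [simp]: "C_k m (\<lambda>x. c)"
proof (induction m arbitrary: c)
  case (Suc m)
  have "partial i (\<lambda>x. c) = (\<lambda>x. 0)" for i :: 'a
    by (rule ext, rule partial_eqI[where f' = "\<lambda>_. 0", THEN trans]) auto
  then show ?case using Suc by simp
qed simp

lemma partial_add:
  assumes "f differentiable (at x)" "g differentiable (at x)"
  shows "partial i (\<lambda>x. f x + g x) x = partial i f x + partial i g x"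
proof -
  have "((\<lambda>x. f x + g x) has_derivative
      (\<lambda>h. frechet_derivative f (at x) h + frechet_derivative g (at x) h)) (at x)"
    using assms by (intro has_derivative_add) (auto simp: frechet_derivative_works)
  from partial_eqI[OF this] show ?thesis by (simp add: partial_def)
qed

lemma partial_mult:
  assumes "f differentiable (at x)" "g differentiable (at x)"
  shows "partial i (\<lambda>x. f x * g x) x = f x * partial i g x + partial i f x * g x"
proof -
  have "((\<lambda>x. f x * g x) has_derivative
      (\<lambda>h. f x * frechet_derivative g (at x) h + frechet_derivative f (at x) h * g x)) (at x)"
    using assms by (intro has_derivative_mult) (auto simp: frechet_derivative_works)
  from partial_eqI[OF this] show ?thesis by (simp add: partial_def)
qed

lemma C_k_add: "C_k m f \<Longrightarrow> C_k m g \<Longrightarrow> C_k m (\<lambda>x. f x + g x)"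
proof (induction m arbitrary: f g)
  case 0
  then show ?case by (auto intro: continuous_intros)
next
  case (Suc m)
  have "partial i (\<lambda>x. f x + g x) = (\<lambda>x. partial i f x + partial i g x)" for i
    using Suc.prems by (intro ext partial_add) auto
  then show ?case using Suc by (auto intro: derivative_intros)
qed

lemma C_k_mult: "C_k m f \<Longrightarrow> C_k m g \<Longrightarrow> C_k m (\<lambda>x. f x * g x)"
proof (induction m arbitrary: f g)
  case 0
  then show ?case by (auto intro: continuous_intros)
next
  case (Suc m)
  have "partial i (\<lambda>x. f x * g x) = (\<lambda>x. f x * partial i g x + partial i f x * g x)" for i
    using Suc.prems by (intro ext partial_mult) auto
  moreover have "C_k m f" "C_k m g" using Suc.prems C_k_Suc_imp by blast+
  ultimately show ?case using Suc by (auto intro!: derivative_intros C_k_add)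
qed

lemma C_k_component: "C_k m (\<lambda>x. x $ j)"
proof (cases m)
  case (Suc l)
  have d: "((\<lambda>x. x $ j) has_derivative (\<lambda>h. h $ j)) (at x)" for x :: "real^'a"
    by (intro bounded_linear_imp_has_derivative bounded_linear_vec_nth)
  then have "partial i (\<lambda>x. x $ j) = (\<lambda>x. axis i 1 $ j)" for i
    by (intro ext partial_eqI)
  then show ?thesis using Suc d by (auto simp: differentiable_def)
qed (auto intro: continuous_intros)

lemma partial_affine:
  assumes "f differentiable (at (c *\<^sub>R x + a))"
  shows "partial i (\<lambda>x. f (c *\<^sub>R x + a)) x = c * partial i f (c *\<^sub>R x + a)"
    and "(\<lambda>x. f (c *\<^sub>R x + a)) differentiable (at x)"
proof -
  let ?D = "frechet_derivative f (at (c *\<^sub>R x + a))"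
  have D: "(f has_derivative ?D) (at (c *\<^sub>R x + a))" using assms by (simp add: frechet_derivative_works)
  have *: "((\<lambda>x. f (c *\<^sub>R x + a)) has_derivative (\<lambda>h. ?D (c *\<^sub>R h))) (at x)"
    by (rule has_derivative_compose[of "\<lambda>x. c *\<^sub>R x + a", OF _ D]) (auto intro!: derivative_eq_intros)
  then show "(\<lambda>x. f (c *\<^sub>R x + a)) differentiable (at x)" by (auto simp: differentiable_def)
  show "partial i (\<lambda>x. f (c *\<^sub>R x + a)) x = c * partial i f (c *\<^sub>R x + a)"
    using partial_eqI[OF *] linear_scale[OF has_derivative_linear[OF D]] by (simp add: partial_def)
qed

lemma C_k_affine: "C_k m f \<Longrightarrow> C_k m (\<lambda>x. f (c *\<^sub>R x + a))"
proof (induction m arbitrary: f)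
  case 0
  then show ?case
    by (auto intro!: continuous_on_compose2[where g = f and t = UNIV] continuous_intros)
next
  case (Suc m)
  have "partial i (\<lambda>x. f (c *\<^sub>R x + a)) = (\<lambda>x. c * partial i f (c *\<^sub>R x + a))" for i
    using Suc.prems by (intro ext partial_affine) auto
  then show ?case using Suc by (auto intro!: C_k_mult partial_affine)
qed

definition smooth :: "(real^'n \<Rightarrow> real) \<Rightarrow> bool" where
  "smooth f \<longleftrightarrow> (\<forall>m. C_k m f)"

lemma smooth_differentiable: "smooth f \<Longrightarrow> f differentiable (at x)"
  unfolding smooth_def using C_k_differentiable by blast

lemma smooth_continuous: "smooth f \<Longrightarrow> continuous_on UNIV f"
  unfolding smooth_def using C_k_continuous by blast

lemma smooth_partial: "smooth f \<Longrightarrow> smooth (partial i f)"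
  unfolding smooth_def using C_k.simps(2) by blast

lemma smooth_mult: "smooth f \<Longrightarrow> smooth g \<Longrightarrow> smooth (\<lambda>x. f x * g x)"
  by (simp add: smooth_def C_k_mult)

lemma smooth_const: "smooth (\<lambda>x. c)"
  by (simp add: smooth_def)

lemma smooth_add: "smooth f \<Longrightarrow> smooth g \<Longrightarrow> smooth (\<lambda>x. f x + g x)"
  by (simp add: smooth_def C_k_add)

lemma smooth_sum: "(\<And>i. i \<in> I \<Longrightarrow> smooth (f i)) \<Longrightarrow> smooth (\<lambda>x. \<Sum>i\<in>I. f i x)"
  by (induction I rule: infinite_finite_induct) (auto intro: smooth_const smooth_add)

lemma smooth_prod: "(\<And>i. i \<in> I \<Longrightarrow> smooth (f i)) \<Longrightarrow> smooth (\<lambda>x. \<Prod>i\<in>I. f i x)"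
  by (induction I rule: infinite_finite_induct) (auto intro: smooth_const smooth_mult)

lemma smooth_power: "smooth f \<Longrightarrow> smooth (\<lambda>x. f x ^ m)"
  by (induction m) (auto intro: smooth_const smooth_mult)

lemma smooth_affine: "smooth f \<Longrightarrow> smooth (\<lambda>x. f (c *\<^sub>R x + a))"
  by (simp add: smooth_def C_k_affine)

lemma smooth_translate: "smooth f \<Longrightarrow> smooth (\<lambda>x. f (x - a))"
  using smooth_affine[of f 1 "- a"] by simp

lemma smooth_reflect: "smooth f \<Longrightarrow> smooth (\<lambda>x. f (a - x))"
  using smooth_affine[of f "- 1" a] by simp

lemma partial_translate: "smooth f \<Longrightarrow> partial i (\<lambda>x. f (x - a)) x = partial i f (x - a)"
  using partial_affine(1)[where f = f and c = 1 and x = x and a = "- a" and i = i] smooth_differentiable[of f] by simp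

lemma partial_reflect: "smooth f \<Longrightarrow> partial i (\<lambda>x. f (a - x)) x = - partial i f (a - x)"
  using partial_affine(1)[where f = f and c = "- 1" and x = x and a = a and i = i] smooth_differentiable[of f] by simp

text \<open>The topological support of a derivative is no larger than that of the function; this keeps
  derivatives of test functions compactly supported.\<close>

lemma partial_eq_0_outside_support:
  assumes "x \<notin> closure {x. f x \<noteq> 0}"
  shows "partial i f x = 0"
proof -
  have op: "open (- closure {x. f x \<noteq> 0})" by (intro open_Compl closed_closure)
  have x: "x \<in> - closure {x. f x \<noteq> 0}" using assms by blast
  have zero: "0 = f y" if "y \<in> - closure {x. f x \<noteq> 0}" for y
    using that closure_subset[of "{x. f x \<noteq> 0}"] by (metis (mono_tags) ComplD mem_Collect_eq subsetD)
  have "(f has_derivative (\<lambda>_. 0)) (at x)"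
    by (rule has_derivative_transform_within_open[OF has_derivative_const op x zero])
  from partial_eqI[OF this] show ?thesis .
qed

lemma test_functions_iff:
  "\<phi> \<in> test_functions \<Omega> \<longleftrightarrow>
     smooth \<phi> \<and> compact (closure {x. \<phi> x \<noteq> 0}) \<and> closure {x. \<phi> x \<noteq> 0} \<subseteq> \<Omega>"
  by (simp add: test_functions_def smooth_def)

lemma test_functions_mult:
  assumes \<phi>: "\<phi> \<in> test_functions \<Omega>" and \<psi>: "smooth \<psi>"
  shows "(\<lambda>x. \<phi> x * \<psi> x) \<in> test_functions \<Omega>"
proof -
  have sub: "closure {x. \<phi> x * \<psi> x \<noteq> 0} \<subseteq> closure {x. \<phi> x \<noteq> 0}" by (intro closure_mono) auto
  moreover have "compact (closure {x. \<phi> x * \<psi> x \<noteq> 0})"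
    using \<phi> bounded_subset[of "{x. \<phi> x \<noteq> 0}" "{x. \<phi> x * \<psi> x \<noteq> 0}"]
    by (auto simp: test_functions_iff compact_closure)
  ultimately show ?thesis using \<phi> \<psi> by (auto simp: test_functions_iff intro: smooth_mult)
qed

lemma smooth_in_test_functions:
  assumes f: "smooth f" and C: "compact C" "{x. f x \<noteq> 0} \<subseteq> C" "C \<subseteq> \<Omega>"
  shows "f \<in> test_functions \<Omega>"
proof -
  have sub: "closure {x. f x \<noteq> 0} \<subseteq> C" using C compact_imp_closed closure_minimal by blast
  moreover have "compact (closure {x. f x \<noteq> 0})"
    using C bounded_subset[OF compact_imp_bounded] by (auto simp: compact_closure)
  ultimately show ?thesis using f C by (auto simp: test_functions_iff)
qed

section \<open>Mollifiers\<close>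

text \<open>The polynomial factor closes the family of functions \<open>exp (- 1 / t)\<close>, extended by zero to \<open>t \<le> 0\<close>,
  under differentiation.\<close>

definition flat_exp :: "real poly \<Rightarrow> real \<Rightarrow> real" where
  "flat_exp p t = (if t > 0 then poly p (1 / t) * exp (- 1 / t) else 0)"

lemma poly_div_exp_tendsto_0: "((\<lambda>s. poly p s / exp s) \<longlongrightarrow> (0::real)) at_top"
proof -
  have "((\<lambda>s. \<Sum>k\<le>degree p. coeff p k * (s ^ k / exp s)) \<longlongrightarrow> (\<Sum>k\<le>degree p. coeff p k * 0)) at_top"
    by (intro tendsto_sum tendsto_mult tendsto_const tendsto_power_div_exp_0)
  then show ?thesis by (simp add: poly_altdef sum_divide_distrib)
qed

text \<open>The only critical point is \<open>t = 0\<close>, where \<open>s = 1 / t\<close> turns the difference quotient into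
  \<open>s * poly p s / exp s\<close>, which tends to zero.\<close>

lemma flat_exp_derivative:
  "(flat_exp p has_real_derivative flat_exp ([:0, 0, 1:] * (p - pderiv p)) t) (at t)"
proof -
  consider "t > 0" | "t < 0" | "t = 0" by linarith
  then show ?thesis
  proof cases
    case 1
    have "((\<lambda>t. poly p (1 / t) * exp (- 1 / t)) has_real_derivative
        flat_exp ([:0, 0, 1:] * (p - pderiv p)) t) (at t)"
      unfolding flat_exp_def using 1
      by (auto intro!: derivative_eq_intros DERIV_chain2[OF poly_DERIV] simp: field_simps power2_eq_square)
    then show ?thesis
      by (rule has_field_derivative_transform_within_open[where S = "{0<..}"])
        (use 1 in \<open>auto simp: flat_exp_def\<close>)
  next
    case 2
    have "((\<lambda>t. 0) has_real_derivative flat_exp ([:0, 0, 1:] * (p - pderiv p)) t) (at t)"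
      using 2 by (auto simp: flat_exp_def)
    then show ?thesis
      by (rule has_field_derivative_transform_within_open[where S = "{..<0}"]) (use 2 in \<open>auto simp: flat_exp_def\<close>)
  next
    case 3
    have "((\<lambda>h. flat_exp p h / h) \<longlongrightarrow> 0) (at_right 0)"
      unfolding filterlim_at_right_to_top
    proof (rule Lim_transform_eventually[OF poly_div_exp_tendsto_0[of "[:0, 1:] * p"]])
      show "\<forall>\<^sub>F x in at_top. poly ([:0, 1:] * p) x / exp x = flat_exp p (inverse x) / inverse x"
        using eventually_gt_at_top[of 0]
        by eventually_elim (auto simp: flat_exp_def field_simps exp_minus)
    qed
    moreover have "((\<lambda>h. flat_exp p h / h) \<longlongrightarrow> 0) (at_left 0)"
      by (rule tendsto_eventually) (auto simp: flat_exp_def eventually_at_filter)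
    ultimately have "((\<lambda>h. flat_exp p h / h) \<longlongrightarrow> 0) (at 0)" by (rule filterlim_split_at[rotated])
    then show ?thesis using 3 by (simp add: DERIV_def flat_exp_def)
  qed
qed

text \<open>The chain rule maps this family into linear multiples of itself, so that one induction over the
  order of differentiability, with \<open>p\<close> arbitrary, suffices.\<close>

lemma smooth_bump: "smooth (\<lambda>x::real^'n. flat_exp p (1 - x \<bullet> x))"
proof -
  have "C_k m (\<lambda>x::real^'n. flat_exp p (1 - x \<bullet> x))" for m
  proof (induction m arbitrary: p)
    case 0
    have "continuous_on UNIV (flat_exp p)"
      using DERIV_isCont[OF flat_exp_derivative] by (simp add: continuous_at_imp_continuous_on)
    then have "continuous_on UNIV (\<lambda>x::real^'n. flat_exp p (1 - x \<bullet> x))"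
      by (rule continuous_on_compose2) (intro continuous_intros subset_UNIV)+
    then show ?case by simp
  next
    case (Suc m)
    let ?q = "[:0, 0, 1:] * (p - pderiv p)"
    have D: "((\<lambda>x::real^'n. flat_exp p (1 - x \<bullet> x)) has_derivative
        (\<lambda>h. (- 2 * (x \<bullet> h)) * flat_exp ?q (1 - x \<bullet> x))) (at x)" for x
    proof -
      have *: "((\<lambda>x::real^'n. 1 - x \<bullet> x) has_derivative (\<lambda>h. - 2 * (x \<bullet> h))) (at x)"
        by (auto intro!: derivative_eq_intros simp: inner_commute)
      show ?thesis
        using has_derivative_compose[OF * flat_exp_derivative[of p, unfolded has_field_derivative_def]]
        by (simp add: mult.commute)
    qed
    have "partial i (\<lambda>x. flat_exp p (1 - x \<bullet> x)) = (\<lambda>x. (- 2 * (x $ i)) * flat_exp ?q (1 - x \<bullet> x))" for i :: 'n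
      using partial_eqI[OF D] by (auto simp: fun_eq_iff inner_axis)
    moreover have "C_k m (\<lambda>x. (- 2 * (x $ i)) * flat_exp ?q (1 - x \<bullet> x))" for i :: 'n
      by (intro C_k_mult C_k_const C_k_component Suc)
    moreover have "(\<lambda>x::real^'n. flat_exp p (1 - x \<bullet> x)) differentiable at x" for x
      using D by (auto simp only: differentiable_def)
    ultimately show ?case by simp
  qed
  then show ?thesis by (simp add: smooth_def)
qed

lemma mollifier_exists:
  fixes n :: nat
  obtains \<eta> :: "real^'n \<Rightarrow> real" where "smooth \<eta>" "\<And>x. \<eta> x \<ge> 0" "{x. \<eta> x \<noteq> 0} \<subseteq> cball 0 (1 / Suc n)"
    "integral\<^sup>L lborel \<eta> = 1"
proof -
  define f where "f x = flat_exp 1 (1 - (real (Suc n) *\<^sub>R x) \<bullet> (real (Suc n) *\<^sub>R x))" for x :: "real^'n"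
  have sm: "smooth f"
    unfolding f_def using smooth_affine[OF smooth_bump[of 1], of "real (Suc n)" 0] by simp
  have f0: "f x \<ge> 0" for x by (simp add: f_def flat_exp_def)
  have supp: "{x. f x \<noteq> 0} \<subseteq> cball 0 (1 / Suc n)"
  proof
    fix x assume "x \<in> {x. f x \<noteq> 0}"
    then have "(norm (real (Suc n) *\<^sub>R x))\<^sup>2 < 1"
      unfolding f_def flat_exp_def power2_norm_eq_inner by (auto split: if_splits)
    then have "norm (real (Suc n) *\<^sub>R x) < 1"
      by (metis abs_norm_cancel abs_square_less_1)
    then show "x \<in> cball 0 (1 / Suc n)" by (simp add: field_simps del: of_nat_Suc)
  qed
  have "integrable lborel (\<lambda>x. indicator (cball 0 (1 / Suc n)) x *\<^sub>R f x)"
    by (intro borel_integrable_compact continuous_on_subset[OF smooth_continuous[OF sm]]) auto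
  moreover have "(\<lambda>x. indicator (cball 0 (1 / Suc n)) x *\<^sub>R f x) = f"
    using supp by (auto simp: fun_eq_iff indicator_def)
  ultimately have int: "integrable lborel f" by simp
  have "integral\<^sup>L lborel f \<noteq> 0"
  proof
    assume "integral\<^sup>L lborel f = 0"
    then have "AE x in lborel. f x = 0" using integral_nonneg_eq_0_iff_AE[OF int] f0 by auto
    then have "AE x in lebesgue. f x = 0" by (rule AE_completion)
    moreover have op: "open {x. f x \<noteq> 0}"
      using smooth_continuous[OF sm] by (intro open_Collect_neq) auto
    ultimately have "negligible {x. f x \<noteq> 0}"
      unfolding negligible_iff_null_sets by (subst AE_iff_null_sets) auto
    moreover note op
    moreover have "0 \<in> {x. f x \<noteq> 0}" by (simp add: f_def flat_exp_def)
    ultimately show False using open_not_negligible by blast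
  qed
  moreover have "integral\<^sup>L lborel f \<ge> 0" using f0 by simp
  ultimately have pos: "integral\<^sup>L lborel f > 0" by linarith
  show ?thesis
  proof (rule that[of "\<lambda>x. (1 / integral\<^sup>L lborel f) * f x"])
    show "smooth (\<lambda>x. (1 / integral\<^sup>L lborel f) * f x)" by (intro smooth_mult sm) (simp add: smooth_def)
    show "integral\<^sup>L lborel (\<lambda>x. (1 / integral\<^sup>L lborel f) * f x) = 1" using pos by simp
  qed (use f0 pos supp in auto)
qed

section \<open>Convolution with mollifiers\<close>

lemma integral_lborel_shift:
  fixes f :: "'a::euclidean_space \<Rightarrow> real"
  assumes [measurable]: "f \<in> borel_measurable borel"
  shows "(\<integral>x. f (x + w) \<partial>lborel) = integral\<^sup>L lborel f"
    and "integrable lborel (\<lambda>x. f (x + w)) \<longleftrightarrow> integrable lborel f"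
proof -
  have "integral\<^sup>L (distr lborel borel ((+) w)) f = (\<integral>x. f (w + x) \<partial>lborel)"
    by (rule integral_distr) auto
  then show "(\<integral>x. f (x + w) \<partial>lborel) = integral\<^sup>L lborel f"
    unfolding lborel_distr_plus by (simp add: add.commute)
  have "integrable (distr lborel borel ((+) w)) f \<longleftrightarrow> integrable lborel (\<lambda>x. f (w + x))"
    by (rule integrable_distr_eq) auto
  then show "integrable lborel (\<lambda>x. f (x + w)) \<longleftrightarrow> integrable lborel f"
    unfolding lborel_distr_plus by (simp add: add.commute)
qed

text \<open>Inner regularity by compact sets holds for finite Borel measures, so it is applied to Lebesgue
  measure restricted to \<open>A\<close>.\<close>

lemma compact_open_sandwich:
  fixes A :: "'a::euclidean_space set"
  assumes A: "A \<in> sets borel" "emeasure lborel A < \<infinity>" and e: "e > 0"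
  obtains K U where "compact K" "open U" "K \<subseteq> A" "A \<subseteq> U" "emeasure lborel (U - K) < ennreal e"
proof -
  have e2: "e / 2 > 0" using e by simp
  have A': "A \<in> sets lebesgue" using A by auto
  obtain U where U: "open U" "A \<subseteq> U" "emeasure lebesgue (U - A) < ennreal (e / 2)"
    using sets_lebesgue_outer_open[OF A' e2] by metis
  have "\<exists>K. compact K \<and> K \<subseteq> A \<and> emeasure lborel (A - K) < ennreal (e / 2)"
  proof (cases "measure lborel A < e / 2")
    case True
    then show ?thesis using A e
      by (intro exI[of _ "{}"]) (auto simp: emeasure_eq_ennreal_measure ennreal_less_iff)
  next
    case False
    define M where "M = density lborel (indicator A)"
    have MA: "emeasure M B = emeasure lborel (A \<inter> B)" if "B \<in> sets borel" for B
      using A that unfolding M_def by (simp add: emeasure_density indicator_inter_arith[symmetric])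
    have "emeasure M A = (SUP K \<in> {K. K \<subseteq> A \<and> compact K}. emeasure M K)"
      by (rule inner_regular) (use A MA[of UNIV] in \<open>auto simp: M_def\<close>)
    moreover have "ennreal (measure lborel A - e / 2) < emeasure M A"
      using MA[OF A(1)] A False e by (simp add: emeasure_eq_ennreal_measure ennreal_less_iff)
    ultimately obtain K where K: "K \<subseteq> A" "compact K" "ennreal (measure lborel A - e / 2) < emeasure M K"
      by (auto simp: less_SUP_iff)
    have Kb: "K \<in> sets borel" using K by (intro borel_compact)
    have "emeasure lborel K \<le> emeasure lborel A" using K(1) A by (intro emeasure_mono) auto
    then have Kfin: "emeasure lborel K < \<infinity>" using A(2) by (rule le_less_trans)
    have "emeasure M K = ennreal (measure lborel K)"
      using MA[OF Kb] K(1) Kfin by (simp add: Int_absorb1 emeasure_eq_ennreal_measure)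
    then have mK: "measure lborel A - e / 2 < measure lborel K" using K(3) False by (simp add: ennreal_less_iff)
    have "measure lborel (A - K) = measure lborel A - measure lborel K"
      using A Kb K(1) Kfin by (intro measure_Diff) auto
    moreover have "emeasure lborel (A - K) \<le> emeasure lborel A" using A by (intro emeasure_mono) auto
    then have "emeasure lborel (A - K) < \<infinity>" using A(2) by (rule le_less_trans)
    moreover from this have "emeasure lborel (A - K) = ennreal (measure lborel (A - K))"
      by (intro emeasure_eq_ennreal_measure) auto
    ultimately have "emeasure lborel (A - K) < ennreal (e / 2)"
      using mK e by (simp only:) (intro ennreal_lessI, auto)
    then show ?thesis using K by blast
  qed
  then obtain K where K: "compact K" "K \<subseteq> A" "emeasure lborel (A - K) < ennreal (e / 2)" by blast
  have Kb: "K \<in> sets borel" using K by (intro borel_compact)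
  have "emeasure lborel (U - K) \<le> emeasure lborel ((U - A) \<union> (A - K))"
    using U K A Kb by (intro emeasure_mono) auto
  also have "\<dots> \<le> emeasure lborel (U - A) + emeasure lborel (A - K)"
    using U K A Kb by (intro emeasure_subadditive) auto
  also have "\<dots> < ennreal (e / 2) + ennreal (e / 2)"
    using U K A by (intro add_strict_mono) auto
  also have "\<dots> = ennreal e" using e by (simp flip: ennreal_plus)
  finally show ?thesis using that U K by blast
qed

abbreviation translation_error :: "('a::euclidean_space \<Rightarrow> real) \<Rightarrow> 'a \<Rightarrow> real" where
  "translation_error h w \<equiv> (\<integral>x. \<bar>h (x + w) - h x\<bar> \<partial>lborel)"

definition translation_continuous :: "('a::euclidean_space \<Rightarrow> real) \<Rightarrow> bool" where
  "translation_continuous h \<longleftrightarrow>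
     (\<forall>e>0. \<exists>d>0. \<forall>w. norm w < d \<longrightarrow> translation_error h w < e)"

lemma translation_continuous_approx:
  fixes h :: "'a::euclidean_space \<Rightarrow> real"
  assumes h: "integrable lborel h"
    and approx: "\<And>e. e > 0 \<Longrightarrow> \<exists>s. integrable lborel s \<and> translation_continuous s \<and> (\<integral>x. \<bar>h x - s x\<bar> \<partial>lborel) < e"
  shows "translation_continuous h"
  unfolding translation_continuous_def
proof (intro allI impI)
  fix e :: real assume "e > 0"
  then obtain s where s: "integrable lborel s" "translation_continuous s" "(\<integral>x. \<bar>h x - s x\<bar> \<partial>lborel) < e / 3"
    using approx[of "e / 3"] by auto
  then obtain d where d: "d > 0" "\<And>w. norm w < d \<Longrightarrow> translation_error s w < e / 3"
    using \<open>e > 0\<close> unfolding translation_continuous_def by (meson divide_pos_pos zero_less_numeral)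
  have [measurable]: "h \<in> borel_measurable borel" "s \<in> borel_measurable borel"
    using h s by (auto dest: borel_measurable_integrable)
  have "translation_error h w < e" if w: "norm w < d" for w
  proof -
    have i: "integrable lborel (\<lambda>x. h (x + w))" "integrable lborel (\<lambda>x. s (x + w))"
      using h s by (auto simp: integral_lborel_shift)
    have "translation_error h w \<le>
        (\<integral>x. \<bar>h (x + w) - s (x + w)\<bar> + \<bar>s (x + w) - s x\<bar> + \<bar>h x - s x\<bar> \<partial>lborel)"
      using i h s by (intro integral_mono) auto
    also have "\<dots> = (\<integral>x. \<bar>h (x + w) - s (x + w)\<bar> \<partial>lborel) + translation_error s w
        + (\<integral>x. \<bar>h x - s x\<bar> \<partial>lborel)"
      using i h s by simp
    also have "(\<integral>x. \<bar>h (x + w) - s (x + w)\<bar> \<partial>lborel) = (\<integral>x. \<bar>h x - s x\<bar> \<partial>lborel)"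
      by (rule integral_lborel_shift(1)[where f = "\<lambda>x. \<bar>h x - s x\<bar>"]) measurable
    finally show ?thesis using d(2)[OF w] s(3) by linarith
  qed
  then show "\<exists>d>0. \<forall>w. norm w < d \<longrightarrow> translation_error h w < e" using d(1) by blast
qed

text \<open>Let \<open>K \<subseteq> A \<subseteq> U\<close> with \<open>K\<close> compact, \<open>U\<close> open and \<open>U - K\<close> of small measure. If \<open>w\<close> is shorter than the
  distance of \<open>K\<close> to the complement of \<open>U\<close>, then exactly one of \<open>x\<close> and \<open>x + w\<close> can lie in \<open>A\<close> only if one
  of them lies in \<open>U - K\<close>.\<close>

lemma translation_continuous_indicator:
  fixes A :: "'a::euclidean_space set"
  assumes A: "A \<in> sets borel" "emeasure lborel A < \<infinity>"
  shows "translation_continuous (indicator A)"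
  unfolding translation_continuous_def
proof (intro allI impI)
  fix e :: real assume e: "e > 0"
  obtain K U where KU: "compact K" "open U" "K \<subseteq> A" "A \<subseteq> U" "emeasure lborel (U - K) < ennreal (e / 2)"
    using compact_open_sandwich[OF A, of "e / 2"] e by auto
  obtain d where d: "d > 0" "\<And>x y. x \<in> K \<Longrightarrow> dist x y < d \<Longrightarrow> y \<in> U"
  proof (cases "K = {}")
    case True then show ?thesis using that[of 1] by auto
  next
    case False
    show ?thesis
    proof (cases "U = UNIV")
      case True then show ?thesis using that[of 1] by auto
    next
      case UN: False
      have "setdist K (- U) > 0"
        using KU False UN by (simp add: setdist_gt_0_compact_closed closed_Compl disjoint_eq_subset_Compl) blast
      then show ?thesis
        using that[of "setdist K (- U)"] setdist_le_dist[of _ K _ "- U"] by (metis ComplI not_le)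
    qed
  qed
  have Kb: "U - K \<in> sets borel" using KU by (intro sets.Diff borel_open borel_compact)
  have "emeasure lborel (U - K) < \<infinity>" using KU(5) by (rule less_le_trans) simp
  then have D: "integrable lborel (indicator (U - K) :: 'a \<Rightarrow> real)" using Kb by simp
  have m: "measure lborel (U - K) < e / 2"
    using KU(5) \<open>emeasure lborel (U - K) < \<infinity>\<close> e by (simp add: emeasure_eq_ennreal_measure ennreal_less_iff)
  have iA: "integrable lborel (indicator A :: 'a \<Rightarrow> real)" using A by simp
  have [measurable]: "A \<in> sets borel" by fact
  have "translation_error (indicator A) w < e" if w: "norm w < d" for w
  proof -
    have iw: "integrable lborel (\<lambda>x. indicator A (x + w) :: real)"
      using iA by (subst integral_lborel_shift(2)) auto
    have Dw: "integrable lborel (\<lambda>x. indicator (U - K) (x + w) :: real)"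
      using D Kb by (subst integral_lborel_shift(2)) auto
    have "translation_error (indicator A) w
        \<le> (\<integral>x. indicator (U - K) x + indicator (U - K) (x + w) \<partial>lborel)"
    proof (intro integral_mono)
      show "integrable lborel (\<lambda>x. \<bar>indicator A (x + w) - indicator A x :: real\<bar>)" using iA iw by auto
      show "integrable lborel (\<lambda>x. indicator (U - K) x + indicator (U - K) (x + w) :: real)" using D Dw by auto
      fix x
      have "x \<in> K \<Longrightarrow> x + w \<in> U" "x + w \<in> K \<Longrightarrow> x \<in> U"
        using d(2)[of x "x + w"] d(2)[of "x + w" x] w by (auto simp: dist_norm)
      then show "\<bar>indicator A (x + w) - indicator A x\<bar> \<le>
          (indicator (U - K) x + indicator (U - K) (x + w) :: real)"
        using KU(3,4) by (auto simp: indicator_def)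
    qed
    also have "\<dots> = measure lborel (U - K) + measure lborel (U - K)"
      using D Dw Kb integral_lborel_shift(1)[of "indicator (U - K)" w] by auto
    finally show ?thesis using m by linarith
  qed
  then show "\<exists>d>0. \<forall>w. norm w < d \<longrightarrow> translation_error (indicator A) w < e"
    using d(1) by blast
qed

lemma translation_continuous_add:
  fixes f g :: "'a::euclidean_space \<Rightarrow> real"
  assumes int: "integrable lborel f" "integrable lborel g"
    and tc: "translation_continuous f" "translation_continuous g"
  shows "translation_continuous (\<lambda>x. f x + g x)"
  unfolding translation_continuous_def
proof (intro allI impI)
  fix e :: real assume "e > 0"
  then have "e / 2 > 0" by simp
  then obtain d1 where d1: "d1 > 0" "\<And>w. norm w < d1 \<Longrightarrow> translation_error f w < e / 2"
    using tc(1) unfolding translation_continuous_def by blast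
  obtain d2 where d2: "d2 > 0" "\<And>w. norm w < d2 \<Longrightarrow> translation_error g w < e / 2"
    using tc(2) \<open>e / 2 > 0\<close> unfolding translation_continuous_def by blast
  have [measurable]: "f \<in> borel_measurable borel" "g \<in> borel_measurable borel"
    using int by (auto dest: borel_measurable_integrable)
  have "translation_error (\<lambda>x. f x + g x) w < e" if w: "norm w < min d1 d2" for w
  proof -
    have i: "integrable lborel (\<lambda>x. f (x + w))" "integrable lborel (\<lambda>x. g (x + w))"
      using int by (auto simp: integral_lborel_shift)
    have "translation_error (\<lambda>x. f x + g x) w
      \<le> (\<integral>x. \<bar>f (x + w) - f x\<bar> + \<bar>g (x + w) - g x\<bar> \<partial>lborel)"
      using i int by (intro integral_mono) auto
    also have "\<dots> = translation_error f w + translation_error g w"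
      using i int by simp
    finally show ?thesis using d1(2)[of w] d2(2)[of w] w by linarith
  qed
  then show "\<exists>d>0. \<forall>w. norm w < d \<longrightarrow> translation_error (\<lambda>x. f x + g x) w < e"
    using d1(1) d2(1) by (intro exI[of _ "min d1 d2"]) auto
qed

lemma translation_continuous_cmult:
  fixes f :: "'a::euclidean_space \<Rightarrow> real"
  assumes "translation_continuous f"
  shows "translation_continuous (\<lambda>x. f x * c)"
  unfolding translation_continuous_def
proof (intro allI impI)
  fix e :: real assume e: "e > 0"
  have "e / (\<bar>c\<bar> + 1) > 0" using e by simp
  then obtain d where d: "d > 0" "\<And>w. norm w < d \<Longrightarrow> translation_error f w < e / (\<bar>c\<bar> + 1)"
    using assms unfolding translation_continuous_def by blast
  have "translation_error (\<lambda>x. f x * c) w < e" if w: "norm w < d" for w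
  proof -
    have "translation_error (\<lambda>x. f x * c) w = translation_error f w * \<bar>c\<bar>"
      by (simp flip: left_diff_distrib add: abs_mult)
    also have "\<dots> \<le> translation_error f w * (\<bar>c\<bar> + 1)" by (intro mult_left_mono) auto
    also have "\<dots> < e" using d(2)[OF w] by (simp add: pos_less_divide_eq)
    finally show ?thesis .
  qed
  then show "\<exists>d>0. \<forall>w. norm w < d \<longrightarrow> translation_error (\<lambda>x. f x * c) w < e"
    using d(1) by blast
qed

lemma integrable_translation_continuous:
  fixes h :: "'a::euclidean_space \<Rightarrow> real"
  assumes "integrable lborel h"
  shows "translation_continuous h"
  using assms
proof (induction rule: integrable_induct)
  case (base A c)
  then show ?case using translation_continuous_cmult[OF translation_continuous_indicator, of A c] by auto
next
  case (add f g)
  then show ?case by (intro translation_continuous_add)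
next
  case (lim f s)
  have [measurable]: "f \<in> borel_measurable borel" "\<And>i. s i \<in> borel_measurable borel"
    using lim by (auto dest: borel_measurable_integrable)
  have "(\<lambda>i. \<integral>x. \<bar>f x - s i x\<bar> \<partial>lborel) \<longlonglongrightarrow> (\<integral>x. 0 \<partial>(lborel::'a measure))"
  proof (rule integral_dominated_convergence[where w = "\<lambda>x. 3 * \<bar>f x\<bar>"])
    show "integrable lborel (\<lambda>x. 3 * \<bar>f x\<bar>)" using lim by auto
    show "AE x in lborel. (\<lambda>i. \<bar>f x - s i x\<bar>) \<longlonglongrightarrow> 0"
    proof (rule AE_I2)
      fix x
      have "(\<lambda>i. f x - s i x) \<longlonglongrightarrow> f x - f x" using lim by (intro tendsto_intros) auto
      then show "(\<lambda>i. \<bar>f x - s i x\<bar>) \<longlonglongrightarrow> 0" by (simp add: tendsto_rabs_zero)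
    qed
    show "AE x in lborel. norm \<bar>f x - s i x\<bar> \<le> 3 * \<bar>f x\<bar>" for i
    proof (rule AE_I2)
      fix x
      have "norm (s i x) \<le> 2 * norm (f x)" by (rule lim) simp
      then show "norm \<bar>f x - s i x\<bar> \<le> 3 * \<bar>f x\<bar>" by auto
    qed
  qed auto
  then have *: "(\<lambda>i. \<integral>x. \<bar>f x - s i x\<bar> \<partial>lborel) \<longlonglongrightarrow> 0" by simp
  show ?case
  proof (rule translation_continuous_approx)
    show "integrable lborel f" by (rule lim)
    fix e :: real assume "e > 0"
    then obtain i where "(\<integral>x. \<bar>f x - s i x\<bar> \<partial>lborel) < e"
      using order_tendstoD(2)[OF *, of e] by (auto simp: eventually_sequentially)
    then show "\<exists>s. integrable lborel s \<and> translation_continuous s \<and> (\<integral>x. \<bar>f x - s x\<bar> \<partial>lborel) < e"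
      using lim by blast
  qed
qed

text \<open>Substituting \<open>x = w + y\<close> and exchanging the integrals turns the left-hand side into the integral of
  \<open>\<eta> n w * C w\<close>, where \<open>C w\<close> is the integral of \<open>k y * h (y + w)\<close> over \<open>y\<close>. This is an average of \<open>C\<close> over
  shrinking balls, and \<open>C\<close> is continuous at 0 because \<open>h\<close> is translation continuous and \<open>k\<close> is bounded.\<close>

lemma mollifier_limit:
  fixes h k :: "'a::euclidean_space \<Rightarrow> real" and \<eta> :: "nat \<Rightarrow> 'a \<Rightarrow> real"
  assumes h: "integrable lborel h" and k: "k \<in> borel_measurable borel" "\<And>x. \<bar>k x\<bar> \<le> M"
    and \<eta>: "\<And>n. \<eta> n \<in> borel_measurable borel" "\<And>n x. \<eta> n x \<ge> 0"
      "\<And>n. {x. \<eta> n x \<noteq> 0} \<subseteq> cball 0 (1 / Suc n)" "\<And>n. integral\<^sup>L lborel (\<eta> n) = 1"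
  shows "(\<lambda>n. \<integral>y. k y * (\<integral>x. h x * \<eta> n (x - y) \<partial>lborel) \<partial>lborel) \<longlonglongrightarrow> (\<integral>x. h x * k x \<partial>lborel)"
proof -
  note [measurable] = k(1) \<eta>(1)
  have [measurable]: "h \<in> borel_measurable borel" using h by (auto dest: borel_measurable_integrable)
  have M: "M \<ge> 0" using k(2)[of 0] by linarith
  have int\<eta>: "integrable lborel (\<eta> n)" for n using \<eta>(4)[of n] not_integrable_integral_eq by fastforce
  define C where "C w = (\<integral>y. k y * h (y + w) \<partial>lborel)" for w
  have ihw: "integrable lborel (\<lambda>y. h (y + w))" for w using h by (simp add: integral_lborel_shift)
  have ikh: "integrable lborel (\<lambda>y. k y * h (y + w))" for w
    by (rule Bochner_Integration.integrable_bound[of _ "\<lambda>y. M * h (y + w)"])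
      (use ihw k M in \<open>auto simp: abs_mult intro!: mult_right_mono\<close>)
  have eq: "(\<integral>y. k y * (\<integral>x. h x * \<eta> n (x - y) \<partial>lborel) \<partial>lborel) = (\<integral>w. \<eta> n w * C w \<partial>lborel)"
    and int: "integrable lborel (\<lambda>w. \<eta> n w * C w)" for n
  proof -
    define F where "F w y = k y * h (y + w) * \<eta> n w" for w y
    have [measurable]: "(\<lambda>(w, y). F w y) \<in> borel_measurable (lborel \<Otimes>\<^sub>M lborel)"
      unfolding F_def by measurable
    \<comment> \<open>Fubini: the integral over \<open>y\<close> is at most \<open>M\<close> times the \<open>L\<^sup>1\<close> norm of \<open>h\<close>, times \<open>\<eta> n w\<close>.\<close>
    have F: "integrable (lborel \<Otimes>\<^sub>M lborel) (\<lambda>(w, y). F w y)"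
    proof (rule lborel_pair.Fubini_integrable)
      have "(\<integral>y. norm (F w y) \<partial>lborel) \<le> (M * (\<integral>y. \<bar>h y\<bar> \<partial>lborel)) * \<eta> n w" for w
      proof -
        have "(\<integral>y. norm (F w y) \<partial>lborel) = (\<integral>y. \<bar>k y * h (y + w)\<bar> \<partial>lborel) * \<eta> n w"
          using \<eta>(2)[of n w] by (simp add: F_def abs_mult)
        also have "(\<integral>y. \<bar>k y * h (y + w)\<bar> \<partial>lborel) \<le> (\<integral>y. M * \<bar>h (y + w)\<bar> \<partial>lborel)"
          by (intro integral_mono integrable_abs ikh)
            (use ihw k in \<open>auto simp: abs_mult intro!: mult_right_mono\<close>)
        also have "\<dots> = M * (\<integral>y. \<bar>h y\<bar> \<partial>lborel)"
          using integral_lborel_shift(1)[of "\<lambda>y. \<bar>h y\<bar>" w] by simp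
        finally show ?thesis using \<eta>(2)[of n w] by (simp add: mult_right_mono)
      qed
      then have "norm (\<integral>y. norm (F w y) \<partial>lborel) \<le> norm ((M * (\<integral>y. \<bar>h y\<bar> \<partial>lborel)) * \<eta> n w)" for w
        using order.trans[OF _ abs_ge_self] by (simp add: abs_of_nonneg) blast
      then have "integrable lborel (\<lambda>w. \<integral>y. norm (F w y) \<partial>lborel)"
        by (intro Bochner_Integration.integrable_bound[OF integrable_mult_right[OF int\<eta>]] AE_I2) auto
      then show "integrable lborel (\<lambda>w. \<integral>y. norm (case (w, y) of (w, y) \<Rightarrow> F w y) \<partial>lborel)" by simp
      show "AE w in lborel. integrable lborel (\<lambda>y. case (w, y) of (w, y) \<Rightarrow> F w y)"
        using ikh by (simp add: F_def)
    qed measurable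
    have "(\<integral>y. k y * (\<integral>x. h x * \<eta> n (x - y) \<partial>lborel) \<partial>lborel) = (\<integral>y. (\<integral>w. F w y \<partial>lborel) \<partial>lborel)"
    proof (rule Bochner_Integration.integral_cong[OF refl])
      fix y
      have "(\<integral>x. h x * \<eta> n (x - y) \<partial>lborel) = (\<integral>w. h (w + y) * \<eta> n w \<partial>lborel)"
        using integral_lborel_shift(1)[of "\<lambda>x. h x * \<eta> n (x - y)" y] by simp
      then show "k y * (\<integral>x. h x * \<eta> n (x - y) \<partial>lborel) = (\<integral>w. F w y \<partial>lborel)"
        by (simp add: F_def mult.assoc add.commute)
    qed
    also have "\<dots> = (\<integral>w. (\<integral>y. F w y \<partial>lborel) \<partial>lborel)" by (rule lborel_pair.Fubini_integral[OF F])
    also have "\<dots> = (\<integral>w. \<eta> n w * C w \<partial>lborel)" by (simp add: F_def C_def mult.commute)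
    finally show "(\<integral>y. k y * (\<integral>x. h x * \<eta> n (x - y) \<partial>lborel) \<partial>lborel) = (\<integral>w. \<eta> n w * C w \<partial>lborel)" .
    show "integrable lborel (\<lambda>w. \<eta> n w * C w)"
      using lborel_pair.integrable_fst[OF F] by (simp add: F_def C_def mult.commute)
  qed
  have C0: "\<bar>C w - C 0\<bar> \<le> M * translation_error h w" for w
  proof -
    have "C w - C 0 = (\<integral>y. k y * (h (y + w) - h y) \<partial>lborel)"
      using ikh[of w] ikh[of 0] by (simp add: C_def right_diff_distrib)
    also have "\<bar>\<dots>\<bar> \<le> (\<integral>y. \<bar>k y * (h (y + w) - h y)\<bar> \<partial>lborel)" by (rule integral_abs_bound)
    also have "\<dots> \<le> (\<integral>y. M * \<bar>h (y + w) - h y\<bar> \<partial>lborel)"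
    proof (intro integral_mono)
      show "integrable lborel (\<lambda>y. \<bar>k y * (h (y + w) - h y)\<bar>)"
        using ikh[of w] ikh[of 0] by (simp add: right_diff_distrib)
      show "integrable lborel (\<lambda>y. M * \<bar>h (y + w) - h y\<bar>)" using ihw h by auto
    qed (use k in \<open>auto simp: abs_mult intro!: mult_right_mono\<close>)
    finally show ?thesis by simp
  qed
  have "(\<lambda>n. \<integral>w. \<eta> n w * C w \<partial>lborel) \<longlonglongrightarrow> C 0"
  proof (rule LIMSEQ_I)
    fix r :: real assume r: "r > 0"
    have "r / (2 * (M + 1)) > 0" using r M by simp
    then obtain d where d: "d > 0" "\<And>w. norm w < d \<Longrightarrow> translation_error h w < r / (2 * (M + 1))"
      using integrable_translation_continuous[OF h] unfolding translation_continuous_def by blast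
    obtain N where N: "1 / real (Suc N) < d" using d(1) by (meson nat_approx_posE)
    have "norm ((\<integral>w. \<eta> n w * C w \<partial>lborel) - C 0) < r" if n: "n \<ge> N" for n
    proof -
      have "(\<integral>w. \<eta> n w * C w \<partial>lborel) - C 0 = (\<integral>w. \<eta> n w * C w - \<eta> n w * C 0 \<partial>lborel)"
        using int int\<eta> \<eta>(4) by simp
      also have "norm \<dots> \<le> (\<integral>w. \<eta> n w * (r / 2) \<partial>lborel)"
        unfolding real_norm_def
      proof (rule order.trans[OF integral_abs_bound], intro integral_mono)
        show "integrable lborel (\<lambda>w. \<bar>\<eta> n w * C w - \<eta> n w * C 0\<bar>)" using int int\<eta> by auto
        show "integrable lborel (\<lambda>w. \<eta> n w * (r / 2))" using int\<eta> by auto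
        fix w
        show "\<bar>\<eta> n w * C w - \<eta> n w * C 0\<bar> \<le> \<eta> n w * (r / 2)"
        proof (cases "\<eta> n w = 0")
          case False
          then have "norm w \<le> 1 / real (Suc n)" using \<eta>(3)[of n] by auto
          also have "\<dots> \<le> 1 / real (Suc N)" using n by (intro divide_left_mono) auto
          also note N
          finally have "M * translation_error h w \<le> M * (r / (2 * (M + 1)))"
            using d(2)[of w] M by (intro mult_left_mono) auto
          also have "\<dots> \<le> r / 2" using M r by (simp add: field_simps)
          finally have "\<bar>C w - C 0\<bar> \<le> r / 2" using C0[of w] by linarith
          then have "\<eta> n w * \<bar>C w - C 0\<bar> \<le> \<eta> n w * (r / 2)" using \<eta>(2) by (intro mult_left_mono)
          moreover have "\<bar>\<eta> n w * C w - \<eta> n w * C 0\<bar> = \<eta> n w * \<bar>C w - C 0\<bar>"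
            using \<eta>(2)[of n w] by (simp add: abs_mult flip: right_diff_distrib)
          ultimately show ?thesis by simp
        qed simp
      qed
      also have "\<dots> = r / 2" using \<eta>(4) by simp
      finally show ?thesis using r by linarith
    qed
    then show "\<exists>no. \<forall>n\<ge>no. norm ((\<integral>w. \<eta> n w * C w \<partial>lborel) - C 0) < r" by blast
  qed
  then show ?thesis unfolding eq by (simp add: C_def mult.commute)
qed

lemma integrable_kernel_product:
  fixes f g c :: "'a::euclidean_space \<Rightarrow> real"
  assumes f: "integrable lborel f" and g: "integrable lborel g"
    and c: "c \<in> borel_measurable borel" "\<And>x. \<bar>c x\<bar> \<le> M"
  shows "integrable (lborel \<Otimes>\<^sub>M lborel) (\<lambda>(x, y). f x * g y * c (x - y))"
proof -
  have [measurable]: "f \<in> borel_measurable borel" "g \<in> borel_measurable borel" "c \<in> borel_measurable borel"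
    using f g c by (auto dest: borel_measurable_integrable)
  have "integrable (lborel \<Otimes>\<^sub>M lborel) (\<lambda>(x, y). f x * g y)"
  proof (rule lborel_pair.Fubini_integrable)
    show "integrable lborel (\<lambda>x. \<integral>y. norm (case (x, y) of (x, y) \<Rightarrow> f x * g y) \<partial>lborel)"
      using f by (simp add: abs_mult)
  qed (use g in auto)
  then have "integrable (lborel \<Otimes>\<^sub>M lborel) (\<lambda>z. M * (case z of (x, y) \<Rightarrow> f x * g y))" by simp
  then show ?thesis
    by (rule Bochner_Integration.integrable_bound)
      (use c(2) in \<open>auto simp: abs_mult mult.commute[of "\<bar>M\<bar>"] intro!: mult_left_mono AE_I2 order.trans[OF c(2)]\<close>)
qed

section \<open>Weak derivatives\<close>

lemma lebesgue_borel_representative: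
  fixes g :: "'a::euclidean_space \<Rightarrow> real"
  assumes "g \<in> borel_measurable lebesgue"
  obtains G where "G \<in> borel_measurable borel" "AE x in lebesgue. g x = G x"
proof -
  obtain G where "G \<in> borel_measurable lborel" "AE x in lborel. g x = G x"
    using completion_ex_borel_measurable_real[OF assms] by blast
  then show ?thesis using that AE_completion by auto
qed

lemma integral_borel_representative:
  fixes g :: "'a::euclidean_space \<Rightarrow> real"
  assumes "g \<in> borel_measurable lebesgue" "G \<in> borel_measurable borel" "AE x in lebesgue. g x = G x"
  shows "integral\<^sup>L lebesgue g = integral\<^sup>L lborel G"
    and "integrable lebesgue g \<longleftrightarrow> integrable lborel G"
proof -
  have G: "G \<in> borel_measurable lebesgue" using assms(2) by (simp add: measurable_completion)
  show "integral\<^sup>L lebesgue g = integral\<^sup>L lborel G"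
    using integral_cong_AE[OF assms(1) G assms(3)] integral_completion[of G lborel] assms(2) by simp
  show "integrable lebesgue g \<longleftrightarrow> integrable lborel G"
    using integrable_cong_AE[OF assms(1) G assms(3)] integrable_completion[of G lborel] assms(2) by simp
qed

lemma steps_eventually_small:
  assumes "\<delta> > 0"
  obtains N where "\<And>n. n \<ge> N \<Longrightarrow> 1 / real (Suc n) < \<delta>"
proof -
  obtain N where "1 / real (Suc N) < \<delta>" using assms by (meson nat_approx_posE)
  moreover have "1 / real (Suc n) \<le> 1 / real (Suc N)" if "n \<ge> N" for n
    using that by (intro divide_left_mono) auto
  ultimately show ?thesis using that by (meson le_less_trans)
qed

lemma smooth_borel_measurable: "smooth f \<Longrightarrow> f \<in> borel_measurable borel"
  by (intro borel_measurable_continuous_onI smooth_continuous)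

text \<open>Elements of the function spaces are only Lebesgue measurable. Fubini's theorem and translation
  invariance are applied to Borel functions on \<^const>\<open>lborel\<close> that extend them by zero.\<close>

definition representative :: "'a::euclidean_space set \<Rightarrow> ('a \<Rightarrow> real) \<Rightarrow> ('a \<Rightarrow> real) \<Rightarrow> bool" where
  "representative \<Omega> f F \<longleftrightarrow> F \<in> borel_measurable borel \<and>
     (AE x in lebesgue. indicator \<Omega> x * f x = F x) \<and> (\<lambda>x. indicator \<Omega> x * f x) \<in> borel_measurable lebesgue"

lemma representative_borel: "representative \<Omega> f F \<Longrightarrow> F \<in> borel_measurable borel"
  by (simp add: representative_def)

lemma representative_integral:
  assumes "open \<Omega>" "representative \<Omega> f F"
  shows "integral\<^sup>L (lebesgue_on \<Omega>) f = integral\<^sup>L lborel F"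
    and "integrable (lebesgue_on \<Omega>) f \<longleftrightarrow> integrable lborel F"
  using assms integral_borel_representative[of "\<lambda>x. indicator \<Omega> x * f x" F]
  by (auto simp: representative_def integral_restrict_space integrable_restrict_space)

lemma representative_mult:
  assumes "representative \<Omega> f F" "representative \<Omega> g G"
  shows "representative \<Omega> (\<lambda>x. f x * g x) (\<lambda>x. F x * G x)"
proof -
  have e: "indicator \<Omega> x * (f x * g x) = (indicator \<Omega> x * f x) * (indicator \<Omega> x * g x)" for x
    by (simp add: indicator_def)
  have "AE x in lebesgue. indicator \<Omega> x * f x = F x" "AE x in lebesgue. indicator \<Omega> x * g x = G x"
    using assms by (auto simp: representative_def)
  then have "AE x in lebesgue. indicator \<Omega> x * (f x * g x) = F x * G x"
    unfolding e by eventually_elim simp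
  moreover have "(\<lambda>x. indicator \<Omega> x * (f x * g x)) \<in> borel_measurable lebesgue"
    unfolding e using assms by (auto simp: representative_def simp del: mult.assoc intro!: borel_measurable_times)
  ultimately show ?thesis using assms unfolding representative_def by (blast intro: borel_measurable_times)
qed

lemma representative_mult_borel:
  assumes "representative \<Omega> f F" "\<psi> \<in> borel_measurable borel"
  shows "representative \<Omega> (\<lambda>x. f x * \<psi> x) (\<lambda>x. F x * \<psi> x)"
proof -
  have m: "(\<lambda>x. indicator \<Omega> x * f x) \<in> borel_measurable lebesgue" "F \<in> borel_measurable borel"
    and ae: "AE x in lebesgue. indicator \<Omega> x * f x = F x"
    using assms by (auto simp: representative_def)
  have "AE x in lebesgue. indicator \<Omega> x * (f x * \<psi> x) = F x * \<psi> x"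
    using ae by eventually_elim (simp flip: mult.assoc)
  moreover have "\<psi> \<in> borel_measurable lebesgue" using assms(2) by (simp add: measurable_completion)
  from borel_measurable_times[OF m(1) this]
  have "(\<lambda>x. indicator \<Omega> x * (f x * \<psi> x)) \<in> borel_measurable lebesgue" by (simp only: mult.assoc)
  ultimately show ?thesis
    unfolding representative_def using borel_measurable_times[OF m(2) assms(2)] by blast
qed

lemma compact_neighbourhood_in_open:
  fixes K :: "'a::euclidean_space set"
  assumes "compact K" "open \<Omega>" "K \<subseteq> \<Omega>"
  obtains \<delta> K' where "\<delta> > 0" "compact K'" "K' \<subseteq> \<Omega>" "\<And>y. y \<in> K \<Longrightarrow> cball y \<delta> \<subseteq> K'"
proof -
  obtain \<delta> where \<delta>: "\<delta> > 0" "(\<Union>x\<in>K. cball x \<delta>) \<subseteq> \<Omega>"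
    using compact_subset_open_imp_cball_epsilon_subset[OF assms] by blast
  let ?K' = "{x + y | x y. x \<in> K \<and> y \<in> cball 0 \<delta>}"
  have "compact ?K'" using assms(1) by (intro compact_sums) auto
  moreover have "?K' = (\<Union>x\<in>K. cball x \<delta>)"
  proof safe
    fix x y assume "x \<in> K" "y \<in> cball x \<delta>"
    then show "\<exists>x' y'. y = x' + y' \<and> x' \<in> K \<and> y' \<in> cball 0 \<delta>"
      by (intro exI[of _ x] exI[of _ "y - x"]) (auto simp: dist_norm norm_minus_commute)
  qed (force simp: dist_norm)
  ultimately show ?thesis using that[of \<delta> ?K'] \<delta> by auto
qed

lemma mollifier_sequence:
  obtains \<eta> :: "nat \<Rightarrow> real^'n \<Rightarrow> real" where
    "\<And>n. smooth (\<eta> n)" "\<And>n x. \<eta> n x \<ge> 0" "\<And>n. {x. \<eta> n x \<noteq> 0} \<subseteq> cball 0 (1 / Suc n)"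
    "\<And>n. integral\<^sup>L lborel (\<eta> n) = 1" "\<And>n. \<eta> n \<in> borel_measurable borel"
proof -
  have "\<forall>n. \<exists>\<eta> :: real^'n \<Rightarrow> real. smooth \<eta> \<and> (\<forall>x. \<eta> x \<ge> 0) \<and> {x. \<eta> x \<noteq> 0} \<subseteq> cball 0 (1 / Suc n) \<and>
      integral\<^sup>L lborel \<eta> = 1"
    using mollifier_exists by metis
  then obtain \<eta> :: "nat \<Rightarrow> real^'n \<Rightarrow> real" where
    "\<forall>n. smooth (\<eta> n) \<and> (\<forall>x. \<eta> n x \<ge> 0) \<and> {x. \<eta> n x \<noteq> 0} \<subseteq> cball 0 (1 / Suc n) \<and> integral\<^sup>L lborel (\<eta> n) = 1"
    by metis
  then show ?thesis
    using that[of \<eta>] by (auto intro: smooth_borel_measurable)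
qed

lemma mollifier_test_function:
  fixes \<eta> :: "real^'n \<Rightarrow> real"
  assumes "smooth \<eta>" "{x. \<eta> x \<noteq> 0} \<subseteq> cball 0 r" "cball y r \<subseteq> \<Omega>"
  shows "(\<lambda>x. \<eta> (x - y)) \<in> test_functions \<Omega>" "(\<lambda>x. \<eta> (y - x)) \<in> test_functions \<Omega>"
proof -
  have "{x. \<eta> (x - y) \<noteq> 0} \<subseteq> cball y r" "{x. \<eta> (y - x) \<noteq> 0} \<subseteq> cball y r"
    using assms(2) by (force simp: dist_norm norm_minus_commute)+
  then show "(\<lambda>x. \<eta> (x - y)) \<in> test_functions \<Omega>" "(\<lambda>x. \<eta> (y - x)) \<in> test_functions \<Omega>"
    using assms by (auto intro!: smooth_in_test_functions[of _ "cball y r"] smooth_translate smooth_reflect)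
qed

lemma integrable_bounded_mult:
  fixes f g :: "'a \<Rightarrow> real"
  assumes "integrable M f" "g \<in> borel_measurable M" "\<And>x. \<bar>g x\<bar> \<le> C"
  shows "integrable M (\<lambda>x. f x * g x)"
proof -
  have "integrable M (\<lambda>x. f x * C)" using assms by simp
  moreover have "(\<lambda>x. f x * g x) \<in> borel_measurable M"
    using assms by (intro borel_measurable_times) auto
  ultimately show ?thesis
  proof (rule Bochner_Integration.integrable_bound, intro AE_I2)
    fix x
    have "\<bar>g x\<bar> \<le> \<bar>C\<bar>" using assms(3)[of x] by linarith
    then show "norm (f x * g x) \<le> norm (f x * C)" by (simp add: abs_mult mult_left_mono)
  qed
qed

lemma bounded_continuous_compact_support:
  fixes \<psi> :: "'a::euclidean_space \<Rightarrow> real"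
  assumes "continuous_on UNIV \<psi>" "compact K" "\<And>x. x \<notin> K \<Longrightarrow> \<psi> x = 0"
  obtains C where "\<And>x. \<bar>\<psi> x\<bar> \<le> C"
proof -
  have "bounded (\<psi> ` K)"
    using assms by (intro compact_imp_bounded compact_continuous_image) (auto intro: continuous_on_subset)
  then obtain C where C: "\<And>x. x \<in> K \<Longrightarrow> norm (\<psi> x) \<le> C" by (auto simp: bounded_iff)
  have "\<bar>\<psi> x\<bar> \<le> max C 0" for x using C[of x] assms(3)[of x] by (cases "x \<in> K") (auto simp: max_def)
  then show ?thesis using that by blast
qed

lemma locally_integrable_mult_integrable:
  fixes f \<psi> :: "real^'n \<Rightarrow> real"
  assumes f: "locally_integrable \<Omega> f" and \<Omega>: "open \<Omega>"
    and \<psi>: "continuous_on UNIV \<psi>" and K: "compact K" "K \<subseteq> \<Omega>" "\<And>x. x \<notin> K \<Longrightarrow> \<psi> x = 0"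
  shows "integrable (lebesgue_on \<Omega>) (\<lambda>x. f x * \<psi> x)"
proof -
  obtain C where C: "\<And>x. \<bar>\<psi> x\<bar> \<le> C" using bounded_continuous_compact_support[OF \<psi> K(1,3)] by blast
  have "integrable lebesgue (\<lambda>x. indicator K x * f x)"
    using f K by (auto simp: locally_integrable_def set_integrable_def)
  then have "integrable lebesgue (\<lambda>x. indicator K x * f x * \<psi> x)"
    by (rule integrable_bounded_mult[OF _ _ C])
      (auto intro!: borel_measurable_continuous_onI \<psi> measurable_completion)
  also have "(\<lambda>x. indicator K x * f x * \<psi> x) = (\<lambda>x. indicator \<Omega> x *\<^sub>R (f x * \<psi> x))"
    using K(2,3) by (auto simp: fun_eq_iff indicator_def)
  finally show ?thesis using \<Omega> by (subst integrable_restrict_space) auto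
qed

lemma test_function_integrable:
  assumes "locally_integrable \<Omega> f" "open \<Omega>" "\<phi> \<in> test_functions \<Omega>"
  shows "integrable (lebesgue_on \<Omega>) (\<lambda>x. f x * \<phi> x)"
    and "integrable (lebesgue_on \<Omega>) (\<lambda>x. f x * partial i \<phi> x)"
proof -
  let ?K = "closure {x. \<phi> x \<noteq> 0}"
  have K: "compact ?K" "?K \<subseteq> \<Omega>" and sm: "smooth \<phi>" using assms(3) by (auto simp: test_functions_iff)
  have "\<phi> x = 0" if "x \<notin> ?K" for x using that closure_subset[of "{x. \<phi> x \<noteq> 0}"] by blast
  then show "integrable (lebesgue_on \<Omega>) (\<lambda>x. f x * \<phi> x)"
    by (rule locally_integrable_mult_integrable[OF assms(1,2) smooth_continuous[OF sm] K])
  show "integrable (lebesgue_on \<Omega>) (\<lambda>x. f x * partial i \<phi> x)"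
    by (rule locally_integrable_mult_integrable[OF assms(1,2) smooth_continuous[OF smooth_partial[OF sm]] K
          partial_eq_0_outside_support])
qed

lemma test_function_bounds:
  assumes "\<phi> \<in> test_functions \<Omega>"
  obtains K C C' where "compact K" "K \<subseteq> \<Omega>" "\<And>x. x \<notin> K \<Longrightarrow> \<phi> x = 0" "\<And>x. \<bar>\<phi> x\<bar> \<le> C" "\<And>x. \<bar>partial i \<phi> x\<bar> \<le> C'"
proof -
  let ?K = "closure {x. \<phi> x \<noteq> 0}"
  have K: "compact ?K" "?K \<subseteq> \<Omega>" and sm: "smooth \<phi>" using assms by (auto simp: test_functions_iff)
  have zero: "\<phi> x = 0" if "x \<notin> ?K" for x using that closure_subset[of "{x. \<phi> x \<noteq> 0}"] by blast
  obtain C where C: "\<And>x. \<bar>\<phi> x\<bar> \<le> C"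
    using bounded_continuous_compact_support[OF smooth_continuous[OF sm] K(1) zero] by blast
  obtain C' where C': "\<And>x. \<bar>partial i \<phi> x\<bar> \<le> C'"
    using bounded_continuous_compact_support[OF smooth_continuous[OF smooth_partial[OF sm]] K(1)
        partial_eq_0_outside_support] by blast
  from that[OF K zero C C'] show ?thesis .
qed

text \<open>The fundamental lemma of the calculus of variations. The translates of mollifiers are test functions,
  so the mollifications of \<open>g\<close> vanish on any compact \<open>K \<subseteq> \<Omega>\<close> once the mollifier is narrow enough. Integrating
  them against \<open>sgn g\<close> on \<open>K\<close> gives, in the limit, the integral of \<open>\<bar>g\<bar>\<close> over \<open>K\<close>.\<close>

theorem weakly_zero_imp_AE_zero:
  fixes g :: "real^'n \<Rightarrow> real"
  assumes \<Omega>: "open \<Omega>" and g: "locally_integrable \<Omega> g"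
    and zero: "\<And>\<phi>. \<phi> \<in> test_functions \<Omega> \<Longrightarrow> (LINT x|lebesgue_on \<Omega>. g x * \<phi> x) = 0"
  shows "AE x in lebesgue_on \<Omega>. g x = 0"
proof -
  have compact: "AE x in lebesgue. x \<in> K \<longrightarrow> g x = 0" if K: "compact K" "K \<subseteq> \<Omega>" for K
  proof -
    obtain \<delta> K' where \<delta>: "\<delta> > 0" "compact K'" "K' \<subseteq> \<Omega>" "\<And>y. y \<in> K \<Longrightarrow> cball y \<delta> \<subseteq> K'"
      using compact_neighbourhood_in_open[OF K(1) \<Omega> K(2)] by blast
    have gK: "integrable lebesgue (\<lambda>x. indicator K' x * g x)"
      using g \<delta> by (auto simp: locally_integrable_def set_integrable_def)
    obtain h where h: "h \<in> borel_measurable borel" "AE x in lebesgue. indicator K' x * g x = h x"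
      by (rule lebesgue_borel_representative[OF borel_measurable_integrable[OF gK]])
    have ih: "integrable lborel h"
      using integral_borel_representative(2)[OF _ h] gK by (auto dest: borel_measurable_integrable)
    obtain \<eta> :: "nat \<Rightarrow> real^'n \<Rightarrow> real" where \<eta>:
      "\<And>n. smooth (\<eta> n)" "\<And>n x. \<eta> n x \<ge> 0" "\<And>n. {x. \<eta> n x \<noteq> 0} \<subseteq> cball 0 (1 / Suc n)"
      "\<And>n. integral\<^sup>L lborel (\<eta> n) = 1" "\<And>n. \<eta> n \<in> borel_measurable borel"
      using mollifier_sequence by blast
    note [measurable] = h(1) \<eta>(5)
    have Kb [measurable]: "K \<in> sets borel" using K by (intro borel_compact)
    \<comment> \<open>With this weight, \<open>h x * k x\<close> is \<open>\<bar>h x\<bar>\<close> on \<open>K\<close>.\<close>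
    define k where "k x = indicator K x * sgn (h x)" for x
    have [measurable]: "k \<in> borel_measurable borel" unfolding k_def by measurable
    have "\<bar>k x\<bar> \<le> 1" for x by (auto simp: k_def indicator_def sgn_if)
    then have lim: "(\<lambda>n. \<integral>y. k y * (\<integral>x. h x * \<eta> n (x - y) \<partial>lborel) \<partial>lborel) \<longlonglongrightarrow> (\<integral>x. h x * k x \<partial>lborel)"
      by (intro mollifier_limit[OF ih _ _ \<eta>(5,2,3,4)]) auto
    obtain N where N: "\<And>n. n \<ge> N \<Longrightarrow> 1 / real (Suc n) < \<delta>" using steps_eventually_small[OF \<delta>(1)] by blast
    have "(\<integral>y. k y * (\<integral>x. h x * \<eta> n (x - y) \<partial>lborel) \<partial>lborel) = 0" if n: "n \<ge> N" for n
    proof -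
      have n\<delta>: "{x. \<eta> n x \<noteq> 0} \<subseteq> cball 0 \<delta>" using \<eta>(3)[of n] N[OF n] by auto
      have "k y * (\<integral>x. h x * \<eta> n (x - y) \<partial>lborel) = 0" for y
      proof (cases "y \<in> K")
        case True
        have t: "(\<lambda>x. \<eta> n (x - y)) \<in> test_functions \<Omega>"
          using mollifier_test_function(1)[OF \<eta>(1) n\<delta>, of y] \<delta> True by blast
        have eq: "indicator \<Omega> x * (g x * \<eta> n (x - y)) = indicator K' x * g x * \<eta> n (x - y)" for x
        proof (cases "\<eta> n (x - y) = 0")
          case False
          then have "x \<in> cball y \<delta>" using n\<delta> by (force simp: dist_norm norm_minus_commute)
          then have "x \<in> K'" using \<delta>(4)[OF True] by blast
          then show ?thesis using \<delta>(3) by (auto simp: indicator_def)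
        qed simp
        have [measurable]: "(\<lambda>x. \<eta> n (x - y)) \<in> borel_measurable borel" by measurable
        have "(\<integral>x. h x * \<eta> n (x - y) \<partial>lborel) = (\<integral>x. indicator K' x * g x * \<eta> n (x - y) \<partial>lebesgue)"
        proof (rule integral_borel_representative(1)[symmetric])
          show "(\<lambda>x. indicator K' x * g x * \<eta> n (x - y)) \<in> borel_measurable lebesgue"
            by (rule borel_measurable_times[OF borel_measurable_integrable[OF gK]])
              (simp add: measurable_completion)
        qed (use h(2) in auto)
        also have "\<dots> = (LINT x|lebesgue_on \<Omega>. g x * \<eta> n (x - y))"
          using \<Omega> by (subst integral_restrict_space) (auto simp: eq)
        also have "\<dots> = 0" by (rule zero[OF t])
        finally show ?thesis by simp
      qed (simp add: k_def)
      then show ?thesis by (simp only: Bochner_Integration.integral_zero)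
    qed
    then have "(\<lambda>n. \<integral>y. k y * (\<integral>x. h x * \<eta> n (x - y) \<partial>lborel) \<partial>lborel) \<longlonglongrightarrow> 0"
      by (intro tendsto_eventually) (auto simp: eventually_sequentially)
    then have "(\<integral>x. h x * k x \<partial>lborel) = 0" using lim LIMSEQ_unique by blast
    moreover have "h x * k x = indicator K x * \<bar>h x\<bar>" for x by (auto simp: k_def indicator_def sgn_if)
    ultimately have "(\<integral>x. indicator K x * \<bar>h x\<bar> \<partial>lborel) = 0" by simp
    moreover have "integrable lborel (\<lambda>x. indicator K x * \<bar>h x\<bar>)"
      using integrable_mult_indicator[OF _ integrable_abs[OF ih], of K] Kb by simp
    ultimately have "AE x in lborel. indicator K x * \<bar>h x\<bar> = 0"
      by (subst (asm) integral_nonneg_eq_0_iff_AE) auto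
    then have "AE x in lebesgue. indicator K x * \<bar>h x\<bar> = 0" by (rule AE_completion)
    then show ?thesis
      using h(2)
    proof eventually_elim
      case (elim x)
      have "x \<in> K \<Longrightarrow> x \<in> K'" using \<delta>(4)[of x] \<delta>(1) centre_in_cball[of x \<delta>] by (auto simp del: centre_in_cball)
      then show ?case using elim by (auto simp: indicator_def split: if_splits)
    qed
  qed
  obtain C :: "nat \<Rightarrow> (real^'n) set"
    where C: "\<And>n. compact (C n)" "\<And>n. C n \<subseteq> \<Omega>" "\<Union> (range C) = \<Omega>"
    using open_Union_compact_subsets[OF \<Omega>] by metis
  have "AE x in lebesgue. \<forall>n. x \<in> C n \<longrightarrow> g x = 0"
    unfolding AE_all_countable using compact C by blast
  then have "AE x in lebesgue. x \<in> \<Omega> \<longrightarrow> g x = 0" by eventually_elim (use C(3) in auto)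
  then show ?thesis using \<Omega> by (subst AE_restrict_space_iff) auto
qed

lemma locally_integrable_add:
  "locally_integrable \<Omega> f \<Longrightarrow> locally_integrable \<Omega> g \<Longrightarrow> locally_integrable \<Omega> (\<lambda>x. f x + g x)"
  by (auto simp: locally_integrable_def intro: set_integral_add)

lemma locally_integrable_cmult: "locally_integrable \<Omega> f \<Longrightarrow> locally_integrable \<Omega> (\<lambda>x. c * f x)"
  by (auto simp: locally_integrable_def intro: set_integrable_mult_right)

lemma has_weak_partial_add:
  assumes "open \<Omega>" "has_weak_partial \<Omega> i f f'" "has_weak_partial \<Omega> i g g'"
  shows "has_weak_partial \<Omega> i (\<lambda>x. f x + g x) (\<lambda>x. f' x + g' x)"
  using assms
  by (auto simp: has_weak_partial_def distrib_right locally_integrable_add test_function_integrable)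

lemma has_weak_partial_cmult:
  assumes "has_weak_partial \<Omega> i f f'"
  shows "has_weak_partial \<Omega> i (\<lambda>x. c * f x) (\<lambda>x. c * f' x)"
  using assms by (auto simp: has_weak_partial_def locally_integrable_cmult mult.assoc)

lemma has_weak_partial_unique:
  assumes \<Omega>: "open \<Omega>" and "has_weak_partial \<Omega> i f g" "has_weak_partial \<Omega> i f h"
  shows "AE x in lebesgue_on \<Omega>. g x = h x"
proof -
  have li: "locally_integrable \<Omega> g" "locally_integrable \<Omega> (\<lambda>x. (-1) * h x)"
    using assms by (auto simp only: has_weak_partial_def intro!: locally_integrable_cmult)
  have "AE x in lebesgue_on \<Omega>. g x + (-1) * h x = 0"
  proof (rule weakly_zero_imp_AE_zero[OF \<Omega> locally_integrable_add[OF li]])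
    fix \<phi> assume \<phi>: "\<phi> \<in> test_functions \<Omega>"
    have "(LINT x|lebesgue_on \<Omega>. (g x + (-1) * h x) * \<phi> x) =
        (LINT x|lebesgue_on \<Omega>. g x * \<phi> x) + (LINT x|lebesgue_on \<Omega>. (-1) * h x * \<phi> x)"
      using test_function_integrable(1)[OF li(1) \<Omega> \<phi>] test_function_integrable(1)[OF li(2) \<Omega> \<phi>]
      by (simp add: left_diff_distrib)
    also have "\<dots> = 0" using assms \<phi> by (simp add: has_weak_partial_def)
    finally show "(LINT x|lebesgue_on \<Omega>. (g x + (-1) * h x) * \<phi> x) = 0" .
  qed
  then show ?thesis by eventually_elim simp
qed

lemma locally_integrable_cong_AE:
  assumes "open \<Omega>" "AE x in lebesgue_on \<Omega>. f x = g x" "locally_integrable \<Omega> f"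
  shows "locally_integrable \<Omega> g"
  unfolding locally_integrable_def
proof (intro allI impI)
  fix C assume C: "compact C \<and> C \<subseteq> \<Omega>"
  have "AE x in lebesgue. x \<in> \<Omega> \<longrightarrow> f x = g x"
    using assms(1,2) by (subst (asm) AE_restrict_space_iff) auto
  then obtain N where N: "N \<in> null_sets lebesgue" "{x \<in> space lebesgue. \<not> (x \<in> \<Omega> \<longrightarrow> f x = g x)} \<subseteq> N"
    unfolding eventually_ae_filter by blast
  show "g absolutely_integrable_on C"
  proof (rule absolutely_integrable_spike)
    show "f absolutely_integrable_on C" using assms(3) C by (auto simp: locally_integrable_def)
    show "negligible N" using N by (simp add: negligible_iff_null_sets)
    show "g x = f x" if "x \<in> C - N" for x using that N(2) C by auto
  qed
qed

lemma has_weak_partial_cong_AE: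
  assumes \<Omega>: "open \<Omega>" and fg: "AE x in lebesgue_on \<Omega>. f x = g x" and f: "has_weak_partial \<Omega> i f f'"
  shows "has_weak_partial \<Omega> i g f'"
proof -
  have lf: "locally_integrable \<Omega> f" using f by (simp add: has_weak_partial_def)
  have lg: "locally_integrable \<Omega> g" by (rule locally_integrable_cong_AE[OF \<Omega> fg lf])
  have "(LINT x|lebesgue_on \<Omega>. g x * partial i \<phi> x) = (LINT x|lebesgue_on \<Omega>. f x * partial i \<phi> x)"
    if "\<phi> \<in> test_functions \<Omega>" for \<phi>
    using test_function_integrable(2)[OF lf \<Omega> that] test_function_integrable(2)[OF lg \<Omega> that] fg
    by (intro integral_cong_AE) (auto dest: borel_measurable_integrable)
  then show ?thesis using f lg by (simp add: has_weak_partial_def)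
qed

text \<open>Functions that agree almost everywhere have the same weak derivatives, so \<^const>\<open>weak_partial\<close>
  chooses the same one for both.\<close>

lemma weak_partial_cong_AE:
  assumes "open \<Omega>" "AE x in lebesgue_on \<Omega>. f x = g x"
  shows "weak_partial \<Omega> i f = weak_partial \<Omega> i g"
proof -
  have "AE x in lebesgue_on \<Omega>. g x = f x" using assms(2) by eventually_elim simp
  then have "has_weak_partial \<Omega> i f = has_weak_partial \<Omega> i g"
    using has_weak_partial_cong_AE[OF assms(1)] assms(2) by (intro ext) blast
  then show ?thesis by (simp add: weak_partial_def)
qed

lemma weak_partial_AE:
  assumes "open \<Omega>" "has_weak_partial \<Omega> i f g"
  shows "AE x in lebesgue_on \<Omega>. weak_partial \<Omega> i f x = g x"
  using has_weak_partial_unique[OF assms(1) _ assms(2)] someI[of "has_weak_partial \<Omega> i f", OF assms(2)]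
  by (simp add: weak_partial_def)

section \<open>The product rule\<close>

lemma kernel_swap:
  fixes f g c :: "'a::euclidean_space \<Rightarrow> real"
  assumes "integrable lborel f" "integrable lborel g" "c \<in> borel_measurable borel" "\<And>x. \<bar>c x\<bar> \<le> M"
  shows "(\<integral>y. g y * (\<integral>x. f x * c (x - y) \<partial>lborel) \<partial>lborel) =
         (\<integral>x. f x * (\<integral>y. g y * c (x - y) \<partial>lborel) \<partial>lborel)"
    and "integrable lborel (\<lambda>y. g y * (\<integral>x. f x * c (x - y) \<partial>lborel))"
proof -
  note int = integrable_kernel_product[OF assms]
  have 1: "(\<integral>x. f x * g y * c (x - y) \<partial>lborel) = g y * (\<integral>x. f x * c (x - y) \<partial>lborel)" for y
    by (simp flip: integral_mult_right_zero add: mult_ac)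
  have 2: "(\<integral>y. f x * g y * c (x - y) \<partial>lborel) = f x * (\<integral>y. g y * c (x - y) \<partial>lborel)" for x
    by (simp flip: integral_mult_right_zero add: mult_ac)
  show "(\<integral>y. g y * (\<integral>x. f x * c (x - y) \<partial>lborel) \<partial>lborel) =
        (\<integral>x. f x * (\<integral>y. g y * c (x - y) \<partial>lborel) \<partial>lborel)"
    using lborel_pair.Fubini_integral[OF int] by (simp only: 1 2)
  show "integrable lborel (\<lambda>y. g y * (\<integral>x. f x * c (x - y) \<partial>lborel))"
    using lborel_pair.integrable_snd[OF int] by (simp only: 1)
qed

text \<open>The truncation makes the essential bound hold at every point.\<close>

lemma Linf_representative:
  fixes f :: "real^'n \<Rightarrow> real"
  assumes f: "f \<in> Linf \<Omega>" and \<Omega>: "open \<Omega>" "bounded \<Omega>"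
  obtains F C where "representative \<Omega> f F" "integrable lborel F" "\<And>x. \<bar>F x\<bar> \<le> C"
proof -
  obtain C where m: "f \<in> borel_measurable (lebesgue_on \<Omega>)" and C: "AE x in lebesgue_on \<Omega>. \<bar>f x\<bar> \<le> C"
    using f by (auto simp: Linf_def)
  have m': "(\<lambda>x. indicator \<Omega> x * f x) \<in> borel_measurable lebesgue"
    using m \<Omega> by (subst (asm) borel_measurable_restrict_space_iff) auto
  obtain G where G: "G \<in> borel_measurable borel" "AE x in lebesgue. indicator \<Omega> x * f x = G x"
    using lebesgue_borel_representative[OF m'] by blast
  define F where "F x = indicator \<Omega> x * max (- \<bar>C\<bar>) (min \<bar>C\<bar> (G x))" for x
  have [measurable]: "\<Omega> \<in> sets borel" "G \<in> borel_measurable borel" using \<Omega> G by auto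
  have F [measurable]: "F \<in> borel_measurable borel" unfolding F_def by measurable
  have b: "\<bar>F x\<bar> \<le> \<bar>C\<bar>" for x by (auto simp: F_def indicator_def)
  have fin: "emeasure lborel \<Omega> < \<infinity>" using \<Omega> by (intro emeasure_bounded_finite)
  have "integrable lborel (\<lambda>x. indicator \<Omega> x * F x)"
    using integrable_bounded_mult[of lborel "indicator \<Omega>" F "\<bar>C\<bar>"] fin b by simp
  moreover have "(\<lambda>x. indicator \<Omega> x * F x) = F" by (auto simp: F_def indicator_def)
  ultimately have "integrable lborel F" by simp
  moreover have "AE x in lebesgue. x \<in> \<Omega> \<longrightarrow> \<bar>f x\<bar> \<le> C"
    using C \<Omega> by (subst (asm) AE_restrict_space_iff) auto
  then have "AE x in lebesgue. indicator \<Omega> x * f x = F x"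
    using G(2) by eventually_elim (auto simp: F_def indicator_def)
  then have "representative \<Omega> f F" using m' F by (simp add: representative_def)
  ultimately show ?thesis using that b by blast
qed

lemma Linf_integrable:
  fixes f :: "real^'n \<Rightarrow> real"
  assumes "f \<in> Linf \<Omega>" "open \<Omega>" "bounded \<Omega>"
  shows "integrable (lebesgue_on \<Omega>) f"
  by (rule Linf_representative[OF assms]) (simp add: representative_integral(2)[OF assms(2)])

lemma Linf_locally_integrable:
  fixes f :: "real^'n \<Rightarrow> real"
  assumes "f \<in> Linf \<Omega>" "open \<Omega>" "bounded \<Omega>"
  shows "locally_integrable \<Omega> f"
  unfolding locally_integrable_def
proof (intro allI impI)
  fix C assume C: "compact C \<and> C \<subseteq> \<Omega>"
  have "integrable lebesgue (\<lambda>x. indicator \<Omega> x * f x)"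
    using Linf_integrable[OF assms] assms(2) by (subst (asm) integrable_restrict_space) auto
  then have "integrable lebesgue (\<lambda>x. indicator C x *\<^sub>R (indicator \<Omega> x * f x))"
    using C by (intro integrable_mult_indicator) (auto intro: fmeasurableD lmeasurable_compact)
  also have "(\<lambda>x. indicator C x *\<^sub>R (indicator \<Omega> x * f x)) = (\<lambda>x. indicator C x *\<^sub>R f x)"
    using C by (auto simp: indicator_def fun_eq_iff)
  finally show "f absolutely_integrable_on C" by (simp add: set_integrable_def)
qed

lemma Linf_mult: "f \<in> Linf \<Omega> \<Longrightarrow> g \<in> Linf \<Omega> \<Longrightarrow> (\<lambda>x. f x * g x) \<in> Linf \<Omega>"
proof -
  assume "f \<in> Linf \<Omega>" "g \<in> Linf \<Omega>"
  then obtain C D where m: "f \<in> borel_measurable (lebesgue_on \<Omega>)" "g \<in> borel_measurable (lebesgue_on \<Omega>)"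
    and C: "AE x in lebesgue_on \<Omega>. \<bar>f x\<bar> \<le> C" and D: "AE x in lebesgue_on \<Omega>. \<bar>g x\<bar> \<le> D"
    by (auto simp: Linf_def)
  have "AE x in lebesgue_on \<Omega>. \<bar>f x * g x\<bar> \<le> C * D"
    using C D
  proof eventually_elim
    case (elim x)
    then have "\<bar>f x\<bar> * \<bar>g x\<bar> \<le> C * D" by (intro mult_mono) auto
    then show ?case by (simp add: abs_mult)
  qed
  moreover note borel_measurable_times[OF m]
  ultimately show ?thesis unfolding Linf_def by blast
qed

lemma Linf_add: "f \<in> Linf \<Omega> \<Longrightarrow> g \<in> Linf \<Omega> \<Longrightarrow> (\<lambda>x. f x + g x) \<in> Linf \<Omega>"
proof -
  assume "f \<in> Linf \<Omega>" "g \<in> Linf \<Omega>"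
  then obtain C D where m: "f \<in> borel_measurable (lebesgue_on \<Omega>)" "g \<in> borel_measurable (lebesgue_on \<Omega>)"
    and C: "AE x in lebesgue_on \<Omega>. \<bar>f x\<bar> \<le> C" and D: "AE x in lebesgue_on \<Omega>. \<bar>g x\<bar> \<le> D"
    by (auto simp: Linf_def)
  have "AE x in lebesgue_on \<Omega>. \<bar>f x + g x\<bar> \<le> C + D" using C D by eventually_elim auto
  moreover note borel_measurable_add[OF m]
  ultimately show ?thesis unfolding Linf_def by blast
qed

text \<open>Doubling of variables. Fix a mollifier \<open>\<eta>\<close> and a test function \<open>\<phi>\<close>. For fixed \<open>y\<close>, the definition of \<open>f'\<close> is
  tested with \<open>\<phi> x * \<eta> (x - y)\<close> as a function of \<open>x\<close>; for fixed \<open>x\<close> in the support of \<open>\<phi>\<close>, that of \<open>g'\<close> is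
  tested with \<open>\<eta> (x - y)\<close> as a function of \<open>y\<close>. The terms in which the derivative falls on \<open>\<eta>\<close> have opposite
  signs. Integrating the first identity against \<open>g y\<close> and the second against \<open>f x * \<phi> x\<close> cancels them, and
  what remains involves \<open>\<eta>\<close> only as a mollifier, so it converges to the product rule tested with \<open>\<phi>\<close>.\<close>

theorem has_weak_partial_mult:
  fixes f g f' g' :: "real^'n \<Rightarrow> real"
  assumes \<Omega>: "open \<Omega>" "bounded \<Omega>"
    and Linf: "f \<in> Linf \<Omega>" "g \<in> Linf \<Omega>" "f' \<in> Linf \<Omega>" "g' \<in> Linf \<Omega>"
    and f': "has_weak_partial \<Omega> i f f'" and g': "has_weak_partial \<Omega> i g g'"
  shows "has_weak_partial \<Omega> i (\<lambda>x. f x * g x) (\<lambda>x. f x * g' x + f' x * g x)"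
  unfolding has_weak_partial_def
proof (intro conjI ballI)
  show "locally_integrable \<Omega> (\<lambda>x. f x * g x)" "locally_integrable \<Omega> (\<lambda>x. f x * g' x + f' x * g x)"
    by (intro Linf_locally_integrable Linf_mult Linf_add Linf \<Omega>)+
  fix \<phi> assume \<phi>: "\<phi> \<in> test_functions \<Omega>"
  obtain F CF where F: "representative \<Omega> f F" "integrable lborel F" "\<And>x. \<bar>F x\<bar> \<le> CF"
    using Linf_representative[OF Linf(1) \<Omega>] by metis
  obtain G CG where G: "representative \<Omega> g G" "integrable lborel G" "\<And>x. \<bar>G x\<bar> \<le> CG"
    using Linf_representative[OF Linf(2) \<Omega>] by metis
  obtain F' CF' where F': "representative \<Omega> f' F'" "integrable lborel F'" "\<And>x. \<bar>F' x\<bar> \<le> CF'"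
    using Linf_representative[OF Linf(3) \<Omega>] by metis
  obtain G' CG' where G': "representative \<Omega> g' G'" "integrable lborel G'" "\<And>x. \<bar>G' x\<bar> \<le> CG'"
    using Linf_representative[OF Linf(4) \<Omega>] by metis
  note [measurable] = F(1)[THEN representative_borel] G(1)[THEN representative_borel]
    F'(1)[THEN representative_borel] G'(1)[THEN representative_borel]
  note bridge = representative_integral(1)[OF \<Omega>(1) representative_mult_borel]
  let ?d = "partial i \<phi>"
  have sm: "smooth \<phi>" using \<phi> by (simp add: test_functions_iff)
  note [measurable] = smooth_borel_measurable[OF sm] smooth_borel_measurable[OF smooth_partial[OF sm]]
  obtain K B B' where K: "compact K" "K \<subseteq> \<Omega>" and \<phi>0: "\<And>x. x \<notin> K \<Longrightarrow> \<phi> x = 0"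
    and B: "\<And>x. \<bar>\<phi> x\<bar> \<le> B" and B': "\<And>x. \<bar>?d x\<bar> \<le> B'"
    using test_function_bounds[OF \<phi>] by blast
  let ?I = "\<lambda>W u c. \<integral>y. W y * (\<integral>x. u x * c (x - y) \<partial>lborel) \<partial>lborel"
  obtain \<delta> K' where \<delta>: "\<delta> > 0" "compact K'" "K' \<subseteq> \<Omega>" "\<And>y. y \<in> K \<Longrightarrow> cball y \<delta> \<subseteq> K'"
    using compact_neighbourhood_in_open[OF K(1) \<Omega>(1) K(2)] by blast
  obtain \<eta> :: "nat \<Rightarrow> real^'n \<Rightarrow> real" where \<eta>:
    "\<And>n. smooth (\<eta> n)" "\<And>n x. \<eta> n x \<ge> 0" "\<And>n. {x. \<eta> n x \<noteq> 0} \<subseteq> cball 0 (1 / Suc n)"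
    "\<And>n. integral\<^sup>L lborel (\<eta> n) = 1" "\<And>n. \<eta> n \<in> borel_measurable borel"
    using mollifier_sequence by blast
  note [measurable] = \<eta>(5)
  define D where "D n = partial i (\<eta> n)" for n
  have [measurable]: "D n \<in> borel_measurable borel" for n
    unfolding D_def by (intro smooth_borel_measurable smooth_partial \<eta>)
  have "\<exists>M M'. (\<forall>x. \<bar>\<eta> n x\<bar> \<le> M) \<and> (\<forall>x. \<bar>D n x\<bar> \<le> M')" for n
    using test_function_bounds[OF smooth_in_test_functions[OF \<eta>(1) compact_cball \<eta>(3) subset_UNIV], of n i]
    unfolding D_def by metis
  then obtain M M' where M: "\<And>n x. \<bar>\<eta> n x\<bar> \<le> M n" and M': "\<And>n x. \<bar>D n x\<bar> \<le> M' n" by metis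
  have int: "integrable lborel (\<lambda>x. F x * ?d x)" "integrable lborel (\<lambda>x. F x * \<phi> x)"
    "integrable lborel (\<lambda>x. F' x * \<phi> x)"
    using F(2) F'(2) B B' by (auto intro!: integrable_bounded_mult)
  have limit: "(\<lambda>n. \<integral>y. W y * (\<integral>x. u x * \<eta> n (x - y) \<partial>lborel) \<partial>lborel) \<longlonglongrightarrow> (\<integral>x. u x * W x \<partial>lborel)"
    if "integrable lborel u" "W \<in> borel_measurable borel" "\<And>x. \<bar>W x\<bar> \<le> C" for u W C
    by (rule mollifier_limit[OF that \<eta>(5,2,3,4)])
  have lim1: "(\<lambda>n. ?I G (\<lambda>x. F x * ?d x) (\<eta> n)) \<longlonglongrightarrow> (\<integral>x. F x * ?d x * G x \<partial>lborel)"
    by (rule limit[OF int(1) _ G(3)]) simp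
  have lim2: "(\<lambda>n. ?I G' (\<lambda>x. F x * \<phi> x) (\<eta> n)) \<longlonglongrightarrow> (\<integral>x. F x * \<phi> x * G' x \<partial>lborel)"
    by (rule limit[OF int(2) _ G'(3)]) simp
  have lim3: "(\<lambda>n. ?I G (\<lambda>x. F' x * \<phi> x) (\<eta> n)) \<longlonglongrightarrow> (\<integral>x. F' x * \<phi> x * G x \<partial>lborel)"
    by (rule limit[OF int(3) _ G(3)]) simp
  obtain N where N: "\<And>n. n \<ge> N \<Longrightarrow> 1 / real (Suc n) < \<delta>" using steps_eventually_small[OF \<delta>(1)] by blast
  have eq: "(?I G (\<lambda>x. F x * ?d x) (\<eta> n)) +
      (?I G' (\<lambda>x. F x * \<phi> x) (\<eta> n)) +
      (?I G (\<lambda>x. F' x * \<phi> x) (\<eta> n)) = 0" if n: "n \<ge> N" for n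
  proof -
    have n\<delta>: "{x. \<eta> n x \<noteq> 0} \<subseteq> cball 0 \<delta>" using \<eta>(3)[of n] N[OF n] by auto
    \<comment> \<open>The definition of \<open>f'\<close>, tested with \<open>\<phi> x * \<eta> n (x - y)\<close> as a function of \<open>x\<close>.\<close>
    have A: "(\<integral>x. F x * ?d x * \<eta> n (x - y) \<partial>lborel) + (\<integral>x. F x * \<phi> x * D n (x - y) \<partial>lborel) =
        - (\<integral>x. F' x * \<phi> x * \<eta> n (x - y) \<partial>lborel)" for y
    proof -
      have t: "(\<lambda>x. \<phi> x * \<eta> n (x - y)) \<in> test_functions \<Omega>"
        by (rule test_functions_mult[OF \<phi> smooth_translate[OF \<eta>(1)]])
      have p: "partial i (\<lambda>x. \<phi> x * \<eta> n (x - y)) x = ?d x * \<eta> n (x - y) + \<phi> x * D n (x - y)" for x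
        by (subst partial_mult)
          (auto simp: D_def partial_translate \<eta>(1) intro!: smooth_differentiable sm smooth_translate)
      have "(\<integral>x. F x * (?d x * \<eta> n (x - y) + \<phi> x * D n (x - y)) \<partial>lborel) =
          (LINT x|lebesgue_on \<Omega>. f x * (?d x * \<eta> n (x - y) + \<phi> x * D n (x - y)))"
        by (rule bridge[OF F(1), symmetric]) simp
      also have "\<dots> = - (LINT x|lebesgue_on \<Omega>. f' x * (\<phi> x * \<eta> n (x - y)))"
        using f' t unfolding has_weak_partial_def by (simp flip: p)
      also have "(LINT x|lebesgue_on \<Omega>. f' x * (\<phi> x * \<eta> n (x - y))) = (\<integral>x. F' x * (\<phi> x * \<eta> n (x - y)) \<partial>lborel)"
        by (rule bridge[OF F'(1)]) simp
      finally have "(\<integral>x. F x * (?d x * \<eta> n (x - y) + \<phi> x * D n (x - y)) \<partial>lborel) =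
          - (\<integral>x. F' x * (\<phi> x * \<eta> n (x - y)) \<partial>lborel)" .
      moreover have "integrable lborel (\<lambda>x. F x * ?d x * \<eta> n (x - y))"
        "integrable lborel (\<lambda>x. F x * \<phi> x * D n (x - y))"
        by (rule integrable_bounded_mult[OF int(1) _ M] integrable_bounded_mult[OF int(2) _ M'], simp)+
      ultimately show ?thesis by (simp add: distrib_left mult.assoc)
    qed
    \<comment> \<open>The definition of \<open>g'\<close>, tested with \<open>\<eta> n (x - y)\<close> as a function of \<open>y\<close>. For \<open>x\<close> outside of \<open>K\<close> this need not be a test function on \<open>\<Omega>\<close>, but then both sides are 0.\<close>
    have Bx: "F x * \<phi> x * (\<integral>y. G y * D n (x - y) \<partial>lborel) = F x * \<phi> x * (\<integral>y. G' y * \<eta> n (x - y) \<partial>lborel)" for x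
    proof (cases "x \<in> K")
      case True
      have t: "(\<lambda>y. \<eta> n (x - y)) \<in> test_functions \<Omega>"
        using mollifier_test_function(2)[OF \<eta>(1) n\<delta>, of x] \<delta> True by blast
      have p: "partial i (\<lambda>y. \<eta> n (x - y)) y = - D n (x - y)" for y
        by (simp add: D_def partial_reflect \<eta>(1))
      have "(\<integral>y. G y * (- D n (x - y)) \<partial>lborel) = (LINT y|lebesgue_on \<Omega>. g y * (- D n (x - y)))"
        by (rule bridge[OF G(1), symmetric]) simp
      also have "\<dots> = - (LINT y|lebesgue_on \<Omega>. g' y * \<eta> n (x - y))"
        using g' t unfolding has_weak_partial_def by (simp flip: p)
      also have "(LINT y|lebesgue_on \<Omega>. g' y * \<eta> n (x - y)) = (\<integral>y. G' y * \<eta> n (x - y) \<partial>lborel)"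
        by (rule bridge[OF G'(1)]) simp
      finally have "(\<integral>y. G y * (- D n (x - y)) \<partial>lborel) = - (\<integral>y. G' y * \<eta> n (x - y) \<partial>lborel)" .
      then show ?thesis by simp
    next
      case False
      show ?thesis by (simp only: \<phi>0[OF False] mult_zero_left mult_zero_right)
    qed
    have "(?I G' (\<lambda>x. F x * \<phi> x) (\<eta> n)) =
        (\<integral>x. F x * \<phi> x * (\<integral>y. G' y * \<eta> n (x - y) \<partial>lborel) \<partial>lborel)"
      by (rule kernel_swap(1)[OF int(2) G'(2) _ M]) simp
    also have "\<dots> = (\<integral>x. F x * \<phi> x * (\<integral>y. G y * D n (x - y) \<partial>lborel) \<partial>lborel)" by (simp only: Bx)
    also have "\<dots> = (?I G (\<lambda>x. F x * \<phi> x) (D n))"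
      by (rule kernel_swap(1)[OF int(2) G(2) _ M', symmetric]) simp
    finally have 2: "(?I G' (\<lambda>x. F x * \<phi> x) (\<eta> n)) =
        (?I G (\<lambda>x. F x * \<phi> x) (D n))" .
    have "(?I G (\<lambda>x. F x * ?d x) (\<eta> n)) +
        (?I G (\<lambda>x. F x * \<phi> x) (D n)) =
        (\<integral>y. G y * ((\<integral>x. F x * ?d x * \<eta> n (x - y) \<partial>lborel) + (\<integral>x. F x * \<phi> x * D n (x - y) \<partial>lborel)) \<partial>lborel)"
      using kernel_swap(2)[where c = "\<eta> n", OF int(1) G(2) _ M]
        kernel_swap(2)[where c = "D n", OF int(2) G(2) _ M'] by (simp add: distrib_left)
    also have "\<dots> = - (?I G (\<lambda>x. F' x * \<phi> x) (\<eta> n))" by (simp only: A) simp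
    finally show ?thesis using 2 by simp
  qed
  have "(\<lambda>n. (?I G (\<lambda>x. F x * ?d x) (\<eta> n)) +
      (?I G' (\<lambda>x. F x * \<phi> x) (\<eta> n)) +
      (?I G (\<lambda>x. F' x * \<phi> x) (\<eta> n)))
    \<longlonglongrightarrow> (\<integral>x. F x * ?d x * G x \<partial>lborel) + (\<integral>x. F x * \<phi> x * G' x \<partial>lborel) + (\<integral>x. F' x * \<phi> x * G x \<partial>lborel)"
    by (intro tendsto_add lim1 lim2 lim3)
  moreover have "(\<lambda>n. (?I G (\<lambda>x. F x * ?d x) (\<eta> n)) +
      (?I G' (\<lambda>x. F x * \<phi> x) (\<eta> n)) +
      (?I G (\<lambda>x. F' x * \<phi> x) (\<eta> n))) \<longlonglongrightarrow> 0"
    using eq by (intro tendsto_eventually) (auto simp: eventually_sequentially)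
  ultimately have sum0: "(\<integral>x. F x * ?d x * G x \<partial>lborel) + (\<integral>x. F x * \<phi> x * G' x \<partial>lborel) +
      (\<integral>x. F' x * \<phi> x * G x \<partial>lborel) = 0"
    using LIMSEQ_unique by blast
  have "(LINT x|lebesgue_on \<Omega>. (f x * g' x + f' x * g x) * \<phi> x) =
      (LINT x|lebesgue_on \<Omega>. f x * g' x * \<phi> x) + (LINT x|lebesgue_on \<Omega>. f' x * g x * \<phi> x)"
    using test_function_integrable(1)[OF Linf_locally_integrable[OF Linf_mult[OF Linf(1,4)] \<Omega>] \<Omega>(1) \<phi>]
      test_function_integrable(1)[OF Linf_locally_integrable[OF Linf_mult[OF Linf(3,2)] \<Omega>] \<Omega>(1) \<phi>]
    by (simp add: distrib_right)
  also have "(LINT x|lebesgue_on \<Omega>. f x * g' x * \<phi> x) = (\<integral>x. F x * G' x * \<phi> x \<partial>lborel)"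
    by (rule bridge[OF representative_mult[OF F(1) G'(1)]]) simp
  also have "(LINT x|lebesgue_on \<Omega>. f' x * g x * \<phi> x) = (\<integral>x. F' x * G x * \<phi> x \<partial>lborel)"
    by (rule bridge[OF representative_mult[OF F'(1) G(1)]]) simp
  also have "(\<integral>x. F x * G' x * \<phi> x \<partial>lborel) + (\<integral>x. F' x * G x * \<phi> x \<partial>lborel) = - (\<integral>x. F x * G x * ?d x \<partial>lborel)"
    using sum0 by (simp add: mult_ac)
  also have "(\<integral>x. F x * G x * ?d x \<partial>lborel) = (LINT x|lebesgue_on \<Omega>. f x * g x * ?d x)"
    by (rule bridge[OF representative_mult[OF F(1) G(1)], symmetric]) simp
  finally show "(LINT x|lebesgue_on \<Omega>. f x * g x * ?d x) =
      - (LINT x|lebesgue_on \<Omega>. (f x * g' x + f' x * g x) * \<phi> x)" by simp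
qed

section \<open>Square-integrable functions and the Sobolev spaces\<close>

definition square_integrable :: "'a measure \<Rightarrow> ('a \<Rightarrow> 'e::euclidean_space) \<Rightarrow> bool" where
  "square_integrable M D \<longleftrightarrow> D \<in> borel_measurable M \<and> integrable M (\<lambda>x. D x \<bullet> D x)"

lemma square_integrable_inner:
  assumes "square_integrable M D" "square_integrable M E"
  shows "integrable M (\<lambda>x. D x \<bullet> E x)"
proof -
  have "integrable M (\<lambda>x. D x \<bullet> D x + E x \<bullet> E x)" using assms by (simp add: square_integrable_def)
  moreover have "(\<lambda>x. D x \<bullet> E x) \<in> borel_measurable M"
    using assms by (auto simp: square_integrable_def intro: borel_measurable_inner)
  ultimately show ?thesis
  proof (rule Bochner_Integration.integrable_bound, intro AE_I2)
    fix x
    have "\<bar>D x \<bullet> E x\<bar> \<le> norm (D x) * norm (E x)" by (rule Cauchy_Schwarz_ineq2)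
    also have "\<dots> \<le> (norm (D x))\<^sup>2 + (norm (E x))\<^sup>2"
      using sum_squares_bound[of "norm (D x)" "norm (E x)"]
        mult_nonneg_nonneg[OF norm_ge_zero[of "D x"] norm_ge_zero[of "E x"]] by linarith
    finally show "norm (D x \<bullet> E x) \<le> norm (D x \<bullet> D x + E x \<bullet> E x)"
      by (simp add: power2_norm_eq_inner)
  qed
qed

lemma square_integrable_add:
  assumes "square_integrable M D" "square_integrable M E"
  shows "square_integrable M (\<lambda>x. D x + E x)"
proof -
  have "integrable M (\<lambda>x. D x \<bullet> D x + D x \<bullet> E x + (E x \<bullet> D x + E x \<bullet> E x))"
    using assms by (intro Bochner_Integration.integrable_add square_integrable_inner)
  then show ?thesis using assms by (auto simp: square_integrable_def inner_add algebra_simps)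
qed

lemma square_integrable_scaleR: "square_integrable M D \<Longrightarrow> square_integrable M (\<lambda>x. c *\<^sub>R D x)"
  by (auto simp: square_integrable_def)

lemma square_integrable_vec:
  fixes w :: "'n::finite \<Rightarrow> 'a \<Rightarrow> 'e::euclidean_space"
  assumes "\<And>i. square_integrable M (w i)"
  shows "square_integrable M (\<lambda>x. \<chi> i. w i x)"
  unfolding square_integrable_def
proof
  show "(\<lambda>x. \<chi> i. w i x) \<in> borel_measurable M"
    unfolding borel_measurable_euclidean_space[where f = "\<lambda>x. \<chi> i. w i x"]
    using assms by (auto simp: Basis_vec_def inner_axis square_integrable_def intro: borel_measurable_inner)
  show "integrable M (\<lambda>x. (\<chi> i. w i x) \<bullet> (\<chi> i. w i x))"
    using assms by (auto simp: inner_vec_def square_integrable_def)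
qed

text \<open>The \<open>H\<^sup>1\<close> inner products and \<open>a\<close> are sums of forms of this kind, with \<open>T\<close> the identity, the gradient or the
  strain. Weak derivatives are only determined up to null sets, so \<open>T\<close> is only linear up to null sets.\<close>

lemma bilinear_on_L2:
  fixes T :: "'v::real_vector \<Rightarrow> 'a \<Rightarrow> 'e::euclidean_space"
  assumes U: "subspace U" and sq: "\<And>u. u \<in> U \<Longrightarrow> square_integrable M (T u)"
    and add: "\<And>u v. u \<in> U \<Longrightarrow> v \<in> U \<Longrightarrow> AE x in M. T (u + v) x = T u x + T v x"
    and scale: "\<And>u c. u \<in> U \<Longrightarrow> AE x in M. T (c *\<^sub>R u) x = c *\<^sub>R T u x"
  shows "bilinear_on U U (\<lambda>u v. \<integral>x. T u x \<bullet> T v x \<partial>M)"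
proof -
  have lin: "functional_on U (\<lambda>u. \<integral>x. T u x \<bullet> T w x \<partial>M)" if w: "w \<in> U" for w
    unfolding functional_on_def
  proof (intro conjI ballI allI)
    note int = square_integrable_inner[OF sq sq[OF w]]
    fix u v c assume u: "u \<in> U" and v: "v \<in> U"
    have "(\<integral>x. T (u + v) x \<bullet> T w x \<partial>M) = (\<integral>x. T u x \<bullet> T w x + T v x \<bullet> T w x \<partial>M)"
    proof (rule integral_cong_AE)
      show "AE x in M. T (u + v) x \<bullet> T w x = T u x \<bullet> T w x + T v x \<bullet> T w x"
        using add[OF u v] by eventually_elim (simp add: inner_add_left)
    qed (use int u v subspace_add[OF U u v] in \<open>auto intro!: borel_measurable_add dest: borel_measurable_integrable\<close>)
    then show "(\<integral>x. T (u + v) x \<bullet> T w x \<partial>M) = (\<integral>x. T u x \<bullet> T w x \<partial>M) + (\<integral>x. T v x \<bullet> T w x \<partial>M)"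
      using int[OF u] int[OF v] by simp
    have "(\<integral>x. T (c *\<^sub>R u) x \<bullet> T w x \<partial>M) = (\<integral>x. c * (T u x \<bullet> T w x) \<partial>M)"
    proof (rule integral_cong_AE)
      show "AE x in M. T (c *\<^sub>R u) x \<bullet> T w x = c * (T u x \<bullet> T w x)"
        using scale[OF u, of c] by eventually_elim simp
    qed (use int u subspace_scale[OF U u] in \<open>auto intro!: borel_measurable_times dest: borel_measurable_integrable\<close>)
    then show "(\<integral>x. T (c *\<^sub>R u) x \<bullet> T w x \<partial>M) = c * (\<integral>x. T u x \<bullet> T w x \<partial>M)" by simp
  qed
  moreover have "functional_on U (\<lambda>v. \<integral>x. T w x \<bullet> T v x \<partial>M)" if "w \<in> U" for w
    using lin[OF that] by (simp add: inner_commute)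
  ultimately show ?thesis by (simp add: bilinear_on_def)
qed

lemma bilinear_on_plus:
  "bilinear_on U W A \<Longrightarrow> bilinear_on U W B \<Longrightarrow> bilinear_on U W (\<lambda>u w. A u w + B u w)"
  by (auto simp: bilinear_on_def functional_on_def algebra_simps)

lemma L2_iff: "f \<in> L2 \<Omega> \<longleftrightarrow> square_integrable (lebesgue_on \<Omega>) f"
  by (simp add: L2_def square_integrable_def power2_eq_square)

lemma L2_cong_AE:
  assumes "open \<Omega>" "f \<in> L2 \<Omega>" "AE x in lebesgue_on \<Omega>. f x = g x"
  shows "g \<in> L2 \<Omega>"
proof -
  have f: "f \<in> borel_measurable (lebesgue_on \<Omega>)" "integrable (lebesgue_on \<Omega>) (\<lambda>x. (f x)\<^sup>2)"
    using assms(2) by (auto simp: L2_def)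
  have "(\<lambda>x. indicator \<Omega> x *\<^sub>R f x) \<in> borel_measurable lebesgue"
    using f(1) assms(1) by (subst (asm) borel_measurable_restrict_space_iff) auto
  moreover have "AE x in lebesgue. x \<in> \<Omega> \<longrightarrow> f x = g x"
    using assms(1,3) by (subst (asm) AE_restrict_space_iff) auto
  then have "AE x in lebesgue. indicator \<Omega> x *\<^sub>R f x = indicator \<Omega> x *\<^sub>R g x"
    by eventually_elim (auto simp: indicator_def)
  ultimately have "(\<lambda>x. indicator \<Omega> x *\<^sub>R g x) \<in> borel_measurable lebesgue" by (rule borel_measurable_AE)
  then have g: "g \<in> borel_measurable (lebesgue_on \<Omega>)"
    using assms(1) by (subst borel_measurable_restrict_space_iff) auto
  have "integrable (lebesgue_on \<Omega>) (\<lambda>x. (g x)\<^sup>2)"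
  proof (rule integrable_cong_AE_imp[OF f(2)])
    show "(\<lambda>x. (g x)\<^sup>2) \<in> borel_measurable (lebesgue_on \<Omega>)" using g by measurable
    show "AE x in lebesgue_on \<Omega>. (f x)\<^sup>2 = (g x)\<^sup>2" using assms(3) by eventually_elim simp
  qed
  then show ?thesis using g by (simp add: L2_def)
qed

text \<open>Membership in \<^const>\<open>H1\<close> provides some weak derivative in \<^const>\<open>L2\<close>; the one chosen by
  \<^const>\<open>weak_partial\<close> agrees with it almost everywhere.\<close>

lemma H1_weak_partial:
  assumes "open \<Omega>" "f \<in> H1 \<Omega>"
  shows "has_weak_partial \<Omega> i f (weak_partial \<Omega> i f)" "weak_partial \<Omega> i f \<in> L2 \<Omega>"
proof -
  obtain g where g: "g \<in> L2 \<Omega>" "has_weak_partial \<Omega> i f g" using assms(2) by (auto simp: H1_def)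
  show *: "has_weak_partial \<Omega> i f (weak_partial \<Omega> i f)"
    unfolding weak_partial_def by (rule someI[where P = "has_weak_partial \<Omega> i f", OF g(2)])
  show "weak_partial \<Omega> i f \<in> L2 \<Omega>"
    by (rule L2_cong_AE[OF assms(1) g(1) has_weak_partial_unique[OF assms(1) g(2) *]])
qed

lemma H1_square_integrable: "f \<in> H1 \<Omega> \<Longrightarrow> square_integrable (lebesgue_on \<Omega>) f"
  by (simp add: H1_def L2_iff)

lemma weak_partial_add:
  assumes "open \<Omega>" "f \<in> H1 \<Omega>" "g \<in> H1 \<Omega>"
  shows "AE x in lebesgue_on \<Omega>. weak_partial \<Omega> i (f + g) x = weak_partial \<Omega> i f x + weak_partial \<Omega> i g x"
  unfolding plus_fun_def
  using assms by (intro weak_partial_AE has_weak_partial_add H1_weak_partial)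

lemma weak_partial_scaleR:
  assumes "open \<Omega>" "f \<in> H1 \<Omega>"
  shows "AE x in lebesgue_on \<Omega>. weak_partial \<Omega> i (c *\<^sub>R f) x = c *\<^sub>R weak_partial \<Omega> i f x"
  unfolding scaleR_fun_def real_scaleR_def
  using assms by (intro weak_partial_AE has_weak_partial_cmult H1_weak_partial)

lemma subspace_H1:
  assumes "open \<Omega>"
  shows "subspace (H1 \<Omega>)"
  unfolding subspace_def
proof (intro conjI ballI allI)
  have z: "(\<lambda>x. 0) \<in> L2 \<Omega>" by (simp add: L2_def)
  have "has_weak_partial \<Omega> i (\<lambda>x. 0) (\<lambda>x. 0)" for i
    by (auto simp: has_weak_partial_def locally_integrable_def set_integrable_def)
  then show "0 \<in> H1 \<Omega>" using z unfolding H1_def zero_fun_def by blast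
next
  fix f g assume fg: "f \<in> H1 \<Omega>" "g \<in> H1 \<Omega>"
  have "f + g \<in> L2 \<Omega>"
    using fg square_integrable_add[of _ f g] by (simp add: H1_def L2_iff plus_fun_def)
  moreover have "\<exists>h\<in>L2 \<Omega>. has_weak_partial \<Omega> i (f + g) h" for i
  proof (rule bexI)
    show "has_weak_partial \<Omega> i (f + g) (\<lambda>x. weak_partial \<Omega> i f x + weak_partial \<Omega> i g x)"
      unfolding plus_fun_def by (intro has_weak_partial_add H1_weak_partial assms fg)
    show "(\<lambda>x. weak_partial \<Omega> i f x + weak_partial \<Omega> i g x) \<in> L2 \<Omega>"
      using H1_weak_partial(2)[OF assms] fg unfolding L2_iff by (intro square_integrable_add) auto
  qed
  ultimately show "f + g \<in> H1 \<Omega>" by (simp add: H1_def)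
next
  fix f c assume f: "f \<in> H1 \<Omega>"
  have "c *\<^sub>R f \<in> L2 \<Omega>"
    using f square_integrable_scaleR[of _ f c] by (simp add: H1_def L2_iff scaleR_fun_def)
  moreover have "\<exists>h\<in>L2 \<Omega>. has_weak_partial \<Omega> i (c *\<^sub>R f) h" for i
  proof (rule bexI)
    show "has_weak_partial \<Omega> i (c *\<^sub>R f) (\<lambda>x. c * weak_partial \<Omega> i f x)"
      unfolding scaleR_fun_def real_scaleR_def by (intro has_weak_partial_cmult H1_weak_partial assms f)
    show "(\<lambda>x. c * weak_partial \<Omega> i f x) \<in> L2 \<Omega>"
      using square_integrable_scaleR[of _ "weak_partial \<Omega> i f" c] H1_weak_partial(2)[OF assms f, of i]
      by (simp add: L2_iff)
  qed
  ultimately show "c *\<^sub>R f \<in> H1 \<Omega>" by (simp add: H1_def)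
qed

lemma subspace_vec_space:
  assumes "subspace X"
  shows "subspace (vec_space X)"
proof -
  have e: "(\<lambda>x. (0 :: real^'n \<Rightarrow> real^'n) x $ i) = 0" "(\<lambda>x. (u + v) x $ i) = (\<lambda>x. u x $ i) + (\<lambda>x. v x $ i)"
    "(\<lambda>x. (c *\<^sub>R u) x $ i) = c *\<^sub>R (\<lambda>x. u x $ i)" for u v :: "real^'n \<Rightarrow> real^'n" and c i
    by (auto simp: fun_eq_iff)
  show ?thesis
    using assms unfolding subspace_def vec_space_def
    by (auto simp: e simp del: plus_fun_apply zero_fun_apply scaleR_fun_apply)
qed

lemma wgrad_square_integrable:
  assumes "open \<Omega>" "f \<in> H1 \<Omega>"
  shows "square_integrable (lebesgue_on \<Omega>) (wgrad \<Omega> f)"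
proof -
  have "square_integrable (lebesgue_on \<Omega>) (\<lambda>x. \<chi> i. weak_partial \<Omega> i f x)"
    using H1_weak_partial(2)[OF assms] by (intro square_integrable_vec) (simp add: L2_iff)
  moreover have "wgrad \<Omega> f = (\<lambda>x. \<chi> i. weak_partial \<Omega> i f x)" by (simp add: wgrad_def fun_eq_iff)
  ultimately show ?thesis by simp
qed

lemma AE_vec_eqI:
  fixes f g :: "'a \<Rightarrow> 'b ^ 'n"
  assumes "\<And>i. AE x in M. f x $ i = g x $ i"
  shows "AE x in M. f x = g x"
proof -
  have "AE x in M. \<forall>i\<in>UNIV. f x $ i = g x $ i" using assms by (intro AE_finite_allI) auto
  then show ?thesis by eventually_elim (simp add: vec_eq_iff)
qed

lemma wgrad_add:
  assumes "open \<Omega>" "f \<in> H1 \<Omega>" "g \<in> H1 \<Omega>"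
  shows "AE x in lebesgue_on \<Omega>. wgrad \<Omega> (f + g) x = wgrad \<Omega> f x + wgrad \<Omega> g x"
  by (rule AE_vec_eqI) (use weak_partial_add[OF assms] in \<open>simp add: wgrad_def\<close>)

lemma wgrad_scaleR:
  assumes "open \<Omega>" "f \<in> H1 \<Omega>"
  shows "AE x in lebesgue_on \<Omega>. wgrad \<Omega> (c *\<^sub>R f) x = c *\<^sub>R wgrad \<Omega> f x"
  by (rule AE_vec_eqI) (use weak_partial_scaleR[OF assms] in \<open>simp add: wgrad_def\<close>)

lemma wgrad_vec_square_integrable:
  assumes "open \<Omega>" "u \<in> vec_space (H1 \<Omega>)"
  shows "square_integrable (lebesgue_on \<Omega>) (wgrad_vec \<Omega> u)"
proof -
  have "square_integrable (lebesgue_on \<Omega>) (\<lambda>x. \<chi> i. wgrad \<Omega> (\<lambda>y. u y $ i) x)"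
    using assms by (intro square_integrable_vec wgrad_square_integrable) (auto simp: vec_space_def)
  moreover have "wgrad_vec \<Omega> u = (\<lambda>x. \<chi> i. wgrad \<Omega> (\<lambda>y. u y $ i) x)" by (simp add: wgrad_vec_def fun_eq_iff)
  ultimately show ?thesis by simp
qed

lemma wgrad_vec_add:
  assumes "open \<Omega>" "u \<in> vec_space (H1 \<Omega>)" "v \<in> vec_space (H1 \<Omega>)"
  shows "AE x in lebesgue_on \<Omega>. wgrad_vec \<Omega> (u + v) x = wgrad_vec \<Omega> u x + wgrad_vec \<Omega> v x"
proof (rule AE_vec_eqI)
  fix i
  have "(\<lambda>y. (u + v) y $ i) = (\<lambda>y. u y $ i) + (\<lambda>y. v y $ i)" by (simp add: fun_eq_iff)
  then show "AE x in lebesgue_on \<Omega>. wgrad_vec \<Omega> (u + v) x $ i = (wgrad_vec \<Omega> u x + wgrad_vec \<Omega> v x) $ i"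
    using wgrad_add[OF assms(1), of "\<lambda>y. u y $ i" "\<lambda>y. v y $ i"] assms
    by (simp add: wgrad_vec_def vec_space_def)
qed

lemma wgrad_vec_scaleR:
  assumes "open \<Omega>" "u \<in> vec_space (H1 \<Omega>)"
  shows "AE x in lebesgue_on \<Omega>. wgrad_vec \<Omega> (c *\<^sub>R u) x = c *\<^sub>R wgrad_vec \<Omega> u x"
proof (rule AE_vec_eqI)
  fix i
  have "(\<lambda>y. (c *\<^sub>R u) y $ i) = c *\<^sub>R (\<lambda>y. u y $ i)" by (simp add: fun_eq_iff)
  then show "AE x in lebesgue_on \<Omega>. wgrad_vec \<Omega> (c *\<^sub>R u) x $ i = (c *\<^sub>R wgrad_vec \<Omega> u x) $ i"
    using wgrad_scaleR[OF assms(1), of "\<lambda>y. u y $ i" c] assms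
    by (simp add: wgrad_vec_def vec_space_def)
qed

lemma H1_inner_bilinear:
  assumes "open \<Omega>"
  shows "bilinear_on (H1 \<Omega>) (H1 \<Omega>) (H1_inner \<Omega>)"
proof -
  have "bilinear_on (H1 \<Omega>) (H1 \<Omega>) (\<lambda>f g. (LINT x|lebesgue_on \<Omega>. f x \<bullet> g x))"
    by (rule bilinear_on_L2[where T = "\<lambda>f. f"]) (auto simp: subspace_H1 assms H1_square_integrable)
  moreover have "bilinear_on (H1 \<Omega>) (H1 \<Omega>) (\<lambda>f g. (LINT x|lebesgue_on \<Omega>. wgrad \<Omega> f x \<bullet> wgrad \<Omega> g x))"
    by (intro bilinear_on_L2 subspace_H1 wgrad_square_integrable wgrad_add wgrad_scaleR assms)
  ultimately have "bilinear_on (H1 \<Omega>) (H1 \<Omega>) (\<lambda>f g. (LINT x|lebesgue_on \<Omega>. f x \<bullet> g x) +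
      (LINT x|lebesgue_on \<Omega>. wgrad \<Omega> f x \<bullet> wgrad \<Omega> g x))"
    by (rule bilinear_on_plus)
  also have "(\<lambda>f g. (LINT x|lebesgue_on \<Omega>. f x \<bullet> g x) +
      (LINT x|lebesgue_on \<Omega>. wgrad \<Omega> f x \<bullet> wgrad \<Omega> g x)) = H1_inner \<Omega>"
    by (simp add: H1_inner_def fun_eq_iff)
  finally show ?thesis .
qed

lemma H1_inner_vec_bilinear:
  fixes \<Omega> :: "(real^'n) set"
  assumes "open \<Omega>"
  shows "bilinear_on (vec_space (H1 \<Omega>)) (vec_space (H1 \<Omega>)) (H1_inner_vec \<Omega>)"
proof -
  have sq: "square_integrable (lebesgue_on \<Omega>) u" if "u \<in> vec_space (H1 \<Omega>)" for u
  proof -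
    have "square_integrable (lebesgue_on \<Omega>) (\<lambda>x. \<chi> i. u x $ i)"
      using that by (intro square_integrable_vec) (auto simp: vec_space_def H1_def L2_iff)
    then show ?thesis by simp
  qed
  have "bilinear_on (vec_space (H1 \<Omega>)) (vec_space (H1 \<Omega>)) (\<lambda>u v. (LINT x|lebesgue_on \<Omega>. u x \<bullet> v x))"
    by (rule bilinear_on_L2[where T = "\<lambda>f. f"]) (auto simp: subspace_vec_space subspace_H1 assms sq)
  moreover have "bilinear_on (vec_space (H1 \<Omega>)) (vec_space (H1 \<Omega>))
      (\<lambda>u v. (LINT x|lebesgue_on \<Omega>. wgrad_vec \<Omega> u x \<bullet> wgrad_vec \<Omega> v x))"
    by (intro bilinear_on_L2 subspace_vec_space subspace_H1 wgrad_vec_square_integrable wgrad_vec_add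
        wgrad_vec_scaleR assms)
  ultimately have "bilinear_on (vec_space (H1 \<Omega>)) (vec_space (H1 \<Omega>)) (\<lambda>u v. (LINT x|lebesgue_on \<Omega>. u x \<bullet> v x) +
      (LINT x|lebesgue_on \<Omega>. wgrad_vec \<Omega> u x \<bullet> wgrad_vec \<Omega> v x))"
    by (rule bilinear_on_plus)
  also have "(\<lambda>u v. (LINT x|lebesgue_on \<Omega>. u x \<bullet> v x) +
      (LINT x|lebesgue_on \<Omega>. wgrad_vec \<Omega> u x \<bullet> wgrad_vec \<Omega> v x)) = H1_inner_vec \<Omega>"
    by (simp add: H1_inner_vec_def fun_eq_iff)
  finally show ?thesis .
qed

lemma form_a_bilinear:
  fixes \<Omega> :: "(real^'n) set"
  assumes "open \<Omega>"
  shows "bilinear_on (vec_space (H1 \<Omega>)) (vec_space (H1 \<Omega>)) (form_a \<Omega>)"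
proof -
  have "bilinear_on (vec_space (H1 \<Omega>)) (vec_space (H1 \<Omega>))
      (\<lambda>u v. (LINT x|lebesgue_on \<Omega>. strain \<Omega> u x \<bullet> strain \<Omega> v x))"
  proof (rule bilinear_on_L2)
    show "subspace (vec_space (H1 \<Omega>))" by (intro subspace_vec_space subspace_H1 assms)
    fix u c assume u: "u \<in> vec_space (H1 \<Omega>)"
    have "square_integrable (lebesgue_on \<Omega>) (\<lambda>x. \<chi> i. \<chi> j. weak_partial \<Omega> i (\<lambda>y. u y $ j) x)"
      using u H1_weak_partial(2)[OF assms]
      by (intro square_integrable_vec) (auto simp: vec_space_def L2_iff)
    moreover have "transpose (wgrad_vec \<Omega> u x) = (\<chi> i. \<chi> j. weak_partial \<Omega> i (\<lambda>y. u y $ j) x)" for x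
      by (simp add: transpose_def wgrad_vec_def wgrad_def vec_eq_iff)
    ultimately have "square_integrable (lebesgue_on \<Omega>) (\<lambda>x. transpose (wgrad_vec \<Omega> u x))" by simp
    from square_integrable_add[OF wgrad_vec_square_integrable[OF assms u] this]
    show "square_integrable (lebesgue_on \<Omega>) (strain \<Omega> u)"
      by (simp add: strain_def[abs_def])
    show "AE x in lebesgue_on \<Omega>. strain \<Omega> (c *\<^sub>R u) x = c *\<^sub>R strain \<Omega> u x"
      using wgrad_vec_scaleR[OF assms u, of c]
      by eventually_elim (simp add: strain_def transpose_def vec_eq_iff algebra_simps)
  next
    fix u v assume "u \<in> vec_space (H1 \<Omega>)" "v \<in> vec_space (H1 \<Omega>)"
    from wgrad_vec_add[OF assms this]
    show "AE x in lebesgue_on \<Omega>. strain \<Omega> (u + v) x = strain \<Omega> u x + strain \<Omega> v x"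
      by eventually_elim (simp add: strain_def transpose_def vec_eq_iff)
  qed
  then show ?thesis by (simp add: form_a_def[abs_def])
qed

lemma form_symmetric:
  "H1_inner_vec \<Omega> u v = H1_inner_vec \<Omega> v u" "form_a \<Omega> u v = form_a \<Omega> v u" "form_a \<Omega> u u \<ge> 0"
  by (simp_all add: H1_inner_vec_def form_a_def inner_commute)

lemma H1_inner_cong_AE:
  assumes "open \<Omega>" "g \<in> H1 \<Omega>" "f \<in> H1 \<Omega>" "f' \<in> H1 \<Omega>" "AE x in lebesgue_on \<Omega>. f x = f' x"
  shows "H1_inner \<Omega> g f = H1_inner \<Omega> g f'"
proof -
  have "wgrad \<Omega> f = wgrad \<Omega> f'"
    using weak_partial_cong_AE[OF assms(1,5)] by (simp add: wgrad_def fun_eq_iff)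
  moreover have "(LINT x|lebesgue_on \<Omega>. g x * f x) = (LINT x|lebesgue_on \<Omega>. g x * f' x)"
  proof (rule integral_cong_AE)
    show "AE x in lebesgue_on \<Omega>. g x * f x = g x * f' x" using assms(5) by eventually_elim simp
  qed (use assms in \<open>auto simp: H1_def L2_def intro!: borel_measurable_times\<close>)
  ultimately show ?thesis by (simp add: H1_inner_def)
qed

section \<open>The algebra of functions with bounded weak derivatives\<close>

lemma Hinf_1_iff: "f \<in> Hinf 1 \<Omega> \<longleftrightarrow> f \<in> Linf \<Omega> \<and> (\<forall>i. \<exists>g\<in>Linf \<Omega>. has_weak_partial \<Omega> i f g)"
  by (simp only: One_nat_def Hinf.simps mem_Collect_eq)

lemma Linf_subset_L2:
  fixes \<Omega> :: "(real^'n) set"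
  assumes \<Omega>: "open \<Omega>" "bounded \<Omega>" and f: "f \<in> Linf \<Omega>"
  shows "f \<in> L2 \<Omega>"
  using f Linf_integrable[OF Linf_mult[OF f f] \<Omega>] by (simp add: L2_def Linf_def power2_eq_square)

lemma Hinf_1_subset_H1:
  fixes \<Omega> :: "(real^'n) set"
  assumes "open \<Omega>" "bounded \<Omega>" "f \<in> Hinf 1 \<Omega>"
  shows "f \<in> H1 \<Omega>"
  using assms Linf_subset_L2[OF assms(1,2)] unfolding Hinf_1_iff H1_def by blast

lemma Hinf_1_add:
  assumes "open \<Omega>" "f \<in> Hinf 1 \<Omega>" "g \<in> Hinf 1 \<Omega>"
  shows "(\<lambda>x. f x + g x) \<in> Hinf 1 \<Omega>"
  unfolding Hinf_1_iff
proof (intro conjI allI)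
  show "(\<lambda>x. f x + g x) \<in> Linf \<Omega>" using assms by (auto simp: Hinf_1_iff intro: Linf_add)
  fix i
  obtain f' where "f' \<in> Linf \<Omega>" "has_weak_partial \<Omega> i f f'" using assms(2) unfolding Hinf_1_iff by blast
  moreover obtain g' where "g' \<in> Linf \<Omega>" "has_weak_partial \<Omega> i g g'" using assms(3) unfolding Hinf_1_iff by blast
  ultimately show "\<exists>h\<in>Linf \<Omega>. has_weak_partial \<Omega> i (\<lambda>x. f x + g x) h"
    using has_weak_partial_add[OF assms(1)] Linf_add by blast
qed

lemma Hinf_1_mult:
  fixes \<Omega> :: "(real^'n) set"
  assumes \<Omega>: "open \<Omega>" "bounded \<Omega>" and fg: "f \<in> Hinf 1 \<Omega>" "g \<in> Hinf 1 \<Omega>"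
  shows "(\<lambda>x. f x * g x) \<in> Hinf 1 \<Omega>"
  unfolding Hinf_1_iff
proof (intro conjI allI)
  show "(\<lambda>x. f x * g x) \<in> Linf \<Omega>" using fg by (auto simp: Hinf_1_iff intro: Linf_mult)
  fix i
  obtain f' where "f' \<in> Linf \<Omega>" "has_weak_partial \<Omega> i f f'" using fg(1) unfolding Hinf_1_iff by blast
  moreover obtain g' where "g' \<in> Linf \<Omega>" "has_weak_partial \<Omega> i g g'" using fg(2) unfolding Hinf_1_iff by blast
  ultimately show "\<exists>h\<in>Linf \<Omega>. has_weak_partial \<Omega> i (\<lambda>x. f x * g x) h"
    using has_weak_partial_mult[OF \<Omega>, of f g f' g' i] fg
    by (intro bexI[of _ "\<lambda>x. f x * g' x + f' x * g x"] Linf_add Linf_mult) (auto simp: Hinf_1_iff)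
qed

text \<open>This puts \<open>v \<bullet> zhat\<close> into the space on which the \<open>H\<^sup>1\<close> inner product is bilinear.\<close>

lemma Hinf_1_inner:
  fixes \<Omega> :: "(real^'n) set"
  assumes \<Omega>: "open \<Omega>" "bounded \<Omega>" and u: "u \<in> vec_space (Hinf 1 \<Omega>)" and v: "v \<in> vec_space (Hinf 1 \<Omega>)"
  shows "(\<lambda>x. u x \<bullet> v x) \<in> Hinf 1 \<Omega>"
proof -
  have "has_weak_partial \<Omega> i (\<lambda>x. 0) (\<lambda>x. 0)" for i
    by (auto simp: has_weak_partial_def locally_integrable_def set_integrable_def)
  moreover have "(\<lambda>x. 0) \<in> Linf \<Omega>" by (auto simp: Linf_def)
  ultimately have z: "(\<lambda>x. 0) \<in> Hinf 1 \<Omega>" unfolding Hinf_1_iff by blast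
  have "(\<lambda>x. \<Sum>i\<in>I. u x $ i * v x $ i) \<in> Hinf 1 \<Omega>" if "finite I" for I
    using that
  proof (induction I rule: finite_induct)
    case empty
    show ?case using z by (simp only: sum.empty)
  next
    case (insert i I)
    then show ?case
      using u v Hinf_1_add[OF \<Omega>(1) Hinf_1_mult[OF \<Omega>, of "\<lambda>x. u x $ i" "\<lambda>x. v x $ i"] insert.IH]
      by (simp add: vec_space_def)
  qed
  from this[of UNIV] show ?thesis by (simp add: inner_vec_def)
qed

section \<open>Weak derivatives of piecewise smooth Lipschitz functions\<close>

text \<open>Steps \<open>1 / (n + 1)\<close> rather than a real parameter, since dominated convergence is used along
  sequences.\<close>

definition difference_quotient :: "'n \<Rightarrow> (real^'n \<Rightarrow> real) \<Rightarrow> nat \<Rightarrow> real^'n \<Rightarrow> real" where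
  "difference_quotient i f n x = (f (x + (1 / real (Suc n)) *\<^sub>R axis i 1) - f x) * real (Suc n)"

lemma smooth_along_axis:
  assumes "smooth f"
  shows "((\<lambda>t. f (x + t *\<^sub>R axis i 1)) has_real_derivative partial i f (x + t *\<^sub>R axis i 1)) (at t)"
proof -
  let ?y = "x + t *\<^sub>R axis i 1"
  have D: "(f has_derivative frechet_derivative f (at ?y)) (at ?y)"
    using smooth_differentiable[OF assms] frechet_derivative_works by blast
  have "((\<lambda>t. f (x + t *\<^sub>R axis i 1)) has_derivative (\<lambda>h. frechet_derivative f (at ?y) (h *\<^sub>R axis i 1))) (at t)"
    by (rule has_derivative_compose[where f = "\<lambda>t. x + t *\<^sub>R axis i 1", OF _ D])
      (auto intro!: derivative_eq_intros)
  then show ?thesis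
    using linear_scale[OF has_derivative_linear[OF D]]
    by (simp add: has_field_derivative_def partial_def mult.commute[of _ "frechet_derivative _ _ _"])
qed

text \<open>The reflected quotient in the third claim is the backward difference quotient of \<open>f\<close>, which is what
  discrete integration by parts produces.\<close>

lemma smooth_difference_quotient:
  assumes f: "smooth f"
  shows "(\<lambda>n. difference_quotient i f n x) \<longlonglongrightarrow> partial i f x"
    and "(\<And>x. \<bar>partial i f x\<bar> \<le> C) \<Longrightarrow> \<bar>difference_quotient i f n x\<bar> \<le> C"
    and "(\<lambda>n. - difference_quotient i (\<lambda>y. f (- y)) n (- x)) \<longlonglongrightarrow> partial i f x"
proof -
  have sm: "smooth (\<lambda>y. f (- y))" using smooth_reflect[OF f, of 0] by simp
  have lim: "(\<lambda>n. difference_quotient i f n x) \<longlonglongrightarrow> partial i f x" if f: "smooth f" for f x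
  proof -
    have "((\<lambda>h. (f (x + (0 + h) *\<^sub>R axis i 1) - f (x + 0 *\<^sub>R axis i 1)) / h) \<longlongrightarrow> partial i f x) (at 0)"
      using smooth_along_axis[OF f, of x i 0] by (simp add: DERIV_def)
    then have "((\<lambda>h. (f (x + h *\<^sub>R axis i 1) - f x) / h) \<longlongrightarrow> partial i f x) (at 0)" by simp
    moreover have "filterlim (\<lambda>n. 1 / real (Suc n)) (at 0) sequentially"
      using LIMSEQ_inverse_real_of_nat by (intro filterlim_atI) (auto simp: inverse_eq_divide)
    ultimately have "(\<lambda>n. (f (x + (1 / real (Suc n)) *\<^sub>R axis i 1) - f x) / (1 / real (Suc n))) \<longlonglongrightarrow> partial i f x"
      by (rule filterlim_compose)
    then show ?thesis by (simp add: difference_quotient_def)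
  qed
  show "(\<lambda>n. difference_quotient i f n x) \<longlonglongrightarrow> partial i f x" by (rule lim[OF f])
  have "(\<lambda>n. - difference_quotient i (\<lambda>y. f (- y)) n (- x)) \<longlonglongrightarrow> - partial i (\<lambda>y. f (- y)) (- x)"
    by (intro tendsto_minus lim sm)
  then show "(\<lambda>n. - difference_quotient i (\<lambda>y. f (- y)) n (- x)) \<longlonglongrightarrow> partial i f x"
    using partial_reflect[OF f, of i 0 "- x"] by simp
  assume C: "\<And>x. \<bar>partial i f x\<bar> \<le> C"
  have "norm (f (x + (1 / real (Suc n)) *\<^sub>R axis i 1) - f (x + 0 *\<^sub>R axis i 1)) \<le> C * norm (1 / real (Suc n) - 0)"
    by (rule field_differentiable_bound[OF convex_UNIV, where f' = "\<lambda>t. partial i f (x + t *\<^sub>R axis i 1)"])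
      (use smooth_along_axis[OF f] C in auto)
  then show "\<bar>difference_quotient i f n x\<bar> \<le> C"
    by (simp add: difference_quotient_def abs_mult pos_le_divide_eq del: of_nat_Suc)
qed

text \<open>Discrete integration by parts: translation invariance of the integral moves a difference quotient
  of \<open>f\<close> to a backward difference quotient of the test function, and both sides converge by dominated
  convergence, with the Lipschitz constants as bounds. Only segments inside \<open>\<Omega>\<close> occur, because the support of
  the test function has a positive distance to the complement of \<open>\<Omega>\<close>.\<close>

theorem lipschitz_has_weak_partial:
  fixes f :: "real^'n \<Rightarrow> real"
  assumes \<Omega>: "open \<Omega>" "bounded \<Omega>" and f [measurable]: "f \<in> borel_measurable borel"
    and B: "\<And>x. x \<in> \<Omega> \<Longrightarrow> \<bar>f x\<bar> \<le> B"
    and L: "\<And>x y. closed_segment x y \<subseteq> \<Omega> \<Longrightarrow> \<bar>f y - f x\<bar> \<le> L * norm (y - x)"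
    and conv: "AE x in lebesgue. x \<in> \<Omega> \<longrightarrow> convergent (\<lambda>n. difference_quotient i f n x)"
  shows "\<exists>g\<in>Linf \<Omega>. has_weak_partial \<Omega> i f g"
proof -
  define g where "g x = lim (\<lambda>n. difference_quotient i f n x)" for x
  have D [measurable]: "difference_quotient i f n \<in> borel_measurable borel" for n
    unfolding difference_quotient_def[abs_def] by measurable
  have g [measurable]: "g \<in> borel_measurable borel" unfolding g_def[abs_def] by measurable
  have g_lim: "AE x in lebesgue. x \<in> \<Omega> \<longrightarrow> (\<lambda>n. difference_quotient i f n x) \<longlonglongrightarrow> g x"
    using conv by eventually_elim (auto simp: g_def convergent_LIMSEQ_iff)
  have D_bound: "\<bar>difference_quotient i f n x\<bar> \<le> L" if "closed_segment x (x + (1 / real (Suc n)) *\<^sub>R axis i 1) \<subseteq> \<Omega>" for n x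
    using L[OF that] by (simp add: difference_quotient_def abs_mult pos_le_divide_eq del: of_nat_Suc)
  have near: "\<exists>N. \<forall>n\<ge>N. closed_segment x (x + (1 / real (Suc n)) *\<^sub>R axis i 1) \<subseteq> S"
    if cb: "cball x \<delta> \<subseteq> S" and \<delta>0: "\<delta> > 0" for x \<delta> and S :: "(real^'n) set"
  proof -
    obtain N where N: "\<And>n. n \<ge> N \<Longrightarrow> 1 / real (Suc n) < \<delta>" using steps_eventually_small[OF \<delta>0] by blast
    have "closed_segment x (x + (1 / real (Suc n)) *\<^sub>R axis i 1) \<subseteq> S" if "n \<ge> N" for n
    proof -
      have "x \<in> cball x \<delta>" "x + (1 / real (Suc n)) *\<^sub>R axis i 1 \<in> cball x \<delta>"
        using N[OF that] \<delta>0 by (auto simp: dist_norm simp del: of_nat_Suc)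
      then have "closed_segment x (x + (1 / real (Suc n)) *\<^sub>R axis i 1) \<subseteq> cball x \<delta>"
        by (intro closed_segment_subset convex_cball)
      then show ?thesis using \<open>cball x \<delta> \<subseteq> S\<close> by blast
    qed
    then show ?thesis by blast
  qed
  have g_bound: "AE x in lebesgue. x \<in> \<Omega> \<longrightarrow> \<bar>g x\<bar> \<le> L"
    using g_lim
  proof eventually_elim
    case (elim x)
    show ?case
    proof
      assume x: "x \<in> \<Omega>"
      obtain \<delta> where "\<delta> > 0" "cball x \<delta> \<subseteq> \<Omega>" using \<Omega>(1) x by (meson open_contains_cball)
      then have "\<exists>N. \<forall>n\<ge>N. \<bar>difference_quotient i f n x\<bar> \<le> L"
        using near[of x \<delta> \<Omega>] D_bound by blast
      moreover have "(\<lambda>n. \<bar>difference_quotient i f n x\<bar>) \<longlonglongrightarrow> \<bar>g x\<bar>" using elim x by (intro tendsto_rabs) auto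
      ultimately show "\<bar>g x\<bar> \<le> L" by (intro LIMSEQ_le_const2)
    qed
  qed
  have meas: "u \<in> borel_measurable (lebesgue_on \<Omega>)" if "u \<in> borel_measurable borel" for u :: "real^'n \<Rightarrow> real"
    using that by (intro measurable_restrict_space1 measurable_completion) simp
  have gL: "g \<in> Linf \<Omega>"
    unfolding Linf_def using g_bound \<Omega>(1) meas[OF g]
    by (auto simp: AE_restrict_space_iff)
  have fL: "f \<in> Linf \<Omega>"
    unfolding Linf_def using meas[OF f] B \<Omega>(1) by (auto simp: AE_restrict_space_iff intro!: exI[of _ B] AE_I2)
  have "(LINT x|lebesgue_on \<Omega>. f x * partial i \<phi> x) = - (LINT x|lebesgue_on \<Omega>. g x * \<phi> x)"
    if \<phi>: "\<phi> \<in> test_functions \<Omega>" for \<phi>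
  proof -
    let ?d = "partial i \<phi>" and ?e = "axis i 1 :: real^'n"
    have sm: "smooth \<phi>" using \<phi> by (simp add: test_functions_iff)
    note [measurable] = smooth_borel_measurable[OF sm] smooth_borel_measurable[OF smooth_partial[OF sm]]
    obtain K C C' where K: "compact K" "K \<subseteq> \<Omega>" and \<phi>0: "\<And>x. x \<notin> K \<Longrightarrow> \<phi> x = 0"
      and C: "\<And>x. \<bar>\<phi> x\<bar> \<le> C" and C': "\<And>x. \<bar>?d x\<bar> \<le> C'"
      using test_function_bounds[OF \<phi>] by blast
    obtain \<delta> K' where \<delta>: "\<delta> > 0" "compact K'" "K' \<subseteq> \<Omega>" "\<And>y. y \<in> K \<Longrightarrow> cball y \<delta> \<subseteq> K'"
      using compact_neighbourhood_in_open[OF K(1) \<Omega>(1) K(2)] by blast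
    have [measurable]: "\<Omega> \<in> sets borel" using \<Omega> by auto
    have fin: "emeasure lborel \<Omega> < \<infinity>" using \<Omega> by (intro emeasure_bounded_finite)
    define F where "F x = indicator \<Omega> x * f x" for x
    have F [measurable]: "F \<in> borel_measurable borel" unfolding F_def by measurable
    have FB: "\<bar>F x\<bar> \<le> \<bar>B\<bar> * indicator \<Omega> x" for x
      using B[of x] by (auto simp: F_def indicator_def)
    have iB: "integrable lborel (\<lambda>x. \<bar>B\<bar> * indicator \<Omega> x :: real)" using fin by simp
    have iF: "integrable lborel F"
      by (rule Bochner_Integration.integrable_bound[OF iB]) (use FB in \<open>auto intro!: AE_I2\<close>)
    let ?h = "\<lambda>n. 1 / real (Suc n)"
    define Q where "Q n x = (\<phi> x - \<phi> (x - ?h n *\<^sub>R ?e)) * real (Suc n)" for n x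
    have Q_eq: "Q n x = - difference_quotient i (\<lambda>y. \<phi> (- y)) n (- x)" for n x
      by (simp add: Q_def difference_quotient_def algebra_simps del: of_nat_Suc)
    have Qlim: "(\<lambda>n. Q n x) \<longlonglongrightarrow> ?d x" for x
      unfolding Q_eq by (rule smooth_difference_quotient(3)[OF sm])
    have Qb: "\<bar>Q n x\<bar> \<le> C'" for n x
      unfolding Q_eq abs_minus_cancel
    proof (rule smooth_difference_quotient(2))
      show "smooth (\<lambda>y. \<phi> (- y))" using smooth_reflect[OF sm, of 0] by simp
      show "\<bar>partial i (\<lambda>y. \<phi> (- y)) y\<bar> \<le> C'" for y
        using partial_reflect[OF sm, of i 0 y] C'[of "- y"] by simp
    qed
    have [measurable]: "Q n \<in> borel_measurable borel" for n unfolding Q_def[abs_def] by measurable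
    have lim1: "(\<lambda>n. \<integral>x. F x * Q n x \<partial>lborel) \<longlonglongrightarrow> (\<integral>x. F x * ?d x \<partial>lborel)"
    proof (rule integral_dominated_convergence[where w = "\<lambda>x. \<bar>F x\<bar> * C'"])
      show "integrable lborel (\<lambda>x. \<bar>F x\<bar> * C')" using iF by auto
      show "AE x in lborel. (\<lambda>n. F x * Q n x) \<longlonglongrightarrow> F x * ?d x"
        by (intro AE_I2 tendsto_intros Qlim)
      show "AE x in lborel. norm (F x * Q n x) \<le> \<bar>F x\<bar> * C'" for n
        using Qb by (intro AE_I2) (auto simp: abs_mult intro!: mult_left_mono)
    qed auto
    obtain N where N: "\<And>n. n \<ge> N \<Longrightarrow> ?h n < \<delta>" using steps_eventually_small[OF \<delta>(1)] by blast
    have eq: "(\<integral>x. F x * Q n x \<partial>lborel) = - (\<integral>x. indicator \<Omega> x * difference_quotient i f n x * \<phi> x \<partial>lborel)"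
      and bound: "\<And>x. \<bar>indicator \<Omega> x * difference_quotient i f n x * \<phi> x\<bar> \<le> L * \<bar>\<phi> x\<bar> * indicator \<Omega> x" if n: "n \<ge> N" for n
    proof -
      have seg: "closed_segment x (x + ?h n *\<^sub>R ?e) \<subseteq> \<Omega>" if "\<phi> x \<noteq> 0" for x
      proof -
        have "x \<in> K" using that \<phi>0 by blast
        have "x \<in> cball x \<delta>" "x + ?h n *\<^sub>R ?e \<in> cball x \<delta>"
          using N[OF n] \<delta>(1) by (auto simp: dist_norm simp del: of_nat_Suc)
        then have "closed_segment x (x + ?h n *\<^sub>R ?e) \<subseteq> cball x \<delta>"
          by (intro closed_segment_subset convex_cball)
        then show ?thesis using \<delta>(3) \<delta>(4)[OF \<open>x \<in> K\<close>] by blast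
      qed
      show "\<bar>indicator \<Omega> x * difference_quotient i f n x * \<phi> x\<bar> \<le> L * \<bar>\<phi> x\<bar> * indicator \<Omega> x" for x
      proof (cases "\<phi> x = 0 \<or> x \<notin> \<Omega>")
        case False
        then show ?thesis using D_bound[OF seg, of x] by (auto simp: abs_mult intro!: mult_right_mono)
      qed auto
      have p: "F x * \<phi> x - F (x + ?h n *\<^sub>R ?e) * \<phi> x = - (?h n * (indicator \<Omega> x * difference_quotient i f n x * \<phi> x))" for x
      proof (cases "\<phi> x = 0")
        case False
        then have "x \<in> \<Omega>" "x + ?h n *\<^sub>R ?e \<in> \<Omega>" using seg[OF False] by auto
        then show ?thesis by (simp add: F_def difference_quotient_def field_simps del: of_nat_Suc)
      qed simp
      have i1: "integrable lborel (\<lambda>x. F x * \<phi> x)" by (rule integrable_bounded_mult[OF iF _ C]) simp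
      have i2: "integrable lborel (\<lambda>x. F x * \<phi> (x - ?h n *\<^sub>R ?e))"
        by (rule integrable_bounded_mult[OF iF _ C]) simp
      \<comment> \<open>Translation invariance is the discrete integration by parts.\<close>
      have s: "(\<integral>x. F x * \<phi> (x - ?h n *\<^sub>R ?e) \<partial>lborel) = (\<integral>x. F (x + ?h n *\<^sub>R ?e) * \<phi> x \<partial>lborel)"
        using integral_lborel_shift(1)[of "\<lambda>x. F x * \<phi> (x - ?h n *\<^sub>R ?e)" "?h n *\<^sub>R ?e"] by simp
      have i3: "integrable lborel (\<lambda>x. F (x + ?h n *\<^sub>R ?e) * \<phi> x)"
        using i2 integral_lborel_shift(2)[of "\<lambda>x. F x * \<phi> (x - ?h n *\<^sub>R ?e)" "?h n *\<^sub>R ?e"] by simp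
      have "(\<integral>x. F x * Q n x \<partial>lborel) = (\<integral>x. (F x * \<phi> x - F x * \<phi> (x - ?h n *\<^sub>R ?e)) * real (Suc n) \<partial>lborel)"
        by (simp add: Q_def algebra_simps)
      also have "\<dots> = ((\<integral>x. F x * \<phi> x \<partial>lborel) - (\<integral>x. F (x + ?h n *\<^sub>R ?e) * \<phi> x \<partial>lborel)) * real (Suc n)"
        using i1 i2 s by (simp del: of_nat_Suc)
      also have "(\<integral>x. F x * \<phi> x \<partial>lborel) - (\<integral>x. F (x + ?h n *\<^sub>R ?e) * \<phi> x \<partial>lborel) =
          (\<integral>x. - (?h n * (indicator \<Omega> x * difference_quotient i f n x * \<phi> x)) \<partial>lborel)"
        unfolding p[symmetric] using i1 i3 by simp
      also have "\<dots> * real (Suc n) = - (\<integral>x. indicator \<Omega> x * difference_quotient i f n x * \<phi> x \<partial>lborel)"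
        by (simp del: of_nat_Suc)
      finally show "(\<integral>x. F x * Q n x \<partial>lborel) =
          - (\<integral>x. indicator \<Omega> x * difference_quotient i f n x * \<phi> x \<partial>lborel)" .
    qed
    have lim2: "(\<lambda>n. \<integral>x. indicator \<Omega> x * difference_quotient i f (n + N) x * \<phi> x \<partial>lborel)
        \<longlonglongrightarrow> (\<integral>x. indicator \<Omega> x * g x * \<phi> x \<partial>lborel)"
    proof (rule integral_dominated_convergence[where w = "\<lambda>x. L * (indicator \<Omega> x * \<bar>\<phi> x\<bar>)"])
      have "integrable lborel (\<lambda>x. indicator \<Omega> x * \<bar>\<phi> x\<bar>)"
        by (rule integrable_bounded_mult[where C = C]) (use fin C in auto)
      then show "integrable lborel (\<lambda>x. L * (indicator \<Omega> x * \<bar>\<phi> x\<bar>))" by simp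
      have "AE x in lborel. x \<in> \<Omega> \<longrightarrow> (\<lambda>n. difference_quotient i f n x) \<longlonglongrightarrow> g x"
        using g_lim by (simp add: AE_completion_iff)
      then show "AE x in lborel. (\<lambda>n. indicator \<Omega> x * difference_quotient i f (n + N) x * \<phi> x)
          \<longlonglongrightarrow> indicator \<Omega> x * g x * \<phi> x"
      proof eventually_elim
        case (elim x)
        then show ?case
          by (cases "x \<in> \<Omega>") (auto intro!: tendsto_intros LIMSEQ_ignore_initial_segment)
      qed
      show "AE x in lborel. norm (indicator \<Omega> x * difference_quotient i f (n + N) x * \<phi> x) \<le> L * (indicator \<Omega> x * \<bar>\<phi> x\<bar>)" for n
        using bound[of "n + N"] by (intro AE_I2) (simp add: mult_ac)
    qed auto
    have "(\<lambda>n. \<integral>x. F x * Q (n + N) x \<partial>lborel) \<longlonglongrightarrow> (\<integral>x. F x * ?d x \<partial>lborel)"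
      by (rule LIMSEQ_ignore_initial_segment[OF lim1])
    moreover have "(\<lambda>n. \<integral>x. F x * Q (n + N) x \<partial>lborel) \<longlonglongrightarrow> - (\<integral>x. indicator \<Omega> x * g x * \<phi> x \<partial>lborel)"
      using tendsto_minus[OF lim2] by (simp add: eq)
    ultimately have *: "(\<integral>x. F x * ?d x \<partial>lborel) = - (\<integral>x. indicator \<Omega> x * g x * \<phi> x \<partial>lborel)"
      using LIMSEQ_unique by blast
    have bridge: "(LINT x|lebesgue_on \<Omega>. u x) = (\<integral>x. indicator \<Omega> x * u x \<partial>lborel)"
      if [measurable]: "u \<in> borel_measurable borel" for u :: "real^'n \<Rightarrow> real"
    proof -
      have "(LINT x|lebesgue_on \<Omega>. u x) = (\<integral>x. indicator \<Omega> x * u x \<partial>lebesgue)"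
        using \<Omega>(1) by (subst integral_restrict_space) auto
      also have "\<dots> = (\<integral>x. indicator \<Omega> x * u x \<partial>lborel)" by (rule integral_completion) measurable
      finally show ?thesis .
    qed
    show ?thesis using * by (subst (1 2) bridge) (auto simp: F_def mult.assoc)
  qed
  then have "has_weak_partial \<Omega> i f g"
    using Linf_locally_integrable[OF fL \<Omega>] Linf_locally_integrable[OF gL \<Omega>] by (simp add: has_weak_partial_def)
  then show ?thesis using gL by blast
qed

section \<open>Finite element functions\<close>

lemma smooth_polys:
  fixes p :: "real^'n \<Rightarrow> real"
  assumes "p \<in> polys k"
  shows "smooth p"
proof -
  obtain c where "p = (\<lambda>x. \<Sum>\<alpha> | (\<Sum>i\<in>UNIV. \<alpha> i) \<le> k. c \<alpha> * (\<Prod>i\<in>UNIV. (x $ i) ^ \<alpha> i))"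
    using assms by (auto simp: polys_def fun_eq_iff)
  moreover have "smooth (\<lambda>x::real^'n. x $ i)" for i :: 'n by (simp add: smooth_def C_k_component)
  ultimately show ?thesis by (auto intro!: smooth_sum smooth_mult smooth_prod smooth_power smooth_const)
qed

lemma smooth_lipschitz_on_compact_convex:
  fixes p :: "real^'n \<Rightarrow> real"
  assumes p: "smooth p" and S: "compact S" "convex S"
  obtains L where "L-lipschitz_on S p"
proof -
  have "\<exists>C. \<forall>x\<in>S. \<bar>partial i p x\<bar> \<le> C" for i
  proof -
    have "bounded (partial i p ` S)"
      by (intro compact_imp_bounded compact_continuous_image S continuous_on_subset[OF smooth_continuous]
          smooth_partial p) auto
    then show ?thesis by (auto simp: bounded_iff)
  qed
  then obtain C where C: "\<And>i x. x \<in> S \<Longrightarrow> \<bar>partial i p x\<bar> \<le> C i" by metis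
  define L where "L = (\<Sum>i\<in>UNIV. \<bar>C i\<bar>)"
  have "onorm (frechet_derivative p (at x)) \<le> L" if x: "x \<in> S" for x
  proof (rule onorm_le)
    fix h :: "real^'n"
    have D: "linear (frechet_derivative p (at x))"
      using smooth_differentiable[OF p] by (simp add: linear_frechet_derivative)
    have "h = (\<Sum>i\<in>UNIV. (h $ i) *\<^sub>R axis i 1)"
      by (simp add: vec_eq_iff sum.delta axis_def if_distrib cong: if_cong)
    then have "frechet_derivative p (at x) h = frechet_derivative p (at x) (\<Sum>i\<in>UNIV. (h $ i) *\<^sub>R axis i 1)"
      by simp
    also have "\<dots> = (\<Sum>i\<in>UNIV. (h $ i) * partial i p x)"
      by (simp add: linear_sum[OF D] linear_scale[OF D] partial_def)
    also have "norm \<dots> \<le> (\<Sum>i\<in>UNIV. \<bar>C i\<bar> * norm h)"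
    proof (rule sum_norm_le)
      fix i
      have "\<bar>partial i p x\<bar> \<le> \<bar>C i\<bar>" using C[OF x, of i] by linarith
      then have "\<bar>partial i p x\<bar> * \<bar>h $ i\<bar> \<le> \<bar>C i\<bar> * norm h"
        using component_le_norm_cart[of h i] by (intro mult_mono) auto
      then show "norm (h $ i * partial i p x) \<le> \<bar>C i\<bar> * norm h" by (simp add: abs_mult mult.commute)
    qed
    also have "\<dots> = L * norm h" by (simp add: L_def sum_distrib_right)
    finally show "norm (frechet_derivative p (at x) h) \<le> L * norm h" .
  qed
  moreover have "(p has_derivative frechet_derivative p (at x)) (at x within S)" for x
    using smooth_differentiable[OF p] frechet_derivative_works has_derivative_at_withinI by blast
  moreover have "L \<ge> 0" by (simp add: L_def sum_nonneg)
  ultimately have "L-lipschitz_on S p"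
    using S(2) by (intro bounded_derivative_imp_lipschitz) auto
  then show ?thesis by (rule that)
qed

lemma simplicial_triangulationD:
  assumes "simplicial_triangulation \<Omega> T"
  shows "finite T" "\<Union>T = closure \<Omega>" "S \<in> T \<Longrightarrow> compact S" "S \<in> T \<Longrightarrow> convex S"
  using assms compact_simplex convex_simplex
  unfolding simplicial_triangulation_def triangulation_def by blast+

text \<open>A polynomial is Lipschitz on each simplex, and the simplices cut the segment into finitely many closed
  pieces. The estimate is restricted to segments in \<open>\<Omega>\<close> since two points of a nonconvex domain may be close to
  each other but far apart within the domain.\<close>

lemma fe_space_lipschitz_on_segments:
  fixes f :: "real^'n \<Rightarrow> real"
  assumes T: "simplicial_triangulation \<Omega> T" and f: "f \<in> fe_space \<Omega> T k"
  obtains L where "\<And>x y. closed_segment x y \<subseteq> \<Omega> \<Longrightarrow> \<bar>f y - f x\<bar> \<le> L * norm (y - x)"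
proof -
  note T' = simplicial_triangulationD[OF T]
  have "\<exists>L. L-lipschitz_on S f" if S: "S \<in> T" for S
  proof -
    obtain p where p: "p \<in> polys k" "\<And>x. x \<in> S \<Longrightarrow> f x = p x" using f S unfolding fe_space_def by blast
    obtain L where "L-lipschitz_on S p"
      using smooth_lipschitz_on_compact_convex[OF smooth_polys[OF p(1)] T'(3,4)[OF S]] .
    then have "L-lipschitz_on S f" by (rule lipschitz_on_transform) (simp add: p(2))
    then show ?thesis by blast
  qed
  then obtain M where M: "\<And>S. S \<in> T \<Longrightarrow> (M S)-lipschitz_on S f" by metis
  define L where "L = (\<Sum>S\<in>T. \<bar>M S\<bar>)"
  have L0: "L \<ge> 0" by (simp add: L_def sum_nonneg)
  have lip: "L-lipschitz_on S f" if "S \<in> T" for S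
  proof (rule lipschitz_on_mono[OF M[OF that] order_refl])
    have "\<bar>M S\<bar> \<le> L" unfolding L_def by (rule member_le_sum) (use that T' in auto)
    then show "M S \<le> L" by linarith
  qed
  have "\<bar>f y - f x\<bar> \<le> L * norm (y - x)" if seg: "closed_segment x y \<subseteq> \<Omega>" for x y
  proof -
    define c where "c t = x + t *\<^sub>R (y - x)" for t :: real
    have cont: "continuous_on UNIV c" unfolding c_def by (intro continuous_intros)
    have "(L * norm (y - x))-lipschitz_on {0..1} (f \<circ> c)"
    proof (rule lipschitz_on_closed_Union[where I = T and U = "\<lambda>S. c -` S"])
      show "(L * norm (y - x))-lipschitz_on (c -` S) (f \<circ> c)" if "S \<in> T" for S
      proof (rule lipschitz_onI)
        fix s t assume st: "s \<in> c -` S" "t \<in> c -` S"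
        have "dist (f (c s)) (f (c t)) \<le> L * dist (c s) (c t)"
          using lipschitz_onD[OF lip[OF that]] st by auto
        also have "dist (c s) (c t) = norm (y - x) * dist s t"
        proof -
          have "c s - c t = (s - t) *\<^sub>R (y - x)" by (simp add: c_def algebra_simps)
          then show ?thesis by (simp add: dist_norm)
        qed
        finally show "dist ((f \<circ> c) s) ((f \<circ> c) t) \<le> L * norm (y - x) * dist s t" by (simp add: mult.assoc)
      qed (use L0 in auto)
      show "closed (c -` S)" if "S \<in> T" for S
        using T'(3)[OF that] cont by (intro closed_vimage) (auto intro: compact_imp_closed)
      show "{0..1} \<subseteq> (\<Union>S\<in>T. c -` S)"
      proof
        fix t :: real assume "t \<in> {0..1}"
        then have "c t \<in> closed_segment x y"
          by (auto simp: c_def in_segment algebra_simps intro!: exI[of _ t])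
        then have "c t \<in> \<Union>T" using seg closure_subset T'(2) by blast
        then show "t \<in> (\<Union>S\<in>T. c -` S)" by auto
      qed
    qed (use T' L0 in auto)
    from lipschitz_onD[OF this, of 1 0] show ?thesis by (simp add: c_def dist_norm)
  qed
  then show ?thesis by (rule that)
qed

text \<open>Off the boundaries of the simplices, which are negligible, \<open>f\<close> is locally a polynomial.\<close>

lemma fe_space_difference_quotients_converge:
  fixes f :: "real^'n \<Rightarrow> real"
  assumes T: "simplicial_triangulation \<Omega> T" and f: "f \<in> fe_space \<Omega> T k"
  shows "AE x in lebesgue. x \<in> \<Omega> \<longrightarrow> convergent (\<lambda>n. difference_quotient i f n x)"
proof -
  note T' = simplicial_triangulationD[OF T]
  have "negligible (\<Union>S\<in>T. frontier S)"
    using T' by (intro negligible_Union) (auto intro: negligible_convex_frontier)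
  then have "AE x in lebesgue. x \<notin> (\<Union>S\<in>T. frontier S)"
    by (simp only: negligible_iff_null_sets AE_not_in)
  then show ?thesis
  proof eventually_elim
    case (elim x)
    show ?case
    proof
      assume "x \<in> \<Omega>"
      then obtain S where S: "S \<in> T" "x \<in> S" using T'(2) closure_subset by blast
      then have "x \<in> interior S" using elim by (auto simp: frontier_def dest: subsetD[OF closure_subset])
      then obtain \<delta> where \<delta>: "\<delta> > 0" "ball x \<delta> \<subseteq> S" by (meson mem_interior)
      obtain p where p: "p \<in> polys k" "\<And>x. x \<in> S \<Longrightarrow> f x = p x" using f S unfolding fe_space_def by blast
      obtain N where N: "\<And>n. n \<ge> N \<Longrightarrow> 1 / real (Suc n) < \<delta>" using steps_eventually_small[OF \<delta>(1)] by blast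
      have "difference_quotient i p n x = difference_quotient i f n x" if "n \<ge> N" for n
      proof -
        have "x + (1 / real (Suc n)) *\<^sub>R axis i 1 \<in> ball x \<delta>"
          using N[OF that] by (simp add: dist_norm del: of_nat_Suc)
        then show ?thesis using p(2) S(2) \<delta>(2) by (auto simp: difference_quotient_def)
      qed
      then have "\<forall>\<^sub>F n in sequentially. difference_quotient i p n x = difference_quotient i f n x"
        by (auto simp: eventually_sequentially)
      then have "(\<lambda>n. difference_quotient i f n x) \<longlonglongrightarrow> partial i p x"
        by (rule Lim_transform_eventually[OF smooth_difference_quotient(1)[OF smooth_polys[OF p(1)]]])
      then show "convergent (\<lambda>n. difference_quotient i f n x)" by (rule convergentI)
    qed
  qed
qed

theorem fe_space_subset_Hinf_1:
  fixes f :: "real^'n \<Rightarrow> real"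
  assumes \<Omega>: "open \<Omega>" "bounded \<Omega>" and T: "simplicial_triangulation \<Omega> T" and f: "f \<in> fe_space \<Omega> T k"
  shows "f \<in> Hinf 1 \<Omega>"
proof -
  have cont: "continuous_on (closure \<Omega>) f" and zero: "\<And>x. x \<notin> closure \<Omega> \<Longrightarrow> f x = 0"
    using f by (auto simp: fe_space_def)
  have "(\<lambda>x. indicator (closure \<Omega>) x *\<^sub>R f x) \<in> borel_measurable borel"
    by (intro borel_measurable_continuous_on_indicator cont) simp
  moreover have "(\<lambda>x. indicator (closure \<Omega>) x *\<^sub>R f x) = f" using zero by (auto simp: indicator_def fun_eq_iff)
  ultimately have meas: "f \<in> borel_measurable borel" by simp
  have "bounded (f ` closure \<Omega>)"
    using \<Omega> by (intro compact_imp_bounded compact_continuous_image cont) (simp add: compact_closure)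
  then obtain B where B: "\<And>x. x \<in> \<Omega> \<Longrightarrow> \<bar>f x\<bar> \<le> B" using closure_subset by (fastforce simp: bounded_iff)
  obtain L where L: "\<And>x y. closed_segment x y \<subseteq> \<Omega> \<Longrightarrow> \<bar>f y - f x\<bar> \<le> L * norm (y - x)"
    using fe_space_lipschitz_on_segments[OF T f] by blast
  have "f \<in> borel_measurable (lebesgue_on \<Omega>)"
    using meas by (intro measurable_restrict_space1 measurable_completion) simp
  then have "f \<in> Linf \<Omega>"
    unfolding Linf_def using B \<Omega>(1) by (auto simp: AE_restrict_space_iff intro!: exI[of _ B] AE_I2)
  then show ?thesis
    unfolding Hinf_1_iff
    using lipschitz_has_weak_partial[OF \<Omega> meas B L fe_space_difference_quotients_converge[OF T f]] by blast
qed

lemma polys_closed: "p \<in> polys k \<Longrightarrow> q \<in> polys k \<Longrightarrow> (\<lambda>x. p x + q x) \<in> polys k"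
  "p \<in> polys k \<Longrightarrow> (\<lambda>x. c * p x) \<in> polys k" "(\<lambda>x. 0) \<in> polys k"
proof -
  assume "p \<in> polys k"
  then obtain a where a: "\<forall>x. p x = (\<Sum>\<alpha> | (\<Sum>i\<in>UNIV. \<alpha> i) \<le> k. a \<alpha> * (\<Prod>i\<in>UNIV. (x $ i) ^ \<alpha> i))"
    by (auto simp: polys_def)
  show "(\<lambda>x. c * p x) \<in> polys k"
    unfolding polys_def using a
    by (auto intro!: exI[of _ "\<lambda>\<alpha>. c * a \<alpha>"] simp: sum_distrib_left mult.assoc)
  assume "q \<in> polys k"
  then obtain b where b: "\<forall>x. q x = (\<Sum>\<alpha> | (\<Sum>i\<in>UNIV. \<alpha> i) \<le> k. b \<alpha> * (\<Prod>i\<in>UNIV. (x $ i) ^ \<alpha> i))"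
    by (auto simp: polys_def)
  show "(\<lambda>x. p x + q x) \<in> polys k"
    unfolding polys_def using a b
    by (auto intro!: exI[of _ "\<lambda>\<alpha>. a \<alpha> + b \<alpha>"] simp: sum.distrib distrib_right)
next
  show "(\<lambda>x. 0) \<in> polys k" unfolding polys_def by (auto intro!: exI[of _ "\<lambda>_. 0"])
qed

lemma subspace_fe_space: "subspace (fe_space \<Omega> T k)"
  unfolding subspace_def
proof (intro conjI ballI allI)
  show "0 \<in> fe_space \<Omega> T k"
    unfolding fe_space_def zero_fun_def using polys_closed(3) by (auto intro!: bexI[of _ "\<lambda>x. 0"])
  fix f g c assume f: "f \<in> fe_space \<Omega> T k"
  have "\<exists>p\<in>polys k. \<forall>x\<in>S. c * f x = p x" if ST: "S \<in> T" for S
  proof -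
    obtain p where "p \<in> polys k" "\<forall>x\<in>S. f x = p x" using f ST unfolding fe_space_def by blast
    then show ?thesis by (intro bexI[of _ "\<lambda>x. c * p x"]) (auto intro: polys_closed)
  qed
  then show "c *\<^sub>R f \<in> fe_space \<Omega> T k"
    using f unfolding fe_space_def scaleR_fun_def by (auto intro!: continuous_intros)
  assume g: "g \<in> fe_space \<Omega> T k"
  have "\<exists>p\<in>polys k. \<forall>x\<in>S. f x + g x = p x" if ST: "S \<in> T" for S
  proof -
    obtain p where "p \<in> polys k" "\<forall>x\<in>S. f x = p x" using f ST unfolding fe_space_def by blast
    moreover obtain q where "q \<in> polys k" "\<forall>x\<in>S. g x = q x" using g ST unfolding fe_space_def by blast
    ultimately show ?thesis by (intro bexI[of _ "\<lambda>x. p x + q x"]) (auto intro: polys_closed)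
  qed
  then show "f + g \<in> fe_space \<Omega> T k"
    using f g unfolding fe_space_def plus_fun_def by (auto intro!: continuous_intros)
qed

lemma sum_fun_apply: "(\<Sum>i\<in>I. f i) x = (\<Sum>i\<in>I. f i x)"
  by (induction I rule: infinite_finite_induct) auto

text \<open>Let \<open>\<sigma>\<close> assign to every point of the domain one simplex that contains it. A finite element function
  is a linear combination of the monomials cut off to the sets where \<open>\<sigma> x = S\<close>. These generators are
  discontinuous, but it only matters that there are finitely many of them.\<close>

lemma finitely_spanned_fe_space:
  fixes \<Omega> :: "(real^'n) set"
  assumes T: "simplicial_triangulation \<Omega> T"
  shows "finitely_spanned (fe_space \<Omega> T k)"
proof -
  note T' = simplicial_triangulationD[OF T]
  define A where "A = {\<alpha> :: 'n \<Rightarrow> nat. (\<Sum>i\<in>UNIV. \<alpha> i) \<le> k}"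
  have "\<alpha> i \<le> k" if "\<alpha> \<in> A" for \<alpha> i
    using member_le_sum[of i UNIV \<alpha>] that by (simp add: A_def)
  then have "A \<subseteq> {\<alpha>. \<forall>i. (i \<in> UNIV \<longrightarrow> \<alpha> i \<in> {..k}) \<and> (i \<notin> UNIV \<longrightarrow> \<alpha> i = 0)}" by auto
  then have finA: "finite A" by (rule finite_subset) (intro finite_set_of_finite_funs; simp)
  have "\<forall>x\<in>closure \<Omega>. \<exists>S. S \<in> T \<and> x \<in> S" using T'(2) by blast
  then obtain \<sigma> where \<sigma>: "\<And>x. x \<in> closure \<Omega> \<Longrightarrow> \<sigma> x \<in> T \<and> x \<in> \<sigma> x" by metis
  define E where "E = (\<lambda>(S, \<alpha>) x. if x \<in> closure \<Omega> \<and> \<sigma> x = S then \<Prod>i\<in>UNIV. (x $ i) ^ \<alpha> i else (0::real))"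
  have "f \<in> span (E ` (T \<times> A))" if f: "f \<in> fe_space \<Omega> T k" for f
  proof -
    have "\<exists>c. \<forall>x\<in>S. f x = (\<Sum>\<alpha>\<in>A. c \<alpha> * (\<Prod>i\<in>UNIV. (x $ i) ^ \<alpha> i))" if ST: "S \<in> T" for S
    proof -
      obtain p where "p \<in> polys k" "\<forall>x\<in>S. f x = p x" using f ST unfolding fe_space_def by blast
      then show ?thesis unfolding polys_def A_def by fastforce
    qed
    then obtain c where c: "\<And>S x. S \<in> T \<Longrightarrow> x \<in> S \<Longrightarrow> f x = (\<Sum>\<alpha>\<in>A. c S \<alpha> * (\<Prod>i\<in>UNIV. (x $ i) ^ \<alpha> i))"
      by metis
    have "f x = (\<Sum>S\<in>T. \<Sum>\<alpha>\<in>A. c S \<alpha> * E (S, \<alpha>) x)" for x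
    proof (cases "x \<in> closure \<Omega>")
      case True
      have "(\<Sum>S\<in>T. \<Sum>\<alpha>\<in>A. c S \<alpha> * E (S, \<alpha>) x) =
          (\<Sum>S\<in>T. if S = \<sigma> x then \<Sum>\<alpha>\<in>A. c S \<alpha> * (\<Prod>i\<in>UNIV. (x $ i) ^ \<alpha> i) else 0)"
        using True by (intro sum.cong) (auto simp: E_def)
      also have "\<dots> = f x" using T'(1) \<sigma>[OF True] c[of "\<sigma> x" x] by (simp add: sum.delta)
      finally show ?thesis by simp
    next
      case False
      then have "f x = 0" using f by (simp add: fe_space_def)
      then show ?thesis using False by (simp add: E_def)
    qed
    then have "f = (\<Sum>S\<in>T. \<Sum>\<alpha>\<in>A. c S \<alpha> *\<^sub>R E (S, \<alpha>))"
      by (auto simp: fun_eq_iff sum_fun_apply)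
    also have "\<dots> \<in> span (E ` (T \<times> A))" by (intro span_sum span_scale span_base) auto
    finally show ?thesis .
  qed
  then show ?thesis unfolding finitely_spanned_def using T'(1) finA by (intro exI[of _ "E ` (T \<times> A)"]) auto
qed

lemma finitely_spanned_vec_space:
  fixes X :: "(real^'n \<Rightarrow> real) set"
  assumes "finitely_spanned X"
  shows "finitely_spanned (vec_space X)"
proof -
  obtain S where S: "finite S" "X \<subseteq> span S" using assms by (auto simp: finitely_spanned_def)
  define e where "e i f = (\<lambda>x. axis i (f x) :: real^'n)" for i and f :: "real^'n \<Rightarrow> real"
  have lin: "linear (e i)" for i
    by (rule linearI) (auto simp: e_def fun_eq_iff vec_eq_iff axis_def)
  let ?S = "\<Union>i\<in>UNIV. e i ` S"
  have "v \<in> span ?S" if v: "v \<in> vec_space X" for v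
  proof -
    have "e i (\<lambda>x. v x $ i) \<in> span ?S" for i
    proof -
      have "e i (\<lambda>x. v x $ i) \<in> e i ` span S" using v S by (auto simp: vec_space_def)
      also have "\<dots> = span (e i ` S)" by (rule linear_span_image[OF lin, symmetric])
      also have "\<dots> \<subseteq> span ?S" by (intro span_mono) auto
      finally show ?thesis .
    qed
    moreover have "v = (\<Sum>i\<in>UNIV. e i (\<lambda>x. v x $ i))"
      by (auto simp: fun_eq_iff sum_fun_apply vec_eq_iff e_def axis_def sum.delta if_distrib cong: if_cong)
    ultimately show ?thesis by (metis (no_types, lifting) span_sum)
  qed
  then show ?thesis unfolding finitely_spanned_def using S(1) by (intro exI[of _ ?S]) auto
qed

text \<open>The set where \<open>u\<close> does not vanish in \<open>\<Omega>\<close> is open and null, hence empty; continuity covers the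
  closure.\<close>

lemma zero_AE_imp_zero:
  fixes u :: "real^'n \<Rightarrow> 'b::real_normed_vector"
  assumes \<Omega>: "open \<Omega>" and AE: "AE x in lebesgue_on \<Omega>. u x = 0" and cont: "continuous_on (closure \<Omega>) u"
    and out: "\<And>x. x \<notin> closure \<Omega> \<Longrightarrow> u x = 0"
  shows "u = (\<lambda>x. 0)"
proof -
  have op: "open {x \<in> \<Omega>. u x \<noteq> 0}"
  proof -
    have "open (\<Omega> \<inter> u -` (- {0}))"
      using \<Omega> continuous_on_subset[OF cont closure_subset] by (intro continuous_open_preimage) auto
    moreover have "\<Omega> \<inter> u -` (- {0}) = {x \<in> \<Omega>. u x \<noteq> 0}" by auto
    ultimately show ?thesis by simp
  qed
  have "AE x in lebesgue. x \<notin> {x \<in> \<Omega>. u x \<noteq> 0}"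
    using AE \<Omega> by (subst (asm) AE_restrict_space_iff) auto
  then have "negligible {x \<in> \<Omega>. u x \<noteq> 0}"
    unfolding negligible_iff_null_sets using op by (subst AE_iff_null_sets) auto
  then have "{x \<in> \<Omega>. u x \<noteq> 0} = {}" using op open_not_negligible by blast
  then have "u x = 0" if "x \<in> closure \<Omega>" for x
    using continuous_constant_on_closure[OF cont _ that] by auto
  then show ?thesis using out by blast
qed

lemma L2_zero_imp_AE_zero:
  assumes "square_integrable M u" "(\<integral>x. u x \<bullet> u x \<partial>M) \<le> 0"
  shows "AE x in M. u x = 0"
proof -
  have "(\<integral>x. u x \<bullet> u x \<partial>M) = 0" using assms(2) by (intro antisym) auto
  then have "AE x in M. u x \<bullet> u x = 0"
    using assms(1) by (subst (asm) integral_nonneg_eq_0_iff_AE) (auto simp: square_integrable_def)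
  then show ?thesis by eventually_elim simp
qed

lemma H1_inner_definite_on_fe_space:
  fixes \<Omega> :: "(real^'n) set"
  assumes \<Omega>: "open \<Omega>" "bounded \<Omega>" and T: "simplicial_triangulation \<Omega> T" and f: "f \<in> fe_space \<Omega> T k"
    and "H1_inner \<Omega> f f \<le> 0"
  shows "f = 0"
proof -
  have "f \<in> H1 \<Omega>" using Hinf_1_subset_H1[OF \<Omega> fe_space_subset_Hinf_1[OF \<Omega> T f]] .
  moreover have "(LINT x|lebesgue_on \<Omega>. wgrad \<Omega> f x \<bullet> wgrad \<Omega> f x) \<ge> 0" by simp
  then have "(LINT x|lebesgue_on \<Omega>. f x \<bullet> f x) \<le> 0" using assms(5) unfolding H1_inner_def inner_real_def by linarith
  ultimately have "AE x in lebesgue_on \<Omega>. f x = 0"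
    by (intro L2_zero_imp_AE_zero H1_square_integrable)
  then have "f = (\<lambda>x. 0)" using f by (intro zero_AE_imp_zero[OF \<Omega>(1)]) (auto simp: fe_space_def)
  then show ?thesis by (simp add: zero_fun_def)
qed

lemma H1_inner_vec_definite_on_fe_space:
  fixes \<Omega> :: "(real^'n) set"
  assumes \<Omega>: "open \<Omega>" "bounded \<Omega>" and T: "simplicial_triangulation \<Omega> T"
    and u: "u \<in> vec_space (fe_space \<Omega> T k)" and "H1_inner_vec \<Omega> u u \<le> 0"
  shows "u = 0"
proof -
  have comp: "(\<lambda>x. u x $ i) \<in> fe_space \<Omega> T k" for i using u by (simp add: vec_space_def)
  have "square_integrable (lebesgue_on \<Omega>) (\<lambda>x. \<chi> i. u x $ i)"
    by (intro square_integrable_vec H1_square_integrable Hinf_1_subset_H1[OF \<Omega>] fe_space_subset_Hinf_1[OF \<Omega> T comp])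
  then have "square_integrable (lebesgue_on \<Omega>) u" by simp
  moreover have "(LINT x|lebesgue_on \<Omega>. wgrad_vec \<Omega> u x \<bullet> wgrad_vec \<Omega> u x) \<ge> 0" by simp
  then have "(LINT x|lebesgue_on \<Omega>. u x \<bullet> u x) \<le> 0" using assms(5) unfolding H1_inner_vec_def by linarith
  ultimately have "AE x in lebesgue_on \<Omega>. u x = 0" by (intro L2_zero_imp_AE_zero)
  moreover have "continuous_on (closure \<Omega>) (\<lambda>x. \<chi> i. u x $ i)"
    using comp by (intro continuous_on_vec_lambda) (auto simp: fe_space_def)
  moreover have "u x = 0" if "x \<notin> closure \<Omega>" for x
    using comp that by (auto simp: fe_space_def vec_eq_iff)
  ultimately have "u = (\<lambda>x. 0)" by (intro zero_AE_imp_zero[OF \<Omega>(1)]) auto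
  then show ?thesis by (simp add: zero_fun_def)
qed

section \<open>The discrete problem\<close>

text \<open>The projection is a definite description, so it says something only once the projection is known
  to exist uniquely; Riesz on \<open>W\<close> provides it. After that, the projection of \<open>u\<close> is determined by the functional
  \<open>H1_inner_vec \<Omega> u\<close> on \<open>W\<close>.\<close>

lemma proj_H1_eq_iff:
  fixes \<Omega> :: "(real^'n) set"
  assumes \<Omega>: "open \<Omega>" and W: "subspace W" "finitely_spanned W" "W \<subseteq> vec_space (H1 \<Omega>)"
    and definite: "\<And>w. w \<in> W \<Longrightarrow> H1_inner_vec \<Omega> w w \<le> 0 \<Longrightarrow> w = 0"
    and u: "u \<in> vec_space (H1 \<Omega>)" and v: "v \<in> vec_space (H1 \<Omega>)"
  shows "proj_H1 \<Omega> W u = proj_H1 \<Omega> W v \<longleftrightarrow> (\<forall>w\<in>W. H1_inner_vec \<Omega> u w = H1_inner_vec \<Omega> v w)"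
proof -
  note bil = H1_inner_vec_bilinear[OF \<Omega>]
  have sub: "subspace (vec_space (H1 \<Omega>))" by (intro subspace_vec_space subspace_H1 \<Omega>)
  note diff = functional_on_diff[OF bilinear_onD(1)[OF bil] sub]
  have proj: "proj_H1 \<Omega> W u \<in> W \<and> (\<forall>w\<in>W. H1_inner_vec \<Omega> (proj_H1 \<Omega> W u) w = H1_inner_vec \<Omega> u w)"
    and unique: "\<And>p. p \<in> W \<Longrightarrow> \<forall>w\<in>W. H1_inner_vec \<Omega> p w = H1_inner_vec \<Omega> u w \<Longrightarrow> proj_H1 \<Omega> W u = p"
    if u: "u \<in> vec_space (H1 \<Omega>)" for u
  proof -
    have char: "(\<forall>w\<in>W. H1_inner_vec \<Omega> (\<lambda>x. u x - p x) w = 0) \<longleftrightarrow>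
        (\<forall>w\<in>W. H1_inner_vec \<Omega> p w = H1_inner_vec \<Omega> u w)" if "p \<in> W" for p
    proof -
      have "(\<lambda>x. u x - p x) = u - p" by (simp add: fun_eq_iff)
      then have "H1_inner_vec \<Omega> (\<lambda>x. u x - p x) w = H1_inner_vec \<Omega> u w - H1_inner_vec \<Omega> p w" if "w \<in> W" for w
        using diff[of w u p] u \<open>p \<in> W\<close> that W(3) by auto
      then show ?thesis by auto
    qed
    obtain S where S: "finite S" "W = span S" using finitely_spanned_subspace_eq_span[OF W(1,2)] .
    have "\<exists>p\<in>span S. \<forall>w\<in>span S. H1_inner_vec \<Omega> p w = H1_inner_vec \<Omega> u w"
    proof (rule riesz_positive_definite[OF S(1)]; fold S(2))
      show "bilinear_on W W (H1_inner_vec \<Omega>)" by (rule bilinear_on_subset[OF bil W(3) W(3)])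
      show "functional_on W (H1_inner_vec \<Omega> u)"
        by (rule functional_on_subset[OF bilinear_onD(2)[OF bil u] W(3)])
      show "H1_inner_vec \<Omega> w w > 0" if "w \<in> W" "w \<noteq> 0" for w using definite[of w] that by force
    qed (rule form_symmetric)
    then obtain p where p: "p \<in> W" "\<forall>w\<in>W. H1_inner_vec \<Omega> p w = H1_inner_vec \<Omega> u w" using S by blast
    have eq: "q = p" if q: "q \<in> W" "\<forall>w\<in>W. H1_inner_vec \<Omega> q w = H1_inner_vec \<Omega> u w" for q
    proof -
      have d: "q - p \<in> W" using W(1) p q by (simp add: subspace_diff)
      have "H1_inner_vec \<Omega> (q - p) (q - p) = 0"
        using diff[of "q - p" q p] p q d W(3) by auto
      then show ?thesis using definite[OF d] by simp
    qed
    have "proj_H1 \<Omega> W u = p"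
      unfolding proj_H1_def
    proof (rule the_equality)
      show "p \<in> W \<and> (\<forall>w\<in>W. H1_inner_vec \<Omega> (\<lambda>x. u x - p x) w = 0)"
        using p(1) p(2) by (simp only: char[OF p(1)] simp_thms)
      fix q assume q: "q \<in> W \<and> (\<forall>w\<in>W. H1_inner_vec \<Omega> (\<lambda>x. u x - q x) w = 0)"
      then have "q \<in> W" by (rule conjunct1)
      from eq[OF this iffD1[OF char[OF this] conjunct2[OF q]]] show "q = p" .
    qed
    note pr = this
    show "proj_H1 \<Omega> W u \<in> W \<and> (\<forall>w\<in>W. H1_inner_vec \<Omega> (proj_H1 \<Omega> W u) w = H1_inner_vec \<Omega> u w)"
      unfolding pr using p by blast
    show "proj_H1 \<Omega> W u = q" if "q \<in> W" "\<forall>w\<in>W. H1_inner_vec \<Omega> q w = H1_inner_vec \<Omega> u w" for q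
      unfolding pr using eq[OF that] by simp
  qed
  show ?thesis
  proof
    assume "proj_H1 \<Omega> W u = proj_H1 \<Omega> W v"
    then show "\<forall>w\<in>W. H1_inner_vec \<Omega> u w = H1_inner_vec \<Omega> v w" using proj[OF u] proj[OF v] by simp
  next
    assume "\<forall>w\<in>W. H1_inner_vec \<Omega> u w = H1_inner_vec \<Omega> v w"
    then show "proj_H1 \<Omega> W u = proj_H1 \<Omega> W v" using unique[OF u, of "proj_H1 \<Omega> W v"] proj[OF v] by simp
  qed
qed

text \<open>If \<open>b(lam, \<cdot>)\<close> vanishes, then all quotients are zero and their supremum is at most zero (it is
  \<open>-\<infinity>\<close> if there are no nonzero functions). So \<open>\<parallel>lam\<parallel>\<^sub>1 \<le> 0\<close>.\<close>

lemma discrete_inf_sup_injective: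
  fixes \<Omega> :: "(real^'n) set"
  assumes \<Omega>: "open \<Omega>" "bounded \<Omega>" and T: "simplicial_triangulation \<Omega> T"
    and inf_sup: "discrete_inf_sup \<Omega> T k zhat \<beta>" and \<beta>: "\<beta> > 0"
    and lam: "lam \<in> fe_space \<Omega> T k"
    and zero: "\<And>v. v \<in> vec_space (fe_space \<Omega> T k) \<Longrightarrow> form_b \<Omega> zhat lam v = 0"
  shows "lam = 0"
proof -
  have "ereal (\<beta> * H1_norm \<Omega> lam) \<le>
      (SUP v\<in>fe_star \<Omega> T k zhat - {\<lambda>_. 0}. ereal (form_b \<Omega> zhat lam v / H1_norm_vec \<Omega> v))"
    using inf_sup lam by (simp add: discrete_inf_sup_def)
  also have "\<dots> \<le> 0" by (rule SUP_least) (auto simp: fe_star_def zero)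
  finally have "\<beta> * H1_norm \<Omega> lam \<le> 0" by simp
  then have "H1_inner \<Omega> lam lam \<le> 0" using \<beta> by (simp add: mult_le_0_iff H1_norm_def)
  then show ?thesis by (rule H1_inner_definite_on_fe_space[OF \<Omega> T lam])
qed

theorem lemma5p6:
  fixes \<Omega> :: "(real^'n) set"
    and z :: "real^'n \<Rightarrow> real" and zhat zvec :: "real^'n \<Rightarrow> real^'n"
    and H :: "real set" and T :: "real \<Rightarrow> (real^'n) set set"
    and k :: nat and \<beta> :: real
  assumes dim: "CARD('n) = 2 \<or> CARD('n) = 3"
    and domain: "polyhedral_lipschitz_domain \<Omega>"
    and k: "k \<ge> 1"
    and z: "z \<in> Hinf 1 \<Omega>"
    and zhat: "zhat \<in> vec_space (Hinf 1 \<Omega>)" "zhat \<in> vec_space (Hinf (k + 1) \<Omega>)"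
    and zhat_unit: "AE x in lebesgue_on \<Omega>. norm (zhat x) = 1"
    and zvec: "zvec = (\<lambda>x. z x *\<^sub>R zhat x)"
    and H: "H \<subseteq> {0<..}"
    and meshes: "\<And>h. h \<in> H \<Longrightarrow> simplicial_triangulation \<Omega> (T h) \<and> mesh_size (T h) = h"
    and regular: "shape_regular H T"
    and \<beta>: "\<beta> > 0"
  shows "\<forall>h\<in>H. discrete_inf_sup \<Omega> (T h) k zhat \<beta> \<longrightarrow>
    (\<exists>!(u, lam).
       u \<in> vec_space (fe_space \<Omega> (T h) k) \<and> lam \<in> fe_space \<Omega> (T h) k \<and>
       proj_H1 \<Omega> (rigid_ker \<Omega> (T h) k zhat) u = proj_H1 \<Omega> (rigid_ker \<Omega> (T h) k zhat) zvec \<and>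
       (\<forall>v\<in>vec_space (fe_space \<Omega> (T h) k). form_a \<Omega> u v + form_b \<Omega> zhat lam v = 0) \<and>
       (\<forall>\<mu>\<in>fe_space \<Omega> (T h) k.
          form_b \<Omega> zhat \<mu> u = form_b \<Omega> zhat \<mu> zvec \<and>
          form_b \<Omega> zhat \<mu> zvec = H1_inner \<Omega> \<mu> z))"
proof (intro ballI impI)
  fix h assume h: "h \<in> H" and inf_sup: "discrete_inf_sup \<Omega> (T h) k zhat \<beta>"
  have \<Omega>: "open \<Omega>" "bounded \<Omega>" using domain by (auto simp: polyhedral_lipschitz_domain_def)
  have T: "simplicial_triangulation \<Omega> (T h)" using meshes[OF h] by simp
  let ?V = "fe_space \<Omega> (T h) k"
  let ?U = "vec_space ?V"
  let ?R = "rigid_ker \<Omega> (T h) k zhat"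
  have V_Hinf: "f \<in> Hinf 1 \<Omega>" if "f \<in> ?V" for f by (rule fe_space_subset_Hinf_1[OF \<Omega> T that])
  have V_H1: "?V \<subseteq> H1 \<Omega>" using V_Hinf Hinf_1_subset_H1[OF \<Omega>] by blast
  have U_H1: "?U \<subseteq> vec_space (H1 \<Omega>)" using V_H1 unfolding vec_space_def by blast
  have U_Hinf: "?U \<subseteq> vec_space (Hinf 1 \<Omega>)" using V_Hinf unfolding vec_space_def by blast
  have dot_H1: "(\<lambda>x. v x \<bullet> zhat x) \<in> H1 \<Omega>" if "v \<in> vec_space (Hinf 1 \<Omega>)" for v
    by (rule Hinf_1_subset_H1[OF \<Omega> Hinf_1_inner[OF \<Omega> that zhat(1)]])
  have zvec_Hinf: "zvec \<in> vec_space (Hinf 1 \<Omega>)"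
    unfolding vec_space_def
  proof (intro CollectI allI)
    fix i
    have "(\<lambda>x. zhat x $ i) \<in> Hinf 1 \<Omega>" using zhat(1) unfolding vec_space_def by blast
    from Hinf_1_mult[OF \<Omega> z this] show "(\<lambda>x. zvec x $ i) \<in> Hinf 1 \<Omega>"
      unfolding zvec vector_scaleR_component real_scaleR_def .
  qed
  have zvec_H1: "zvec \<in> vec_space (H1 \<Omega>)"
    using zvec_Hinf Hinf_1_subset_H1[OF \<Omega>] unfolding vec_space_def by blast
  have z_H1: "z \<in> H1 \<Omega>" by (rule Hinf_1_subset_H1[OF \<Omega> z])
  \<comment> \<open>The scalar product \<open>zvec \<bullet> zhat = z * (norm zhat)\<^sup>2\<close> equals \<open>z\<close> almost everywhere.\<close>
  have b_zvec: "form_b \<Omega> zhat \<mu> zvec = H1_inner \<Omega> \<mu> z" if "\<mu> \<in> ?V" for \<mu>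
    unfolding form_b_def
  proof (rule H1_inner_cong_AE[OF \<Omega>(1) _ dot_H1[OF zvec_Hinf] z_H1])
    show "\<mu> \<in> H1 \<Omega>" using that V_H1 by blast
    show "AE x in lebesgue_on \<Omega>. zvec x \<bullet> zhat x = z x"
      using zhat_unit by eventually_elim (simp add: zvec flip: power2_norm_eq_inner)
  qed
  have U: "subspace ?U" by (intro subspace_vec_space subspace_fe_space)
  have fU: "finitely_spanned ?U" by (intro finitely_spanned_vec_space finitely_spanned_fe_space T)
  have definite: "w = 0" if "w \<in> ?U" "H1_inner_vec \<Omega> w w \<le> 0" for w
    by (rule H1_inner_vec_definite_on_fe_space[OF \<Omega> T that])
  have b: "bilinear_on ?V ?U (form_b \<Omega> zhat)"
    unfolding bilinear_on_def
  proof (intro conjI ballI)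
    note bil = H1_inner_bilinear[OF \<Omega>(1)]
    fix v assume "v \<in> ?U"
    then have "(\<lambda>x. v x \<bullet> zhat x) \<in> H1 \<Omega>" using dot_H1 U_Hinf by blast
    from functional_on_subset[OF bilinear_onD(1)[OF bil this] V_H1]
    show "functional_on ?V (\<lambda>lam. form_b \<Omega> zhat lam v)" by (simp add: form_b_def)
  next
    note bil = H1_inner_bilinear[OF \<Omega>(1)]
    fix lam assume "lam \<in> ?V"
    then have lin: "functional_on (H1 \<Omega>) (H1_inner \<Omega> lam)" using V_H1 by (intro bilinear_onD(2)[OF bil]) blast
    show "functional_on ?U (form_b \<Omega> zhat lam)"
      unfolding functional_on_def
    proof (intro conjI ballI allI)
      fix u v c assume uv: "u \<in> ?U" "v \<in> ?U"
      have e: "(\<lambda>x. (u + v) x \<bullet> zhat x) = (\<lambda>x. u x \<bullet> zhat x) + (\<lambda>x. v x \<bullet> zhat x)"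
        "(\<lambda>x. (c *\<^sub>R u) x \<bullet> zhat x) = c *\<^sub>R (\<lambda>x. u x \<bullet> zhat x)"
        by (simp_all add: fun_eq_iff inner_add_left)
      have m: "(\<lambda>x. u x \<bullet> zhat x) \<in> H1 \<Omega>" "(\<lambda>x. v x \<bullet> zhat x) \<in> H1 \<Omega>"
        using uv U_Hinf by (auto intro!: dot_H1)
      show "form_b \<Omega> zhat lam (u + v) = form_b \<Omega> zhat lam u + form_b \<Omega> zhat lam v"
        unfolding form_b_def e by (rule functional_onD(1)[OF lin m])
      show "form_b \<Omega> zhat lam (c *\<^sub>R u) = c * form_b \<Omega> zhat lam u"
        unfolding form_b_def e by (rule functional_onD(2)[OF lin m(1)])
    qed
  qed
  have R: "?R = {r \<in> ?U. form_a \<Omega> r r = 0 \<and> (\<forall>q\<in>?V. form_b \<Omega> zhat q r = 0)}"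
    using U_H1 unfolding rigid_ker_def ker_b_def rigid_motions_def by blast
  have a: "bilinear_on ?U ?U (form_a \<Omega>)" by (rule bilinear_on_subset[OF form_a_bilinear[OF \<Omega>(1)] U_H1 U_H1])
  have ip: "bilinear_on ?U ?U (H1_inner_vec \<Omega>)"
    by (rule bilinear_on_subset[OF H1_inner_vec_bilinear[OF \<Omega>(1)] U_H1 U_H1])
  have R_sub: "subspace ?R"
    unfolding R by (rule subspace_degenerate_vectors[OF U a form_symmetric(2,3) b])
  have R_U: "?R \<subseteq> ?U" unfolding R by blast
  have proj: "proj_H1 \<Omega> ?R u = proj_H1 \<Omega> ?R zvec \<longleftrightarrow> (\<forall>r\<in>?R. H1_inner_vec \<Omega> u r = H1_inner_vec \<Omega> zvec r)"
    if "u \<in> ?U" for u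
    by (rule proj_H1_eq_iff[OF \<Omega>(1) R_sub finitely_spanned_subset[OF fU R_U] _ _ _ zvec_H1])
      (use R_U U_H1 definite that in blast)+
  have "\<exists>!(u, lam). u \<in> ?U \<and> lam \<in> ?V \<and> (\<forall>r\<in>?R. H1_inner_vec \<Omega> u r = H1_inner_vec \<Omega> zvec r) \<and>
      (\<forall>v\<in>?U. form_a \<Omega> u v + form_b \<Omega> zhat lam v = 0) \<and> (\<forall>\<mu>\<in>?V. form_b \<Omega> zhat \<mu> u = H1_inner \<Omega> \<mu> z)"
  proof (rule constrained_saddle_point_ex1[OF U fU subspace_fe_space finitely_spanned_fe_space[OF T]
        a form_symmetric(2,3) b ip form_symmetric(1) _ _ R])
    show "H1_inner_vec \<Omega> u u > 0" if "u \<in> ?U" "u \<noteq> 0" for u using definite[of u] that by force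
    show "q = 0" if "q \<in> ?V" "\<And>v. v \<in> ?U \<Longrightarrow> form_b \<Omega> zhat q v = 0" for q
      by (rule discrete_inf_sup_injective[OF \<Omega> T inf_sup \<beta> that])
    show "functional_on ?V (\<lambda>\<mu>. H1_inner \<Omega> \<mu> z)"
      by (rule functional_on_subset[OF bilinear_onD(1)[OF H1_inner_bilinear[OF \<Omega>(1)] z_H1] V_H1])
    show "functional_on ?R (H1_inner_vec \<Omega> zvec)"
      by (rule functional_on_subset[OF bilinear_onD(2)[OF H1_inner_vec_bilinear[OF \<Omega>(1)] zvec_H1]])
        (use R_U U_H1 in blast)
  qed
  moreover have "(u \<in> ?U \<and> lam \<in> ?V \<and> proj_H1 \<Omega> ?R u = proj_H1 \<Omega> ?R zvec \<and>
      (\<forall>v\<in>?U. form_a \<Omega> u v + form_b \<Omega> zhat lam v = 0) \<and>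
      (\<forall>\<mu>\<in>?V. form_b \<Omega> zhat \<mu> u = form_b \<Omega> zhat \<mu> zvec \<and> form_b \<Omega> zhat \<mu> zvec = H1_inner \<Omega> \<mu> z)) \<longleftrightarrow>
    (u \<in> ?U \<and> lam \<in> ?V \<and> (\<forall>r\<in>?R. H1_inner_vec \<Omega> u r = H1_inner_vec \<Omega> zvec r) \<and>
      (\<forall>v\<in>?U. form_a \<Omega> u v + form_b \<Omega> zhat lam v = 0) \<and> (\<forall>\<mu>\<in>?V. form_b \<Omega> zhat \<mu> u = H1_inner \<Omega> \<mu> z))" for u lam
    using proj[of u] b_zvec by auto
  ultimately show "\<exists>!(u, lam). u \<in> ?U \<and> lam \<in> ?V \<and> proj_H1 \<Omega> ?R u = proj_H1 \<Omega> ?R zvec \<and>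
      (\<forall>v\<in>?U. form_a \<Omega> u v + form_b \<Omega> zhat lam v = 0) \<and>
      (\<forall>\<mu>\<in>?V. form_b \<Omega> zhat \<mu> u = form_b \<Omega> zhat \<mu> zvec \<and> form_b \<Omega> zhat \<mu> zvec = H1_inner \<Omega> \<mu> z)"
    by (simp only:)
qed

end
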